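(* For all $\alpha,\beta>0$ with $0<\alpha\beta\le 1$ and every $1<q\le 2$ there exists a function $g\in M^q(\mathbb{R})$ for which $\mathcal{G}(g,\alpha,\beta)$ is a frame for $L^2(\mathbb{R})$ but $g\notin M^p(\mathbb{R})$ for any $1\le p<q$. Moreover, if $q=2$, then for all $\alpha,\beta>0$ with $0<\alpha\beta\le\frac12$ there exists $g\in M^2(\mathbb{R})$ for which $\mathcal{G}(g,\alpha,\beta)$ is a Parseval frame for $L^2(\mathbb{R})$ but $g\notin M^p(\mathbb{R})$ for any $1\le p<2$.
   Context: For $x,\xi\in\mathbb{R}$, $(T_xg)(t)=g(t-x)$ and $(M_\xi g)(t)=e^{2\pi i\xi t}g(t)$. For $\alpha,\beta>0$ and $g\in L^2(\mathbb{R})$, the Gabor system is $\mathcal{G}(g,\alpha,\beta)=\{M_{\beta n}T_{\alpha k}g\}_{k,n\in\mathbb{Z}}$. It is a (Gabor) frame for $L^2(\mathbb{R})$ if there are constants $A,B>0$ with $A\|f\|_{L^2}^2\le\sum_{k,n\in\mathbb{Z}}|\langle f,M_{\beta n}T_{\alpha k}g\rangle|^2\le B\|f\|_{L^2}^2$ for all $f\in L^2(\mathbb{R})$; it is a Parseval frame if one can take $A=B=1$. Fix a nonzero Schwartz function $\psi\in S(\mathbb{R})$. The short-time Fourier transform of a tempered distribution $f$ is $V_\psi f(x,w)=\langle f,M_wT_x\psi\rangle$ (conjugate-linear in the second slot). For $1\le p\le\infty$, $M^p(\mathbb{R})$ is the space of all $f\in S'(\mathbb{R})$ with $\|f\|_{M^p(\mathbb{R})}=\|V_\psi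 f\|_{L^p(\mathbb{R}^2)}<\infty$. Different nonzero $\psi\in S(\mathbb{R})$ give the same space with equivalent norms, and $M^2(\mathbb{R})=L^2(\mathbb{R})$. *)

theory Defs
  imports "HOL-Analysis.Analysis"
begin

section \<open>Lebesgue spaces\<close>

text \<open>Only finite exponents \<open>p \<ge> 1\<close> are used.  Functions are not identified almost everywhere.\<close>

definition Lp_norm :: "'a measure \<Rightarrow> real \<Rightarrow> ('a \<Rightarrow> complex) \<Rightarrow> ennreal" where
  "Lp_norm M p f =
     (let I = (\<integral>\<^sup>+ x. ennreal (norm (f x) powr p) \<partial>M)
      in if I = top then top else ennreal (enn2real I powr (1 / p)))"

definition L2 :: "(real \<Rightarrow> complex) set" where
  "L2 = {f \<in> borel_measurable lborel. Lp_norm lborel 2 f < top}"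

definition L2_inner :: "(real \<Rightarrow> complex) \<Rightarrow> (real \<Rightarrow> complex) \<Rightarrow> complex" where
  "L2_inner f h = (LINT t|lborel. f t * cnj (h t))"


section \<open>Frames and Gabor systems\<close>

definition translation :: "real \<Rightarrow> (real \<Rightarrow> complex) \<Rightarrow> real \<Rightarrow> complex" where
  "translation x g = (\<lambda>t. g (t - x))"

definition modulation :: "real \<Rightarrow> (real \<Rightarrow> complex) \<Rightarrow> real \<Rightarrow> complex" where
  "modulation \<xi> g = (\<lambda>t. exp (2 * of_real pi * \<i> * of_real \<xi> * of_real t) * g t)"

definition gabor_system ::
  "(real \<Rightarrow> complex) \<Rightarrow> real \<Rightarrow> real \<Rightarrow> int \<times> int \<Rightarrow> real \<Rightarrow> complex" where
  "gabor_system g \<alpha> \<beta> =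
     (\<lambda>(k, n). modulation (\<beta> * of_int n) (translation (\<alpha> * of_int k) g))"

text \<open>The sum is taken in \<^typ>\<open>ennreal\<close>, where it always exists, so the upper bound
  includes the convergence of the sum.\<close>

definition has_frame_bounds :: "('i \<Rightarrow> real \<Rightarrow> complex) \<Rightarrow> real \<Rightarrow> real \<Rightarrow> bool" where
  "has_frame_bounds e A B \<longleftrightarrow>
     (\<forall>f \<in> L2.
        ennreal A * (Lp_norm lborel 2 f)\<^sup>2 \<le> (\<Sum>\<^sub>\<infinity>i\<in>UNIV. ennreal ((norm (L2_inner f (e i)))\<^sup>2)) \<and>
        (\<Sum>\<^sub>\<infinity>i\<in>UNIV. ennreal ((norm (L2_inner f (e i)))\<^sup>2)) \<le> ennreal B * (Lp_norm lborel 2 f)\<^sup>2)"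

definition is_frame :: "('i \<Rightarrow> real \<Rightarrow> complex) \<Rightarrow> bool" where
  "is_frame e \<longleftrightarrow> (\<exists>A>0. \<exists>B>0. has_frame_bounds e A B)"

definition is_parseval_frame :: "('i \<Rightarrow> real \<Rightarrow> complex) \<Rightarrow> bool" where
  "is_parseval_frame e \<longleftrightarrow> has_frame_bounds e 1 1"


section \<open>Schwartz functions and tempered distributions\<close>

definition nth_deriv :: "nat \<Rightarrow> (real \<Rightarrow> complex) \<Rightarrow> real \<Rightarrow> complex" where
  "nth_deriv n = ((\<lambda>f x. vector_derivative f (at x)) ^^ n)"

definition schwartz :: "(real \<Rightarrow> complex) set" where
  "schwartz = {\<phi>. (\<forall>n x. nth_deriv n \<phi> differentiable (at x)) \<and>
                   (\<forall>m n. bounded (range (\<lambda>x. of_real (x ^ m) * nth_deriv n \<phi> x)))}"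

definition schwartz_seminorm :: "nat \<Rightarrow> nat \<Rightarrow> (real \<Rightarrow> complex) \<Rightarrow> real" where
  "schwartz_seminorm m n \<phi> = (SUP x. norm (of_real (x ^ m) * nth_deriv n \<phi> x))"

definition schwartz_topology :: "(real \<Rightarrow> complex) topology" where
  "schwartz_topology = topology_generated_by
     {{\<eta> \<in> schwartz. schwartz_seminorm m n (\<lambda>x. \<eta> x - \<phi> x) < \<epsilon>} | m n \<phi> \<epsilon>.
        \<phi> \<in> schwartz \<and> \<epsilon> > 0}"

text \<open>Continuous (complex-)linear functionals on the Schwartz space, extended by
  \<^const>\<open>undefined\<close> outside it so that they are determined by their values on Schwartz functions.\<close>

definition tempered_distributions :: "((real \<Rightarrow> complex) \<Rightarrow> complex) set" where
  "tempered_distributions = {u \<in> extensional schwartz.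
     (\<forall>\<phi>\<in>schwartz. \<forall>\<eta>\<in>schwartz. u (\<lambda>x. \<phi> x + \<eta> x) = u \<phi> + u \<eta>) \<and>
     (\<forall>c. \<forall>\<phi>\<in>schwartz. u (\<lambda>x. c * \<phi> x) = c * u \<phi>) \<and>
     continuous_map schwartz_topology euclidean u}"

text \<open>The usual embedding of functions, such as those in \<^const>\<open>L2\<close>, into the tempered
  distributions.\<close>

definition distribution_of :: "(real \<Rightarrow> complex) \<Rightarrow> (real \<Rightarrow> complex) \<Rightarrow> complex" where
  "distribution_of g = (\<lambda>\<phi>\<in>schwartz. LINT t|lborel. g t * \<phi> t)"


section \<open>Modulation spaces\<close>

text \<open>The pairing \<open>\<langle>u, \<phi>\<rangle>\<close> extending the \<open>L\<^sup>2\<close> inner product is conjugate-linear in \<open>\<phi>\<close>,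
  whereas distributions are linear functionals here; hence the complex conjugate.\<close>

definition stft ::
  "(real \<Rightarrow> complex) \<Rightarrow> ((real \<Rightarrow> complex) \<Rightarrow> complex) \<Rightarrow> real \<times> real \<Rightarrow> complex" where
  "stft \<psi> u = (\<lambda>(x, w). u (\<lambda>t. cnj (modulation w (translation x \<psi>) t)))"

definition modulation_norm ::
  "(real \<Rightarrow> complex) \<Rightarrow> real \<Rightarrow> ((real \<Rightarrow> complex) \<Rightarrow> complex) \<Rightarrow> ennreal" where
  "modulation_norm \<psi> p u = Lp_norm lborel p (stft \<psi> u)"

text \<open>No measurability requirement is needed: the short-time Fourier transform of a tempered
  distribution is continuous.\<close>

definition modulation_space ::
  "(real \<Rightarrow> complex) \<Rightarrow> real \<Rightarrow> ((real \<Rightarrow> complex) \<Rightarrow> complex) set" where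
  "modulation_space \<psi> p = {u \<in> tempered_distributions. modulation_norm \<psi> p u < top}"

end

theory Submission
  imports Defs
begin

text \<open>
  The window is \<open>sqrt \<beta>\<close> times a function \<open>u\<close> of modulus one on \<open>[0, \<alpha>)\<close> and zero elsewhere.
  Because \<open>\<alpha> \<le> 1 / \<beta>\<close>, each translate of the window lives on one period of the modulations, so
  Parseval's identity for Fourier series turns the frame sum into
  \<open>\<integral> \<bar>f(t)\<bar>\<^sup>2 \<Sum>\<^sub>k \<bar>u(t - \<alpha> k)\<bar>\<^sup>2 dt\<close> (\<open>gabor_frame_sum_compact_support\<close>), and the inner sum is one
  because the translates of \<open>[0, \<alpha>)\<close> tile the line.  The system is a Parseval frame whatever the
  phase of \<open>u\<close> is; the phase is free to place \<open>u\<close> in the scale of modulation spaces.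

  The phase consists of chirps \<open>exp (i L (t - s)\<^sup>2)\<close> on consecutive intervals of length \<open>l\<close>.  The
  short-time Fourier transform of such a piece has size about \<open>1 / sqrt L\<close> on a frequency band of
  width about \<open>L l\<close> and at most of order \<open>1 / \<bar>w\<bar>\<close> outside it (\<open>STFT_chirp_piece_bound\<close>), so the \<open>r\<close>-th
  power of its \<open>L\<^sup>r\<close> norm is of order \<open>L\<^sup>1\<^sup>-\<^sup>r\<^sup>/\<^sup>2 l\<close> up to a smaller tail.  With \<open>L = exp (N\<^sup>2)\<close>
  and \<open>l\<close> proportional to \<open>L\<^sup>q\<^sup>/\<^sup>2\<^sup>-\<^sup>1 exp (- 3 N)\<close> for the \<open>N\<close>-th piece, these quantities are summable
  for \<open>r = q\<close>, with room for a geometric factor that replaces Minkowski's inequality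
  (\<open>STFT_train_Lq\<close>).

  For \<open>1 < p < q\<close> the same upper bounds are used, now for the conjugate exponent \<open>r\<close> of \<open>p\<close>.  The
  inner product of \<open>u\<close> with its \<open>N\<close>-th piece is the length \<open>l\<close>.  Moyal's identity carries it to the
  transforms, where Young's inequality, applied to the piece multiplied by \<open>exp N / l\<close>, bounds a
  constant times \<open>exp N\<close> by the \<open>p\<close>-th power of the \<open>L\<^sup>p\<close> norm of the transform of \<open>u\<close> plus a
  quantity that stays bounded in \<open>N\<close> (\<open>train_duality\<close>, \<open>rescaled_plateau_integral_bounded\<close>).  So
  that norm is infinite, and \<open>p = 1\<close> follows because the transform is bounded
  (\<open>STFT_train_not_Lp\<close>).
\<close>

section \<open>Parseval's identity for Fourier series on an interval\<close>

definition harmonic :: "real \<Rightarrow> int \<Rightarrow> real \<Rightarrow> complex" where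
  "harmonic \<beta> n t = cis (2 * pi * \<beta> * of_int n * t)"

definition trig_poly :: "real \<Rightarrow> int set \<Rightarrow> (int \<Rightarrow> complex) \<Rightarrow> real \<Rightarrow> complex" where
  "trig_poly \<beta> F c t = (\<Sum>n\<in>F. c n * harmonic \<beta> n t)"

definition period_measure :: "real \<Rightarrow> real \<Rightarrow> real measure" where
  "period_measure a \<beta> = restrict_space lborel {a..a + 1 / \<beta>}"

lemma norm_harmonic [simp]: "norm (harmonic \<beta> n t) = 1"
  by (simp add: harmonic_def)

lemma continuous_harmonic [continuous_intros]: "continuous_on S (harmonic \<beta> n)"
  unfolding harmonic_def by (intro continuous_intros)

lemma continuous_trig_poly [continuous_intros]: "continuous_on S (trig_poly \<beta> F c)"
  unfolding trig_poly_def by (intro continuous_intros)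

lemma space_period_measure [simp]: "space (period_measure a \<beta>) = {a..a + 1 / \<beta>}"
  by (simp add: period_measure_def space_restrict_space)

lemma finite_period_measure: "\<beta> > 0 \<Longrightarrow> finite_measure (period_measure a \<beta>)"
  by (intro finite_measureI) (simp add: period_measure_def emeasure_restrict_space space_restrict_space)

lemma continuous_measurable_period_measure:
  assumes "continuous_on {a..a + 1 / \<beta>} f"
  shows "f \<in> borel_measurable (period_measure a \<beta>)"
proof -
  have "f \<in> borel_measurable (restrict_space borel {a..a + 1 / \<beta>})"
    using assms by (rule borel_measurable_continuous_on_restrict)
  then show ?thesis
    unfolding period_measure_def
    by (simp cong: measurable_cong_sets sets_restrict_space_cong)
qed

lemma integrable_period_measure_bounded:
  fixes f :: "real \<Rightarrow> 'b::{banach,second_countable_topology}"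
  assumes "\<beta> > 0" "f \<in> borel_measurable (period_measure a \<beta>)"
    and "\<And>t. t \<in> {a..a + 1 / \<beta>} \<Longrightarrow> norm (f t) \<le> K"
  shows "integrable (period_measure a \<beta>) f"
proof -
  interpret finite_measure "period_measure a \<beta>" using assms(1) by (rule finite_period_measure)
  show ?thesis
    by (rule integrable_const_bound[where B=K]) (use assms in \<open>auto intro!: AE_I2\<close>)
qed

lemma borel_measurable_cnj [measurable (raw)]:
  "f \<in> borel_measurable M \<Longrightarrow> (\<lambda>x. cnj (f x)) \<in> borel_measurable M"
  by (rule measurable_compose[OF _ borel_measurable_continuous_onI[OF continuous_on_cnj[OF continuous_on_id]]])

lemma measurable_harmonic [measurable]:
  "harmonic \<beta> n \<in> borel_measurable (period_measure a \<gamma>)"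
  by (intro continuous_measurable_period_measure continuous_harmonic)

lemma measurable_trig_poly [measurable]:
  "trig_poly \<beta> F c \<in> borel_measurable (period_measure a \<gamma>)"
  by (intro continuous_measurable_period_measure continuous_trig_poly)

lemma norm_trig_poly_le: "norm (trig_poly \<beta> F c t) \<le> (\<Sum>n\<in>F. norm (c n))"
  unfolding trig_poly_def by (rule order.trans[OF norm_sum]) (simp add: norm_mult)

lemma harmonic_orthogonal:
  assumes "\<beta> > 0"
  shows "(LINT t|period_measure a \<beta>. harmonic \<beta> n t * cnj (harmonic \<beta> m t)) =
    (if n = m then 1 / \<beta> else 0)"
proof -
  define d where "d = n - m"
  define L where "L = 2 * pi * \<beta> * of_int d"
  have e: "harmonic \<beta> n t * cnj (harmonic \<beta> m t) = cis (L * t)" for t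
    by (simp add: harmonic_def cis_cnj cis_mult L_def d_def algebra_simps)
  have c: "continuous_on {a..a + 1 / \<beta>} (\<lambda>t. cis (L * t))"
    by (intro continuous_intros)
  have "(LINT t|period_measure a \<beta>. cis (L * t)) = (LINT t:{a..a + 1 / \<beta>}|lborel. cis (L * t))"
    unfolding period_measure_def set_lebesgue_integral_def
    by (rule integral_restrict_space) auto
  also have "\<dots> = integral {a..a + 1 / \<beta>} (\<lambda>t. cis (L * t))"
    by (intro set_borel_integral_eq_integral borel_integrable_atLeastAtMost' c)
  also have "\<dots> = (if d = 0 then 1 / \<beta> else 0)"
  proof (cases "d = 0")
    case True
    then show ?thesis using assms by (simp add: L_def scaleR_conv_of_real)
  next
    case False
    with assms have L: "L \<noteq> 0" by (simp add: L_def)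
    have "((\<lambda>t. cis (L * t)) has_integral (cis (L * (a + 1 / \<beta>)) / (\<i> * L) - cis (L * a) / (\<i> * L))) {a..a + 1 / \<beta>}"
    proof (rule fundamental_theorem_of_calculus)
      show "a \<le> a + 1 / \<beta>" using assms by simp
      fix x assume "x \<in> {a..a + 1 / \<beta>}"
      show "((\<lambda>t. cis (L * t) / (\<i> * L)) has_vector_derivative cis (L * x)) (at x within {a..a + 1 / \<beta>})"
        unfolding cis_conv_exp
        by (rule has_vector_derivative_real_field derivative_eq_intros refl | simp add: L mult.commute[of _ \<i>])+
    qed
    moreover have "cis (L * (a + 1 / \<beta>)) = cis (L * a)"
    proof -
      have "L * (a + 1 / \<beta>) = L * a + 2 * pi * of_int d"
        using assms by (simp add: L_def field_simps)
      then show ?thesis by (metis cis_mult cis_multiple_2pi Ints_of_int mult.right_neutral)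
    qed
    ultimately show ?thesis using False by (simp add: integral_unique)
  qed
  finally show ?thesis by (simp add: e d_def)
qed

lemma integrable_from_square:
  fixes h :: "real \<Rightarrow> complex"
  assumes "\<beta> > 0" and h: "h \<in> borel_measurable (period_measure a \<beta>)"
    and h2: "integrable (period_measure a \<beta>) (\<lambda>t. (norm (h t))\<^sup>2)"
  shows "integrable (period_measure a \<beta>) h"
proof -
  interpret finite_measure "period_measure a \<beta>" using assms(1) by (rule finite_period_measure)
  have "integrable (period_measure a \<beta>) (\<lambda>t. 1 + (norm (h t))\<^sup>2)"
    using h2 by (intro Bochner_Integration.integrable_add) auto
  then show ?thesis
  proof (rule Bochner_Integration.integrable_bound)
    show "AE x in period_measure a \<beta>. norm (h x) \<le> norm (1 + (norm (h x))\<^sup>2)"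
    proof (intro AE_I2)
      fix x
      have "0 \<le> (norm (h x) - 1 / 2)\<^sup>2" by simp
      then show "norm (h x) \<le> norm (1 + (norm (h x))\<^sup>2)"
        by (simp add: power2_eq_square algebra_simps)
    qed
  qed (use h in auto)
qed

definition fourier_coeff :: "real \<Rightarrow> real \<Rightarrow> (real \<Rightarrow> complex) \<Rightarrow> int \<Rightarrow> complex" where
  "fourier_coeff a \<beta> h n = (LINT t|period_measure a \<beta>. h t * cnj (harmonic \<beta> n t))"

text \<open>Expanding the square and completing it: this single identity gives Bessel's inequality
  (take \<open>c\<close> to be the normalised coefficients) and the best approximation property.\<close>

lemma square_distance_trig_poly:
  fixes h :: "real \<Rightarrow> complex"
  assumes \<beta>: "\<beta> > 0" and F: "finite F" and h[measurable]: "h \<in> borel_measurable (period_measure a \<beta>)"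
    and h2: "integrable (period_measure a \<beta>) (\<lambda>t. (norm (h t))\<^sup>2)"
  shows "(LINT t|period_measure a \<beta>. (norm (h t - trig_poly \<beta> F c t))\<^sup>2) =
     (LINT t|period_measure a \<beta>. (norm (h t))\<^sup>2) - \<beta> * (\<Sum>n\<in>F. (norm (fourier_coeff a \<beta> h n))\<^sup>2)
      + 1 / \<beta> * (\<Sum>n\<in>F. (norm (c n - \<beta> * fourier_coeff a \<beta> h n))\<^sup>2)"
proof -
  let ?M = "period_measure a \<beta>"
  let ?P = "trig_poly \<beta> F c"
  have hi: "integrable ?M h" by (rule integrable_from_square[OF \<beta> h h2])
  have hn: "integrable ?M (\<lambda>t. h t * cnj (harmonic \<beta> n t))" for n
    by (rule Bochner_Integration.integrable_bound[OF hi])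
       (auto simp: norm_mult)
  have nn: "integrable ?M (\<lambda>t. harmonic \<beta> n t * cnj (harmonic \<beta> m t))" for n m
    by (rule integrable_period_measure_bounded[OF \<beta>, where K=1]) (auto simp: norm_mult)
  have hP: "(\<lambda>t. h t * cnj (?P t)) = (\<lambda>t. \<Sum>n\<in>F. cnj (c n) * (h t * cnj (harmonic \<beta> n t)))"
    by (simp add: trig_poly_def sum_distrib_left mult_ac)
  have ihP: "integrable ?M (\<lambda>t. h t * cnj (?P t))"
    unfolding hP using hn by (intro Bochner_Integration.integrable_sum integrable_mult_right) auto
  have vhP: "(LINT t|?M. h t * cnj (?P t)) = (\<Sum>n\<in>F. cnj (c n) * fourier_coeff a \<beta> h n)"
    unfolding hP fourier_coeff_def using hn by (subst Bochner_Integration.integral_sum) auto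
  have PP: "(\<lambda>t. complex_of_real ((norm (?P t))\<^sup>2)) =
     (\<lambda>t. \<Sum>n\<in>F. \<Sum>m\<in>F. c n * cnj (c m) * (harmonic \<beta> n t * cnj (harmonic \<beta> m t)))"
    by (simp only: complex_norm_square trig_poly_def cnj_sum sum_product)
       (simp add: mult_ac)
  have iPPc: "integrable ?M (\<lambda>t. complex_of_real ((norm (?P t))\<^sup>2))"
    unfolding PP using nn by (intro Bochner_Integration.integrable_sum integrable_mult_right) auto
  have iPP: "integrable ?M (\<lambda>t. (norm (?P t))\<^sup>2)"
    using integrable_Re[OF iPPc] by simp
  have "complex_of_real (LINT t|?M. (norm (?P t))\<^sup>2) = (LINT t|?M. complex_of_real ((norm (?P t))\<^sup>2))"
    by (rule integral_complex_of_real[symmetric])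
  also have "\<dots> = (\<Sum>n\<in>F. \<Sum>m\<in>F. c n * cnj (c m) * (if n = m then 1 / \<beta> else 0))"
    unfolding PP using nn
    by (simp add: Bochner_Integration.integral_sum Bochner_Integration.integrable_sum harmonic_orthogonal[OF \<beta>])
  also have "\<dots> = (\<Sum>n\<in>F. complex_of_real ((norm (c n))\<^sup>2 / \<beta>))"
  proof (rule sum.cong[OF refl])
    fix n assume "n \<in> F"
    have "(\<Sum>m\<in>F. c n * cnj (c m) * (if n = m then 1 / \<beta> else 0)) =
      (\<Sum>m\<in>F. if n = m then c n * cnj (c n) / \<beta> else 0)"
      by (intro sum.cong) auto
    then show "(\<Sum>m\<in>F. c n * cnj (c m) * (if n = m then 1 / \<beta> else 0)) = complex_of_real ((norm (c n))\<^sup>2 / \<beta>)"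
      using F \<open>n \<in> F\<close> by (simp only: sum.delta' of_real_divide complex_norm_square if_True)
  qed
  also have "\<dots> = complex_of_real (\<Sum>n\<in>F. (norm (c n))\<^sup>2 / \<beta>)" by simp
  finally have vPP: "(LINT t|?M. (norm (?P t))\<^sup>2) = (\<Sum>n\<in>F. (norm (c n))\<^sup>2 / \<beta>)"
    by (simp only: of_real_eq_iff)
  have ex: "(norm (x - y))\<^sup>2 = (norm x)\<^sup>2 - 2 * Re (x * cnj y) + (norm y)\<^sup>2" for x y :: complex
    by (simp only: cmod_power2) (simp add: power2_eq_square algebra_simps)
  have "(LINT t|?M. (norm (h t - ?P t))\<^sup>2) =
     (LINT t|?M. (norm (h t))\<^sup>2) - 2 * Re (LINT t|?M. h t * cnj (?P t)) + (LINT t|?M. (norm (?P t))\<^sup>2)"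
  proof -
    define G where "G t = Re (h t * cnj (?P t))" for t
    have G: "integrable ?M G" "Re (LINT t|?M. h t * cnj (?P t)) = (LINT t|?M. G t)"
      unfolding G_def using ihP by (auto intro: integrable_Re simp del: times_complex.sel)
    show ?thesis unfolding ex G(2) G_def[symmetric] using h2 G(1) iPP by simp
  qed
  also have "\<dots> = (LINT t|?M. (norm (h t))\<^sup>2) + (\<Sum>n\<in>F. (norm (c n))\<^sup>2 / \<beta> - 2 * Re (cnj (c n) * fourier_coeff a \<beta> h n))"
    unfolding vhP vPP sum_subtractf sum_distrib_left Re_sum by linarith
  also have "\<dots> = (LINT t|?M. (norm (h t))\<^sup>2) +
     (\<Sum>n\<in>F. 1 / \<beta> * (norm (c n - \<beta> * fourier_coeff a \<beta> h n))\<^sup>2 - \<beta> * (norm (fourier_coeff a \<beta> h n))\<^sup>2)"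
  proof -
    have "(norm (c n))\<^sup>2 / \<beta> - 2 * Re (cnj (c n) * z) = 1 / \<beta> * (norm (c n - \<beta> * z))\<^sup>2 - \<beta> * (norm z)\<^sup>2" for n and z :: complex
    proof -
      have "(norm (c n - \<beta> * z))\<^sup>2 = (norm (c n))\<^sup>2 - 2 * (\<beta> * Re (cnj (c n) * z)) + (\<beta> * norm z)\<^sup>2"
        unfolding ex[of "c n" "\<beta> * z"] using \<beta> by (simp add: norm_mult algebra_simps)
      then show ?thesis using \<beta> by (simp add: field_simps power2_eq_square)
    qed
    then show ?thesis by presburger
  qed
  finally show ?thesis by (simp add: sum_subtractf sum_distrib_left)
qed



lemma trig_poly_add:
  assumes "finite F" "finite G"
  shows "\<exists>d. (\<lambda>t. trig_poly \<beta> F b t + trig_poly \<beta> G c t) = trig_poly \<beta> (F \<union> G) d"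
proof (intro exI ext)
  fix t
  have 1: "trig_poly \<beta> F b t = (\<Sum>n\<in>F \<union> G. if n \<in> F then b n * harmonic \<beta> n t else 0)"
    unfolding trig_poly_def using assms by (intro sum.mono_neutral_cong_left) auto
  have 2: "trig_poly \<beta> G c t = (\<Sum>n\<in>F \<union> G. if n \<in> G then c n * harmonic \<beta> n t else 0)"
    unfolding trig_poly_def using assms by (intro sum.mono_neutral_cong_left) auto
  show "trig_poly \<beta> F b t + trig_poly \<beta> G c t =
    trig_poly \<beta> (F \<union> G) (\<lambda>n. (if n \<in> F then b n else 0) + (if n \<in> G then c n else 0)) t"
    unfolding 1 2 by (subst trig_poly_def, subst sum.distrib[symmetric], intro sum.cong) (auto simp: algebra_simps)
qed

definition is_trig_poly :: "real \<Rightarrow> (real \<Rightarrow> complex) \<Rightarrow> bool" where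
  "is_trig_poly \<beta> P \<longleftrightarrow> (\<exists>F c. finite F \<and> P = trig_poly \<beta> F c)"

lemma is_trig_poly_add:
  "is_trig_poly \<beta> P \<Longrightarrow> is_trig_poly \<beta> Q \<Longrightarrow> is_trig_poly \<beta> (\<lambda>t. P t + Q t)"
  unfolding is_trig_poly_def using trig_poly_add by (metis finite_UnI)

lemma is_trig_poly_harmonic: "is_trig_poly \<beta> (\<lambda>t. c * harmonic \<beta> n t)"
  unfolding is_trig_poly_def
  by (rule exI[of _ "{n}"], rule exI[of _ "\<lambda>_. c"]) (simp add: trig_poly_def fun_eq_iff)

lemma is_trig_poly_const: "is_trig_poly \<beta> (\<lambda>t. c)"
  using is_trig_poly_harmonic[of \<beta> c 0] by (simp add: harmonic_def)

lemma is_trig_poly_sum: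
  "finite F \<Longrightarrow> (\<And>n. n \<in> F \<Longrightarrow> is_trig_poly \<beta> (P n)) \<Longrightarrow> is_trig_poly \<beta> (\<lambda>t. \<Sum>n\<in>F. P n t)"
  by (induction F rule: finite_induct) (auto intro!: is_trig_poly_add is_trig_poly_const)

lemma is_trig_poly_mult:
  assumes "is_trig_poly \<beta> P" "is_trig_poly \<beta> Q"
  shows "is_trig_poly \<beta> (\<lambda>t. P t * Q t)"
proof -
  from assms obtain F b G c where F: "finite F" "P = trig_poly \<beta> F b" and G: "finite G" "Q = trig_poly \<beta> G c"
    unfolding is_trig_poly_def by blast
  have m: "harmonic \<beta> n t * harmonic \<beta> m t = harmonic \<beta> (n + m) t" for n m t
    by (simp add: harmonic_def cis_mult algebra_simps)
  have e: "(\<lambda>t. P t * Q t) = (\<lambda>t. \<Sum>n\<in>F. \<Sum>m\<in>G. (b n * c m) * harmonic \<beta> (n + m) t)"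
    unfolding F G trig_poly_def sum_product by (simp add: m[symmetric] mult_ac)
  show ?thesis
    unfolding e using F(1) G(1) by (intro is_trig_poly_sum is_trig_poly_harmonic)
qed

text \<open>Trigonometric polynomials form an algebra that contains the restrictions of \<open>Re\<close> and \<open>Im\<close> to the
  circle, hence of all real polynomials.\<close>

lemma is_trig_poly_circle_polynomial:
  fixes p :: "complex \<Rightarrow> real"
  assumes "real_polynomial_function p"
  shows "is_trig_poly \<beta> (\<lambda>t. complex_of_real (p (harmonic \<beta> 1 (t - a))))"
  using assms
proof (induction p)
  case (linear f)
  interpret bounded_linear f by (rule linear)
  define v where "v t = 2 * pi * \<beta> * (t - a)" for t
  define A where "A = (complex_of_real (f 1) - \<i> * f \<i>) / 2"
  have f: "f z = Re z * f 1 + Im z * f \<i>" for z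
  proof -
    have "z = Re z *\<^sub>R 1 + Im z *\<^sub>R \<i>" by (simp add: complex_eq_iff)
    then have "f z = f (Re z *\<^sub>R 1 + Im z *\<^sub>R \<i>)" by simp
    also have "\<dots> = Re z * f 1 + Im z * f \<i>" by (simp only: add scaleR real_scaleR_def)
    finally show ?thesis .
  qed
  have "complex_of_real (f (harmonic \<beta> 1 (t - a))) = (A * cis (- (2 * pi * \<beta> * a))) * harmonic \<beta> 1 t
     + (cnj A * cis (2 * pi * \<beta> * a)) * harmonic \<beta> (- 1) t" for t
  proof -
    have 1: "cis (- (2 * pi * \<beta> * a)) * harmonic \<beta> 1 t = cis (v t)"
      by (simp add: harmonic_def cis_mult v_def algebra_simps)
    have 2: "cis (2 * pi * \<beta> * a) * harmonic \<beta> (- 1) t = cis (- v t)"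
      by (simp add: harmonic_def cis_mult v_def algebra_simps)
    have 3: "harmonic \<beta> 1 (t - a) = cis (v t)"
      by (simp add: harmonic_def v_def)
    have "complex_of_real (f (cis (v t))) = A * cis (v t) + cnj A * cis (- v t)"
      by (subst f) (simp add: A_def complex_eq_iff field_simps)
    then show ?thesis unfolding 3 mult.assoc[of _ _ "harmonic _ _ _"] 1 2 .
  qed
  then show ?case
    by (simp only:) (intro is_trig_poly_add is_trig_poly_harmonic)
qed (auto intro: is_trig_poly_const is_trig_poly_add is_trig_poly_mult)

text \<open>A continuous function with equal values at the end points of a period lives on the circle,
  where the theorem of Stone and Weierstrass applies.\<close>

lemma uniform_trig_approximation:
  fixes F :: "real \<Rightarrow> complex"
  assumes \<beta>: "\<beta> > 0" and cont: "continuous_on {a..a + 1 / \<beta>} F"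
    and ends: "F a = F (a + 1 / \<beta>)" and e: "e > 0"
  shows "\<exists>P. is_trig_poly \<beta> P \<and> (\<forall>t\<in>{a..a + 1 / \<beta>}. norm (F t - P t) < e)"
proof -
  define p where "p s = F (a + s / \<beta>)" for s
  have cp: "continuous_on {0..1} p"
    unfolding p_def using \<beta>
    by (intro continuous_on_compose2[OF cont] continuous_intros) (auto simp: field_simps)
  have "homotopic_loops UNIV p p"
    using cp ends by (simp add: homotopic_loops_refl path_def pathstart_def pathfinish_def p_def)
  from homotopic_loops_imp_homotopic_circlemaps[OF this]
  have cG: "continuous_on (sphere 0 1) (p \<circ> (\<lambda>z. Arg2pi z / (2 * pi)))"
    by (rule homotopic_with_imp_continuous[THEN conjunct1])
  obtain g where g: "polynomial_function g"
    and gG: "\<And>z. z \<in> sphere 0 1 \<Longrightarrow> norm ((p \<circ> (\<lambda>z. Arg2pi z / (2 * pi))) z - g z) < e"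
    using Stone_Weierstrass_polynomial_function[OF compact_sphere cG e] by blast
  define P where "P t = g (harmonic \<beta> 1 (t - a))" for t
  have "P t = complex_of_real ((Re \<circ> g) (harmonic \<beta> 1 (t - a))) + \<i> * complex_of_real ((Im \<circ> g) (harmonic \<beta> 1 (t - a)))" for t
    by (simp add: P_def complex_eq_iff)
  moreover have "is_trig_poly \<beta> (\<lambda>t. complex_of_real ((Re \<circ> g) (harmonic \<beta> 1 (t - a))) + \<i> * complex_of_real ((Im \<circ> g) (harmonic \<beta> 1 (t - a))))"
    using g bounded_linear_Re bounded_linear_Im unfolding polynomial_function_def
    by (intro is_trig_poly_add is_trig_poly_mult is_trig_poly_const is_trig_poly_circle_polynomial) blast+
  ultimately have "is_trig_poly \<beta> P" by presburger
  moreover have "norm (F t - P t) < e" if t: "t \<in> {a..a + 1 / \<beta>}" for t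
  proof -
    define s where "s = (t - a) * \<beta>"
    have s: "0 \<le> s" "s \<le> 1" "t = a + s / \<beta>" using t \<beta> by (auto simp: s_def field_simps)
    have h: "harmonic \<beta> 1 (t - a) = cis (2 * pi * s)"
      by (simp add: harmonic_def s_def mult_ac)
    have pa: "p (Arg2pi (cis (2 * pi * s)) / (2 * pi)) = F t"
    proof (cases "s = 1")
      case True
      have "Arg2pi 1 = 0" using Arg2pi_of_real[of 1] by simp
      then show ?thesis using ends s(3) True by (simp add: p_def)
    next
      case False
      then have "Arg2pi (cis (2 * pi * s)) = 2 * pi * s"
        using s by (intro Arg2pi_unique[of 1]) (auto simp: cis_conv_exp)
      then show ?thesis using s(3) by (simp add: p_def)
    qed
    show ?thesis using gG[of "cis (2 * pi * s)"] by (simp add: pa P_def h)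
  qed
  ultimately show ?thesis by blast
qed

lemma square_norm_add_le: "(norm (x + y :: 'a::real_normed_vector))\<^sup>2 \<le> 2 * (norm x)\<^sup>2 + 2 * (norm y)\<^sup>2"
proof -
  have "(norm (x + y))\<^sup>2 \<le> (norm x + norm y)\<^sup>2"
    by (intro power_mono norm_triangle_ineq norm_ge_zero)
  also have "\<dots> \<le> 2 * (norm x)\<^sup>2 + 2 * (norm y)\<^sup>2"
    using sum_squares_bound[of "norm x" "norm y"] by (simp add: power2_eq_square algebra_simps)
  finally show ?thesis .
qed

definition trig_approximable :: "real \<Rightarrow> real \<Rightarrow> (real \<Rightarrow> complex) \<Rightarrow> bool" where
  "trig_approximable a \<beta> h \<longleftrightarrow> (\<forall>e>0. \<exists>P. is_trig_poly \<beta> P \<and>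
     (LINT t|period_measure a \<beta>. (norm (h t - P t))\<^sup>2) < e)"

lemma integrable_square_diff:
  assumes "f \<in> borel_measurable M" "g \<in> borel_measurable M"
    and "integrable M (\<lambda>t. (norm (f t :: complex))\<^sup>2)" "integrable M (\<lambda>t. (norm (g t))\<^sup>2)"
  shows "integrable M (\<lambda>t. (norm (f t - g t))\<^sup>2)"
proof (rule Bochner_Integration.integrable_bound)
  show "integrable M (\<lambda>t. 2 * (norm (f t))\<^sup>2 + 2 * (norm (g t))\<^sup>2)"
    using assms by simp
  show "AE t in M. norm ((norm (f t - g t))\<^sup>2) \<le> norm (2 * (norm (f t))\<^sup>2 + 2 * (norm (g t))\<^sup>2)"
    using square_norm_add_le[of "f _" "- g _"] by (intro AE_I2) simp
qed (use assms in measurable)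

text \<open>Closure under dominated limits lets density climb from continuous functions to bounded ones and
  from there to all square-integrable ones.\<close>

lemma trig_approximable_limit:
  assumes \<beta>: "\<beta> > 0"
    and h: "h \<in> borel_measurable (period_measure a \<beta>)"
    and h2: "integrable (period_measure a \<beta>) (\<lambda>t. (norm (h t))\<^sup>2)"
    and g: "\<And>n. g n \<in> borel_measurable (period_measure a \<beta>)"
    and dom: "\<And>n t. t \<in> {a..a + 1 / \<beta>} \<Longrightarrow> norm (g n t) \<le> B t"
    and B: "integrable (period_measure a \<beta>) (\<lambda>t. (B t)\<^sup>2)"
    and lim: "AE t in period_measure a \<beta>. (\<lambda>n. g n t) \<longlonglongrightarrow> h t"
    and appr: "\<And>n::nat. trig_approximable a \<beta> (g n)"
  shows "trig_approximable a \<beta> h"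
  unfolding trig_approximable_def
proof (intro allI impI)
  fix e :: real assume e: "e > 0"
  let ?M = "period_measure a \<beta>"
  have [measurable]: "h \<in> borel_measurable ?M" "g n \<in> borel_measurable ?M" for n by fact+
  have g2: "integrable ?M (\<lambda>t. (norm (g n t))\<^sup>2)" for n
    by (rule Bochner_Integration.integrable_bound[OF B]) (auto intro!: AE_I2 power_mono dom)
  have "(\<lambda>n. LINT t|?M. (norm (h t - g n t))\<^sup>2) \<longlonglongrightarrow> (LINT t|?M. 0)"
  proof (rule integral_dominated_convergence)
    show "integrable ?M (\<lambda>t. 2 * (norm (h t))\<^sup>2 + 2 * (B t)\<^sup>2)" using h2 B by simp
    show "AE t in ?M. (\<lambda>n. (norm (h t - g n t))\<^sup>2) \<longlonglongrightarrow> 0"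
      using lim
    proof eventually_elim
      case (elim t)
      have "(\<lambda>n. (norm (h t - g n t))\<^sup>2) \<longlonglongrightarrow> (norm (h t - h t))\<^sup>2"
        by (intro tendsto_intros elim)
      then show ?case by simp
    qed
    show "AE t in ?M. norm ((norm (h t - g n t))\<^sup>2) \<le> 2 * (norm (h t))\<^sup>2 + 2 * (B t)\<^sup>2" for n
    proof (intro AE_I2)
      fix t assume t: "t \<in> space ?M"
      have "(norm (h t - g n t))\<^sup>2 \<le> 2 * (norm (h t))\<^sup>2 + 2 * (norm (g n t))\<^sup>2"
        using square_norm_add_le[of "h t" "- g n t"] by simp
      also have "(norm (g n t))\<^sup>2 \<le> (B t)\<^sup>2" using t by (intro power_mono dom) auto
      finally show "norm ((norm (h t - g n t))\<^sup>2) \<le> 2 * (norm (h t))\<^sup>2 + 2 * (B t)\<^sup>2" by simp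
    qed
  qed measurable
  then have "\<forall>\<^sub>F n in sequentially. (LINT t|?M. (norm (h t - g n t))\<^sup>2) < e / 4"
    using e by (auto dest: order_tendstoD(2)[of _ 0 _ "e / 4"])
  then obtain n where n: "(LINT t|?M. (norm (h t - g n t))\<^sup>2) < e / 4"
    by (auto simp: eventually_sequentially)
  obtain P where P: "is_trig_poly \<beta> P" "(LINT t|?M. (norm (g n t - P t))\<^sup>2) < e / 4"
    using appr[of n] e unfolding trig_approximable_def by (meson divide_pos_pos zero_less_numeral)
  obtain F c where Pc: "P = trig_poly \<beta> F c" using P(1) by (auto simp: is_trig_poly_def)
  have [measurable]: "P \<in> borel_measurable ?M" unfolding Pc by measurable
  have P2: "integrable ?M (\<lambda>t. (norm (P t))\<^sup>2)"
    by (rule integrable_period_measure_bounded[OF \<beta>, where K="(\<Sum>n\<in>F. norm (c n))\<^sup>2"])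
       (auto simp: Pc intro!: power_mono norm_trig_poly_le)
  have i1: "integrable ?M (\<lambda>t. (norm (h t - g n t))\<^sup>2)" and i2: "integrable ?M (\<lambda>t. (norm (g n t - P t))\<^sup>2)"
    and i3: "integrable ?M (\<lambda>t. (norm (h t - P t))\<^sup>2)"
    using h2 g2 P2 by (auto intro!: integrable_square_diff)
  have "(LINT t|?M. (norm (h t - P t))\<^sup>2) \<le> (LINT t|?M. 2 * (norm (h t - g n t))\<^sup>2 + 2 * (norm (g n t - P t))\<^sup>2)"
  proof (rule integral_mono)
    show "(norm (h t - P t))\<^sup>2 \<le> 2 * (norm (h t - g n t))\<^sup>2 + 2 * (norm (g n t - P t))\<^sup>2" for t
      using square_norm_add_le[of "h t - g n t" "g n t - P t"] by simp
  qed (use i1 i2 i3 in auto)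
  also have "\<dots> = 2 * (LINT t|?M. (norm (h t - g n t))\<^sup>2) + 2 * (LINT t|?M. (norm (g n t - P t))\<^sup>2)"
    using i1 i2 by simp
  also have "\<dots> < e" using n P(2) by simp
  finally show "\<exists>P. is_trig_poly \<beta> P \<and> (LINT t|?M. (norm (h t - P t))\<^sup>2) < e"
    using P(1) by blast
qed

lemma trig_approximable_continuous:
  assumes \<beta>: "\<beta> > 0" and cont: "continuous_on {a..a + 1 / \<beta>} F" and ends: "F a = F (a + 1 / \<beta>)"
  shows "trig_approximable a \<beta> F"
  unfolding trig_approximable_def
proof (intro allI impI)
  fix e :: real assume e: "e > 0"
  let ?M = "period_measure a \<beta>"
  interpret finite_measure ?M using \<beta> by (rule finite_period_measure)
  define d where "d = sqrt (e * \<beta> / 2)"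
  have d: "d > 0" "d\<^sup>2 = e * \<beta> / 2" using e \<beta> by (auto simp: d_def)
  obtain P where P: "is_trig_poly \<beta> P" and le: "\<And>t. t \<in> {a..a + 1 / \<beta>} \<Longrightarrow> norm (F t - P t) < d"
    using uniform_trig_approximation[OF \<beta> cont ends d(1)] by blast
  obtain G c where Pc: "P = trig_poly \<beta> G c" using P(1) by (auto simp: is_trig_poly_def)
  have [measurable]: "P \<in> borel_measurable ?M" unfolding Pc by measurable
  have [measurable]: "F \<in> borel_measurable ?M" by (rule continuous_measurable_period_measure[OF cont])
  have b: "t \<in> {a..a + 1 / \<beta>} \<Longrightarrow> (norm (F t - P t))\<^sup>2 \<le> d\<^sup>2" for t
    by (intro power_mono less_imp_le[OF le]) auto
  have "integrable ?M (\<lambda>t. (norm (F t - P t))\<^sup>2)"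
    by (rule integrable_period_measure_bounded[OF \<beta>, where K="d\<^sup>2"]) (use b in auto)
  then have "(LINT t|?M. (norm (F t - P t))\<^sup>2) \<le> (LINT t|?M. d\<^sup>2)"
    using b by (intro integral_mono) auto
  also have "\<dots> = d\<^sup>2 / \<beta>"
    using \<beta> by (simp add: period_measure_def measure_restrict_space)
  also have "\<dots> < e" using d(2) \<beta> mult_pos_pos[OF e \<beta>] by (simp add: field_simps)
  finally show "\<exists>P. is_trig_poly \<beta> P \<and> (LINT t|?M. (norm (F t - P t))\<^sup>2) < e"
    using P by blast
qed

text \<open>A measurable function is almost everywhere a limit of continuous functions, which can be arranged
  to be uniformly bounded and to vanish at both end points.\<close>

lemma trig_approximable_bounded:
  assumes \<beta>: "\<beta> > 0" and h: "h \<in> borel_measurable lborel" and b: "\<And>t. norm (h t) \<le> K" and K: "K > 0"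
  shows "trig_approximable a \<beta> h"
proof -
  let ?M = "period_measure a \<beta>"
  have hM: "h \<in> borel_measurable ?M"
    unfolding period_measure_def by (rule measurable_restrict_space1[OF h])
  have "h \<in> borel_measurable lebesgue" using h by (rule measurable_completion)
  then have "h measurable_on UNIV" by (intro lebesgue_measurable_imp_measurable_on) auto
  then obtain N g where N: "negligible N" and g: "\<And>n. continuous_on UNIV (g n)"
    and lim: "\<And>t. t \<notin> N \<Longrightarrow> (\<lambda>n. g n t) \<longlonglongrightarrow> h t"
    unfolding measurable_on_def by auto
  \<comment> \<open>Clip the approximants to the disc of radius \<open>K\<close>, and cut them off so that they vanish at
    both end points.\<close>
  define clip where "clip z = complex_of_real (K / max K (norm z)) * z" for z
  define cut where "cut n t = complex_of_real (min 1 (real n * ((t - a) * (a + 1 / \<beta> - t))))" for n t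
  define f where "f n t = cut n t * clip (g n t)" for n t
  have nz: "max K (norm z) \<noteq> 0" for z :: complex using K by auto
  have cont: "continuous_on {a..a + 1 / \<beta>} (f n)" for n
    unfolding f_def cut_def clip_def
    by (intro continuous_intros continuous_on_subset[OF g]) (use nz in auto)
  have cut: "norm (cut n t) \<le> 1" if "t \<in> {a..a + 1 / \<beta>}" for n t
  proof -
    have "0 \<le> real n * ((t - a) * (a + 1 / \<beta> - t))" using that by auto
    then show ?thesis unfolding cut_def norm_of_real by linarith
  qed
  have clip: "norm (clip z) \<le> K" for z
    using K by (auto simp: clip_def norm_mult norm_divide max_def field_simps)
  have clip_id: "clip z = z" if "norm z \<le> K" for z
    using that K by (simp add: clip_def max_def)
  have contclip: "continuous_on UNIV clip"
    unfolding clip_def by (intro continuous_intros) (use nz in auto)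
  have conv: "(\<lambda>n. f n t) \<longlonglongrightarrow> h t" if t: "t \<notin> N" "t \<in> {a<..<a + 1 / \<beta>}" for t
  proof -
    define w where "w = (t - a) * (a + 1 / \<beta> - t)"
    have w: "w > 0" using t by (auto simp: w_def)
    obtain m :: nat where m: "real m > 1 / w" using reals_Archimedean2 by blast
    have ev: "\<forall>\<^sub>F n in sequentially. cut n t = 1"
    proof (rule eventually_sequentiallyI)
      fix n assume "n \<ge> m"
      then have "1 / w < real n" using m by linarith
      then have "1 \<le> real n * w" using w by (simp add: field_simps)
      then show "cut n t = 1" by (simp add: cut_def w_def[symmetric])
    qed
    have "(\<lambda>n. clip (g n t)) \<longlonglongrightarrow> clip (h t)"
      by (rule continuous_on_tendsto_compose[OF contclip lim[OF t(1)]]) auto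
    then have "(\<lambda>n. clip (g n t)) \<longlonglongrightarrow> h t" using clip_id[OF b] by simp
    moreover have "\<forall>\<^sub>F n in sequentially. clip (g n t) = f n t"
      using ev by eventually_elim (simp add: f_def)
    ultimately show ?thesis by (rule Lim_transform_eventually)
  qed
  have "negligible (N \<union> {a, a + 1 / \<beta>})"
    using N by (intro negligible_Un) auto
  then have "AE t in lebesgue. t \<notin> N \<union> {a, a + 1 / \<beta>}"
    unfolding negligible_iff_null_sets by (rule AE_not_in)
  then have "AE t in lborel. t \<notin> N \<union> {a, a + 1 / \<beta>}" by (simp only: AE_completion_iff)
  then have "AE t in lborel. t \<in> {a..a + 1 / \<beta>} \<longrightarrow> (\<lambda>n. f n t) \<longlonglongrightarrow> h t"
    by eventually_elim (use conv in auto)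
  then have AE: "AE t in ?M. (\<lambda>n. f n t) \<longlonglongrightarrow> h t"
    unfolding period_measure_def
    by (subst AE_restrict_space_iff) auto
  show ?thesis
  proof (rule trig_approximable_limit[OF \<beta> hM _ _ _ _ AE, where B="\<lambda>_. K"])
    show "integrable ?M (\<lambda>t. (norm (h t))\<^sup>2)"
      by (rule integrable_period_measure_bounded[OF \<beta>, where K="K\<^sup>2"])
         (use hM b in \<open>auto intro!: power_mono\<close>)
    show "f n \<in> borel_measurable ?M" for n by (rule continuous_measurable_period_measure[OF cont])
    show "norm (f n t) \<le> K" if "t \<in> {a..a + 1 / \<beta>}" for n t
      using mult_mono[OF cut[OF that] clip[of "g n t"]] by (simp add: f_def norm_mult)
    show "integrable ?M (\<lambda>t. K\<^sup>2)"
      by (rule integrable_period_measure_bounded[OF \<beta>, where K="K\<^sup>2"]) auto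
    show "trig_approximable a \<beta> (f n)" for n
      using \<beta> cont by (rule trig_approximable_continuous) (simp add: f_def cut_def)
  qed
qed

lemma trig_approximable_square_integrable:
  assumes \<beta>: "\<beta> > 0" and h: "h \<in> borel_measurable lborel"
    and h2: "integrable (period_measure a \<beta>) (\<lambda>t. (norm (h t))\<^sup>2)"
  shows "trig_approximable a \<beta> h"
proof -
  let ?M = "period_measure a \<beta>"
  have hM: "h \<in> borel_measurable ?M"
    unfolding period_measure_def by (rule measurable_restrict_space1[OF h])
  define g where "g n t = (if norm (h t) \<le> real (Suc n) then h t else 0)" for n t
  have gm: "g n \<in> borel_measurable lborel" for n
    unfolding g_def using h by measurable
  have "(\<lambda>n. g n t) \<longlonglongrightarrow> h t" for t
  proof (rule tendsto_eventually, rule eventually_sequentiallyI)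
    fix n assume "n \<ge> nat \<lceil>norm (h t)\<rceil>"
    then show "g n t = h t" by (simp add: g_def)
  qed
  then show ?thesis
  proof (intro trig_approximable_limit[OF \<beta> hM h2, where g=g and B="\<lambda>t. norm (h t)"] AE_I2 h2)
    show "trig_approximable a \<beta> (g n)" for n
      using \<beta> gm by (rule trig_approximable_bounded[where K="real (Suc n)"]) (auto simp: g_def)
    show "g n \<in> borel_measurable ?M" for n
      unfolding period_measure_def by (rule measurable_restrict_space1[OF gm])
  qed (auto simp: g_def)
qed

definition fourier :: "(real \<Rightarrow> complex) \<Rightarrow> real \<Rightarrow> complex" where
  "fourier h w = (LINT t|lborel. h t * cis (- (2 * pi * w * t)))"

text \<open>Bessel's inequality bounds the partial sums from above; the approximating trigonometric
  polynomials show that they come arbitrarily close to the bound.\<close>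

theorem fourier_series_Parseval:
  fixes h :: "real \<Rightarrow> complex"
  assumes \<beta>: "\<beta> > 0" and h: "h \<in> borel_measurable lborel"
    and supp: "\<And>t. t \<notin> {a..a + 1 / \<beta>} \<Longrightarrow> h t = 0"
    and fin: "(\<integral>\<^sup>+ t. ennreal ((norm (h t))\<^sup>2) \<partial>lborel) < top"
  shows "(\<Sum>\<^sub>\<infinity>n\<in>UNIV. ennreal ((norm (fourier h (\<beta> * of_int n)))\<^sup>2)) =
    ennreal (1 / \<beta>) * (\<integral>\<^sup>+ t. ennreal ((norm (h t))\<^sup>2) \<partial>lborel)"
proof -
  let ?M = "period_measure a \<beta>"
  define I where "I = {a..a + 1 / \<beta>}"
  have hM: "h \<in> borel_measurable ?M"
    unfolding period_measure_def by (rule measurable_restrict_space1[OF h])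
  have ind: "indicator I t * x = (x::complex)" if "h t = 0 \<Longrightarrow> x = 0" for t x
    using that supp by (auto simp: I_def indicator_def)
  have int_lborel: "integrable lborel (\<lambda>t. (norm (h t))\<^sup>2)"
    using h fin by (intro integrableI_bounded) auto
  have h2: "integrable ?M (\<lambda>t. (norm (h t))\<^sup>2)"
    unfolding period_measure_def
    using integrable_mult_indicator[OF _ int_lborel, of "{a..a + 1 / \<beta>}"]
    by (subst integrable_restrict_space) auto
  have coeff: "fourier_coeff a \<beta> h n = fourier h (\<beta> * of_int n)" for n
  proof -
    have "fourier_coeff a \<beta> h n = (LINT t|lborel. indicator I t *\<^sub>R (h t * cnj (harmonic \<beta> n t)))"
      unfolding fourier_coeff_def period_measure_def I_def
      by (subst integral_restrict_space) auto
    also have "\<dots> = fourier h (\<beta> * of_int n)"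
      unfolding fourier_def
      by (intro Bochner_Integration.integral_cong refl)
         (use supp in \<open>auto simp: harmonic_def cis_cnj I_def indicator_def mult_ac\<close>)
    finally show ?thesis .
  qed
  define E where "E = (LINT t|?M. (norm (h t))\<^sup>2)"
  have E: "E = (LINT t|lborel. (norm (h t))\<^sup>2)"
  proof -
    have "E = (LINT t|lborel. indicator I t *\<^sub>R (norm (h t))\<^sup>2)"
      unfolding E_def period_measure_def I_def by (subst integral_restrict_space) auto
    also have "\<dots> = (LINT t|lborel. (norm (h t))\<^sup>2)"
      by (intro Bochner_Integration.integral_cong refl) (use supp in \<open>auto simp: I_def indicator_def\<close>)
    finally show ?thesis .
  qed
  have Epos: "E \<ge> 0" unfolding E by simp
  define c where "c n = (norm (fourier h (\<beta> * of_int n)))\<^sup>2" for n :: int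
  have c0: "c n \<ge> 0" for n by (simp add: c_def)
  have ident: "(LINT t|?M. (norm (h t - trig_poly \<beta> F b t))\<^sup>2) =
     E - \<beta> * sum c F + 1 / \<beta> * (\<Sum>n\<in>F. (norm (b n - \<beta> * fourier_coeff a \<beta> h n))\<^sup>2)"
    if "finite F" for F b
    using square_distance_trig_poly[OF \<beta> that hM h2, of b] by (simp add: E_def c_def coeff)
  have bessel: "sum c F \<le> E / \<beta>" if "finite F" for F
  proof -
    have "0 \<le> (LINT t|?M. (norm (h t - trig_poly \<beta> F (\<lambda>n. \<beta> * fourier_coeff a \<beta> h n) t))\<^sup>2)" by simp
    then have "\<beta> * sum c F \<le> E" unfolding ident[OF that] by simp
    then show ?thesis using \<beta> by (simp add: field_simps)
  qed
  have best: "\<exists>F. finite F \<and> E / \<beta> - e < sum c F" if e: "e > 0" for e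
  proof -
    from trig_approximable_square_integrable[OF \<beta> h h2] e \<beta>
    obtain P where P: "is_trig_poly \<beta> P" "(LINT t|?M. (norm (h t - P t))\<^sup>2) < e * \<beta>"
      unfolding trig_approximable_def by (metis mult_pos_pos)
    then obtain F b where F: "finite F" "P = trig_poly \<beta> F b" by (auto simp: is_trig_poly_def)
    have "0 \<le> 1 / \<beta> * (\<Sum>n\<in>F. (norm (b n - \<beta> * fourier_coeff a \<beta> h n))\<^sup>2)"
      using \<beta> by (intro mult_nonneg_nonneg sum_nonneg) auto
    then have "E - \<beta> * sum c F < e * \<beta>" using P(2) ident[OF F(1), of b] unfolding F(2) by linarith
    then show ?thesis using F(1) \<beta> by (intro exI[of _ F]) (simp add: field_simps)
  qed
  have sm: "c summable_on UNIV"
    by (rule nonneg_bounded_partial_sums_imp_summable_on[where C="E / \<beta>"])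
       (use bessel c0 in \<open>auto simp: eventually_finite_subsets_at_top_finite intro!: always_eventually eventually_finite_subsets_at_top_weakI\<close>)
  have "infsum c UNIV = E / \<beta>"
  proof (rule antisym)
    show "infsum c UNIV \<le> E / \<beta>" by (rule infsum_le_finite_sums[OF sm]) (use bessel in auto)
    show "E / \<beta> \<le> infsum c UNIV"
    proof (rule field_le_epsilon)
      fix e :: real assume "e > 0"
      then obtain F where F: "finite F" "E / \<beta> - e < sum c F" using best by blast
      have "sum c F \<le> infsum c UNIV" using F c0 by (intro finite_sum_le_infsum sm) auto
      then show "E / \<beta> \<le> infsum c UNIV + e" using F by linarith
    qed
  qed
  moreover have "(\<Sum>\<^sub>\<infinity>n\<in>UNIV. ennreal (c n)) = ennreal (infsum c UNIV)"
    using sm c0 by (subst infsum_nonneg_is_SUPREMUM_ennreal[OF sm]) (auto simp: nonneg_infsum_complete intro!: SUP_cong)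
  moreover have "(\<integral>\<^sup>+ t. ennreal ((norm (h t))\<^sup>2) \<partial>lborel) = ennreal E"
    unfolding E by (rule nn_integral_eq_integral[OF int_lborel]) auto
  ultimately show ?thesis
    using \<beta> Epos by (simp add: c_def ennreal_mult[symmetric])
qed

section \<open>Gabor systems with compactly supported windows\<close>

lemma Lp_norm_less_top_iff:
  "Lp_norm M p f < top \<longleftrightarrow> (\<integral>\<^sup>+ x. ennreal (norm (f x) powr p) \<partial>M) < top"
  unfolding Lp_norm_def Let_def by (auto simp: top.not_eq_extremum)

lemma powr_2_nonneg: "0 \<le> x \<Longrightarrow> x powr 2 = (x::real)\<^sup>2"
  by (cases "x = 0") (auto simp: powr_numeral)

lemma Lp_norm_2_power2:
  "(Lp_norm M 2 f)\<^sup>2 = (\<integral>\<^sup>+ x. ennreal ((norm (f x))\<^sup>2) \<partial>M)"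
proof -
  define I where "I = (\<integral>\<^sup>+ x. ennreal ((norm (f x))\<^sup>2) \<partial>M)"
  have N: "Lp_norm M 2 f = (if I = top then top else ennreal (enn2real I powr (1 / 2)))"
    by (simp add: Lp_norm_def Let_def I_def powr_2_nonneg)
  show ?thesis
  proof (cases "I = top")
    case True
    moreover have "(top :: ennreal)\<^sup>2 = top" by (simp add: power2_eq_square)
    ultimately show ?thesis by (simp add: N I_def[symmetric])
  next
    case False
    then have "(ennreal (enn2real I powr (1 / 2)))\<^sup>2 = I"
      by (simp add: powr_half_sqrt ennreal_power less_top[symmetric])
    then show ?thesis using False by (simp add: N I_def[symmetric])
  qed
qed

lemma L2_iff:
  "f \<in> L2 \<longleftrightarrow> f \<in> borel_measurable lborel \<and> (\<integral>\<^sup>+ x. ennreal ((norm (f x))\<^sup>2) \<partial>lborel) < top"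
  by (simp add: L2_def Lp_norm_less_top_iff powr_2_nonneg)

text \<open>Sums over indices become integrals over a counting measure, so that Tonelli's theorem covers the
  interchange of sums as well.\<close>

lemma infsum_ennreal_eq_nn_integral:
  fixes f :: "'a::countable \<Rightarrow> ennreal"
  shows "infsum f UNIV = (\<integral>\<^sup>+ x. f x \<partial>count_space UNIV)"
proof (rule antisym)
  have S: "infsum f UNIV = (SUP F\<in>{F. finite F \<and> F \<subseteq> UNIV}. sum f F)"
    by (rule nonneg_infsum_complete) simp
  show "infsum f UNIV \<le> (\<integral>\<^sup>+ x. f x \<partial>count_space UNIV)"
    unfolding S
  proof (rule SUP_least)
    fix F :: "'a set" assume F: "F \<in> {F. finite F \<and> F \<subseteq> UNIV}"
    then have "sum f F = (\<integral>\<^sup>+ x. f x \<partial>count_space F)"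
      by (simp add: nn_integral_count_space_finite)
    also have "\<dots> = (\<integral>\<^sup>+ x. f x * indicator F x \<partial>count_space UNIV)"
      by (simp add: nn_integral_count_space_indicator)
    also have "\<dots> \<le> (\<integral>\<^sup>+ x. f x \<partial>count_space UNIV)"
      by (intro nn_integral_mono) (auto simp: indicator_def)
    finally show "sum f F \<le> (\<integral>\<^sup>+ x. f x \<partial>count_space UNIV)" .
  qed
  let ?R = "range (to_nat :: 'a \<Rightarrow> nat)"
  have "(\<integral>\<^sup>+ x. f x \<partial>count_space UNIV) = (\<integral>\<^sup>+ x. f (from_nat (to_nat (x::'a))) \<partial>count_space UNIV)"
    by simp
  also have "\<dots> = (\<integral>\<^sup>+ n. f (from_nat n) \<partial>count_space ?R)"
    by (rule nn_integral_bij_count_space) (simp add: bij_betw_def)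
  also have "\<dots> = (\<integral>\<^sup>+ n. f (from_nat n) * indicator ?R n \<partial>count_space UNIV)"
    by (simp add: nn_integral_count_space_indicator)
  also have "\<dots> = (\<Sum>n. f (from_nat n) * indicator ?R n)"
    by (rule nn_integral_count_space_nat)
  also have "\<dots> \<le> infsum f UNIV"
    unfolding suminf_eq_SUP
  proof (rule SUP_least)
    fix N
    have "(\<Sum>n<N. f (from_nat n) * indicator ?R n) = (\<Sum>n\<in>{..<N} \<inter> ?R. f (from_nat n))"
      by (rule sum.mono_neutral_cong_right) (auto simp: indicator_def)
    also have "\<dots> = sum f (from_nat ` ({..<N} \<inter> ?R))"
      by (subst sum.reindex) (auto simp: inj_on_def)
    also have "\<dots> \<le> infsum f UNIV"
      unfolding S by (rule SUP_upper) auto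
    finally show "(\<Sum>n<N. f (from_nat n) * indicator ?R n) \<le> infsum f UNIV" .
  qed
  finally show "(\<integral>\<^sup>+ x. f x \<partial>count_space UNIV) \<le> infsum f UNIV" .
qed

lemma gabor_coefficient_eq_fourier:
  "L2_inner f (gabor_system g \<alpha> \<beta> (k, n)) = fourier (\<lambda>t. f t * cnj (g (t - \<alpha> * of_int k))) (\<beta> * of_int n)"
proof -
  have "cnj (exp (2 * of_real pi * \<i> * of_real (\<beta> * of_int n) * of_real t)) = cis (- (2 * pi * (\<beta> * of_int n) * t))" for t
    by (simp add: cis_conv_exp exp_cnj mult_ac)
  then show ?thesis
    by (simp add: L2_inner_def gabor_system_def modulation_def translation_def fourier_def mult_ac)
qed

text \<open>If the window lives on one period of the modulations, then for each translate the
  coefficients are Fourier coefficients on that period, and the frame operator is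
  multiplication by a function.\<close>

theorem gabor_frame_sum_compact_support:
  fixes f g :: "real \<Rightarrow> complex"
  assumes \<beta>: "\<beta> > 0" and g: "g \<in> borel_measurable lborel" and bound: "\<And>t. norm (g t) \<le> K"
    and supp: "\<And>t. t \<notin> {a..a + 1 / \<beta>} \<Longrightarrow> g t = 0" and f: "f \<in> L2"
  shows "(\<Sum>\<^sub>\<infinity>i\<in>UNIV. ennreal ((norm (L2_inner f (gabor_system g \<alpha> \<beta> i)))\<^sup>2)) =
    (\<integral>\<^sup>+ t. ennreal ((norm (f t))\<^sup>2) *
       (ennreal (1 / \<beta>) * (\<integral>\<^sup>+ k. ennreal ((norm (g (t - \<alpha> * of_int k)))\<^sup>2) \<partial>count_space UNIV)) \<partial>lborel)"
proof -
  have fm [measurable]: "f \<in> borel_measurable borel" and f2: "(\<integral>\<^sup>+ x. ennreal ((norm (f x))\<^sup>2) \<partial>lborel) < top"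
    using f by (auto simp: L2_iff)
  have gm [measurable]: "g \<in> borel_measurable borel" using g by simp
  define h where "h k t = f t * cnj (g (t - \<alpha> * of_int k))" for k :: int and t
  have hm [measurable]: "h k \<in> borel_measurable borel" for k
    unfolding h_def by measurable
  have "(\<Sum>\<^sub>\<infinity>i\<in>UNIV. ennreal ((norm (L2_inner f (gabor_system g \<alpha> \<beta> i)))\<^sup>2))
     = (\<integral>\<^sup>+ i. ennreal ((norm (L2_inner f (gabor_system g \<alpha> \<beta> i)))\<^sup>2) \<partial>count_space UNIV)"
    by (rule infsum_ennreal_eq_nn_integral)
  also have "\<dots> = (\<integral>\<^sup>+ k. (\<integral>\<^sup>+ n. ennreal ((norm (fourier (h k) (\<beta> * of_int n)))\<^sup>2) \<partial>count_space UNIV) \<partial>count_space UNIV)"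
    unfolding h_def gabor_coefficient_eq_fourier[symmetric] by (rule nn_integral_fst_count_space[symmetric])
  also have "\<dots> = (\<integral>\<^sup>+ k. ennreal (1 / \<beta>) * (\<integral>\<^sup>+ t. ennreal ((norm (h k t))\<^sup>2) \<partial>lborel) \<partial>count_space UNIV)"
  proof (rule nn_integral_cong)
    fix k
    have "(\<integral>\<^sup>+ t. ennreal ((norm (h k t))\<^sup>2) \<partial>lborel) \<le> (\<integral>\<^sup>+ t. ennreal (K\<^sup>2) * ennreal ((norm (f t))\<^sup>2) \<partial>lborel)"
    proof (rule nn_integral_mono)
      fix t
      have "(norm (g (t - \<alpha> * of_int k)))\<^sup>2 \<le> K\<^sup>2" by (intro power_mono bound) auto
      then show "ennreal ((norm (h k t))\<^sup>2) \<le> ennreal (K\<^sup>2) * ennreal ((norm (f t))\<^sup>2)"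
        by (auto simp: h_def norm_mult power_mult_distrib ennreal_mult[symmetric] mult.commute[of "K\<^sup>2"]
            intro!: ennreal_leI mult_left_mono)
    qed
    also have "\<dots> < top" using f2 by (simp add: nn_integral_cmult ennreal_mult_less_top)
    finally have "(\<integral>\<^sup>+ t. ennreal ((norm (h k t))\<^sup>2) \<partial>lborel) < top" .
    moreover have "h k t = 0" if "t \<notin> {a + \<alpha> * of_int k..a + \<alpha> * of_int k + 1 / \<beta>}" for t
      using that supp[of "t - \<alpha> * of_int k"] by (auto simp: h_def)
    ultimately have "(\<Sum>\<^sub>\<infinity>n\<in>UNIV. ennreal ((norm (fourier (h k) (\<beta> * of_int n)))\<^sup>2)) =
       ennreal (1 / \<beta>) * (\<integral>\<^sup>+ t. ennreal ((norm (h k t))\<^sup>2) \<partial>lborel)"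
      using \<beta> by (intro fourier_series_Parseval[where a="a + \<alpha> * of_int k"]) auto
    then show "(\<integral>\<^sup>+ n. ennreal ((norm (fourier (h k) (\<beta> * of_int n)))\<^sup>2) \<partial>count_space UNIV) =
       ennreal (1 / \<beta>) * (\<integral>\<^sup>+ t. ennreal ((norm (h k t))\<^sup>2) \<partial>lborel)"
      by (simp add: infsum_ennreal_eq_nn_integral)
  qed
  also have "\<dots> = (\<integral>\<^sup>+ k. (\<integral>\<^sup>+ t. ennreal (1 / \<beta>) * ennreal ((norm (h k t))\<^sup>2) \<partial>lborel) \<partial>count_space UNIV)"
    by (simp add: nn_integral_cmult)
  also have "\<dots> = (\<integral>\<^sup>+ t. (\<integral>\<^sup>+ k. ennreal (1 / \<beta>) * ennreal ((norm (h k t))\<^sup>2) \<partial>count_space UNIV) \<partial>lborel)"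
    by (rule nn_integral_count_space_nn_integral[symmetric]) auto
  also have "\<dots> = (\<integral>\<^sup>+ t. ennreal ((norm (f t))\<^sup>2) *
       (ennreal (1 / \<beta>) * (\<integral>\<^sup>+ k. ennreal ((norm (g (t - \<alpha> * of_int k)))\<^sup>2) \<partial>count_space UNIV)) \<partial>lborel)"
    by (simp add: h_def norm_mult power_mult_distrib ennreal_mult nn_integral_cmult[symmetric] mult_ac)
  finally show ?thesis .
qed

text \<open>The translates of \<open>[0, \<alpha>)\<close> tile the line.  This serves twice: for the translates of a window in
  time, and for the periods of the frequency axis in Plancherel's identity.\<close>

lemma nn_integral_translates_fundamental_domain:
  fixes \<alpha> t :: real
  assumes \<alpha>: "\<alpha> > 0"
  shows "(\<integral>\<^sup>+ k. c * indicator {0..<\<alpha>} (t - \<alpha> * of_int k) \<partial>count_space UNIV) = c"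
proof -
  define m where "m = \<lfloor>t / \<alpha>\<rfloor>"
  have iff: "t - \<alpha> * of_int k \<in> {0..<\<alpha>} \<longleftrightarrow> k = m" for k :: int
  proof -
    have "t - \<alpha> * of_int k \<in> {0..<\<alpha>} \<longleftrightarrow> of_int k \<le> t / \<alpha> \<and> t / \<alpha> < of_int k + 1"
      using \<alpha> by (auto simp: field_simps)
    also have "\<dots> \<longleftrightarrow> k = m" unfolding m_def by linarith
    finally show ?thesis .
  qed
  have "(\<integral>\<^sup>+ k. c * indicator {0..<\<alpha>} (t - \<alpha> * of_int k) \<partial>count_space UNIV) =
    (\<Sum>k\<in>{m}. c * indicator {0..<\<alpha>} (t - \<alpha> * of_int k))"
    by (rule nn_integral_count_space') (simp_all only: indicator_def iff, auto)
  also have "\<dots> = c" using iff[of m] by (simp add: indicator_def)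
  finally show ?thesis .
qed

corollary parseval_frame_constant_modulus:
  assumes \<alpha>: "\<alpha> > 0" and \<beta>: "\<beta> > 0" and "\<alpha> * \<beta> \<le> 1"
    and g: "g \<in> borel_measurable lborel"
    and modulus: "\<And>t. norm (g t) = (if t \<in> {0..<\<alpha>} then sqrt \<beta> else 0)"
  shows "is_parseval_frame (gabor_system g \<alpha> \<beta>)"
proof -
  have "\<alpha> \<le> 1 / \<beta>" using assms by (simp add: field_simps)
  then have supp: "g t = 0" if "t \<notin> {0..0 + 1 / \<beta>}" for t
    using modulus[of t] that by (auto split: if_splits)
  have bound: "norm (g t) \<le> sqrt \<beta>" for t using modulus[of t] \<beta> by auto
  have sq: "ennreal ((norm (g t))\<^sup>2) = ennreal \<beta> * indicator {0..<\<alpha>} t" for t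
    using modulus[of t] \<beta> by (auto simp: indicator_def)
  have one: "ennreal (1 / \<beta>) * ennreal \<beta> = 1"
    using \<beta> by (simp add: ennreal_mult[symmetric])
  have "(\<Sum>\<^sub>\<infinity>i\<in>UNIV. ennreal ((norm (L2_inner f (gabor_system g \<alpha> \<beta> i)))\<^sup>2)) = (Lp_norm lborel 2 f)\<^sup>2"
    if "f \<in> L2" for f
    by (subst gabor_frame_sum_compact_support[where a=0, OF \<beta> g bound supp that])
       (simp_all add: sq nn_integral_translates_fundamental_domain[OF \<alpha>] one Lp_norm_2_power2)
  then show ?thesis
    unfolding is_parseval_frame_def has_frame_bounds_def by simp
qed

lemma parseval_frame_imp_frame: "is_parseval_frame e \<Longrightarrow> is_frame e"
  unfolding is_parseval_frame_def is_frame_def by (intro exI[of _ 1] conjI) simp_all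

section \<open>Plancherel and Moyal identities for compactly supported functions\<close>

text \<open>The short-time Fourier transform of a function as an honest integral; \<open>stft_distribution_of\<close>
  identifies it with the transform of the associated distribution.\<close>

definition STFT :: "(real \<Rightarrow> complex) \<Rightarrow> (real \<Rightarrow> complex) \<Rightarrow> real \<times> real \<Rightarrow> complex" where
  "STFT \<psi> g = (\<lambda>(x, w). LINT t|lborel. g t * cnj (\<psi> (t - x)) * cis (- (2 * pi * w * t)))"

lemma STFT_eq_fourier: "STFT \<psi> g (x, w) = fourier (\<lambda>t. g t * cnj (\<psi> (t - x))) w"
  by (simp add: STFT_def fourier_def)

lemma borel_measurable_fourier [measurable]:
  assumes [measurable]: "h \<in> borel_measurable borel"
  shows "fourier h \<in> borel_measurable borel"
  unfolding fourier_def cis_conv_exp by measurable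

lemma borel_measurable_STFT [measurable]:
  assumes [measurable]: "g \<in> borel_measurable borel" "\<psi> \<in> borel_measurable borel"
  shows "STFT \<psi> g \<in> borel_measurable (borel \<Otimes>\<^sub>M borel)"
  unfolding STFT_def cis_conv_exp by measurable

text \<open>Integrating Parseval's identity for the modulated functions \<open>M\<^sub>-\<^sub>u h\<close> over one
  period of \<open>u\<close> covers all frequencies exactly once.\<close>

theorem plancherel_compact_support:
  fixes h :: "real \<Rightarrow> complex"
  assumes h: "h \<in> borel_measurable lborel" and R: "R > 0"
    and supp: "\<And>t. t \<notin> {a..a + R} \<Longrightarrow> h t = 0"
    and fin: "(\<integral>\<^sup>+ t. ennreal ((norm (h t))\<^sup>2) \<partial>lborel) < top"
  shows "(\<integral>\<^sup>+ w. ennreal ((norm (fourier h w))\<^sup>2) \<partial>lborel) = (\<integral>\<^sup>+ t. ennreal ((norm (h t))\<^sup>2) \<partial>lborel)"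
proof -
  define \<beta> where "\<beta> = 1 / R"
  have \<beta>: "\<beta> > 0" "1 / \<beta> = R" using R by (auto simp: \<beta>_def)
  have hm [measurable]: "h \<in> borel_measurable borel" using h by simp
  define F where "F w = ennreal ((norm (fourier h w))\<^sup>2)" for w
  have Fm [measurable]: "F \<in> borel_measurable borel" unfolding F_def by measurable
  define I where "I = (\<integral>\<^sup>+ t. ennreal ((norm (h t))\<^sup>2) \<partial>lborel)"
  have per: "(\<integral>\<^sup>+ k. F (u + \<beta> * of_int k) \<partial>count_space UNIV) = ennreal (1 / \<beta>) * I" for u
  proof -
    define g where "g t = h t * cis (- (2 * pi * u * t))" for t
    have gh: "norm (g t) = norm (h t)" for t by (simp add: g_def norm_mult)
    have f: "fourier g w = fourier h (u + w)" for w
    proof -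
      have "cis (- (2 * pi * u * t)) * cis (- (2 * pi * w * t)) = cis (- (2 * pi * (u + w) * t))" for t
        by (simp add: cis_mult algebra_simps)
      then show ?thesis unfolding fourier_def g_def by (simp add: mult.assoc)
    qed
    have gm: "g \<in> borel_measurable lborel" unfolding g_def cis_conv_exp by measurable
    have "(\<Sum>\<^sub>\<infinity>n\<in>UNIV. ennreal ((norm (fourier g (\<beta> * of_int n)))\<^sup>2)) =
      ennreal (1 / \<beta>) * (\<integral>\<^sup>+ t. ennreal ((norm (g t))\<^sup>2) \<partial>lborel)"
      by (rule fourier_series_Parseval[OF \<beta>(1) gm, where a=a]) (use supp fin \<beta>(2) in \<open>auto simp: gh\<close>, auto simp: g_def)
    then show ?thesis by (simp add: infsum_ennreal_eq_nn_integral F_def f gh I_def)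
  qed
  have "(\<integral>\<^sup>+ w. F w \<partial>lborel) = (\<integral>\<^sup>+ w. (\<integral>\<^sup>+ k. F w * indicator {0..<\<beta>} (w - \<beta> * of_int k) \<partial>count_space UNIV) \<partial>lborel)"
    by (simp add: nn_integral_translates_fundamental_domain[OF \<beta>(1)])
  also have "\<dots> = (\<integral>\<^sup>+ k. (\<integral>\<^sup>+ w. F w * indicator {0..<\<beta>} (w - \<beta> * of_int k) \<partial>lborel) \<partial>count_space UNIV)"
    by (rule nn_integral_count_space_nn_integral) auto
  also have "\<dots> = (\<integral>\<^sup>+ k. (\<integral>\<^sup>+ u. F (u + \<beta> * of_int k) * indicator {0..<\<beta>} u \<partial>lborel) \<partial>count_space UNIV)"
  proof (rule nn_integral_cong)
    fix k :: int
    show "(\<integral>\<^sup>+ w. F w * indicator {0..<\<beta>} (w - \<beta> * of_int k) \<partial>lborel) = (\<integral>\<^sup>+ u. F (u + \<beta> * of_int k) * indicator {0..<\<beta>} u \<partial>lborel)"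
      by (subst nn_integral_real_affine[where c=1 and t="\<beta> * of_int k"]) (auto simp: add.commute)
  qed
  also have "\<dots> = (\<integral>\<^sup>+ u. (\<integral>\<^sup>+ k. F (u + \<beta> * of_int k) * indicator {0..<\<beta>} u \<partial>count_space UNIV) \<partial>lborel)"
    by (rule nn_integral_count_space_nn_integral[symmetric]) auto
  also have "\<dots> = (\<integral>\<^sup>+ u. ennreal (1 / \<beta>) * I * indicator {0..<\<beta>} u \<partial>lborel)"
    by (simp add: nn_integral_multc per)
  also have "\<dots> = (ennreal (1 / \<beta>) * ennreal \<beta>) * I"
  proof -
    have "(\<integral>\<^sup>+ u. ennreal (1 / \<beta>) * I * indicator {0..<\<beta>} u \<partial>lborel) = ennreal (1 / \<beta>) * I * emeasure lborel {0..<\<beta>}"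
      by (rule nn_integral_cmult_indicator) simp
    then show ?thesis using \<beta>(1) by (simp add: mult_ac)
  qed
  also have "\<dots> = I" using \<beta>(1) by (simp add: ennreal_mult[symmetric])
  finally show ?thesis by (simp add: F_def I_def)
qed

text \<open>Plancherel's identity in the frequency variable, for each fixed position, leaves a convolution
  whose integral Tonelli's theorem factors.\<close>

theorem moyal_compact_support:
  fixes g \<psi> :: "real \<Rightarrow> complex"
  assumes g: "g \<in> borel_measurable borel" and \<psi>: "\<psi> \<in> borel_measurable borel"
    and R: "R > 0" and supp: "\<And>t. t \<notin> {a..a + R} \<Longrightarrow> g t = 0"
    and bg: "\<And>t. norm (g t) \<le> K" and b\<psi>: "\<And>t. norm (\<psi> t) \<le> C"
  shows "(\<integral>\<^sup>+ z. ennreal ((norm (STFT \<psi> g z))\<^sup>2) \<partial>lborel) =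
    (\<integral>\<^sup>+ t. ennreal ((norm (g t))\<^sup>2) \<partial>lborel) * (\<integral>\<^sup>+ t. ennreal ((norm (\<psi> t))\<^sup>2) \<partial>lborel)"
proof -
  note [measurable] = g \<psi>
  define h where "h x t = g t * cnj (\<psi> (t - x))" for x t
  define J where "J = (\<integral>\<^sup>+ t. ennreal ((norm (\<psi> t))\<^sup>2) \<partial>lborel)"
  have K: "0 \<le> K" and C: "0 \<le> C" using bg b\<psi> norm_ge_zero order.trans by blast+
  have pl: "(\<integral>\<^sup>+ w. ennreal ((norm (fourier (h x) w))\<^sup>2) \<partial>lborel) = (\<integral>\<^sup>+ t. ennreal ((norm (h x t))\<^sup>2) \<partial>lborel)" for x
  proof (rule plancherel_compact_support[OF _ R, where a=a])
    show "h x \<in> borel_measurable lborel" unfolding h_def by measurable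
    show "h x t = 0" if "t \<notin> {a..a + R}" for t using supp[OF that] by (simp add: h_def)
    have "ennreal ((norm (h x t))\<^sup>2) \<le> ennreal ((K * C)\<^sup>2) * indicator {a..a + R} t" for t
    proof (cases "t \<in> {a..a + R}")
      case True
      have "norm (h x t) \<le> K * C"
        unfolding h_def norm_mult complex_mod_cnj using K by (intro mult_mono bg b\<psi>) auto
      then show ?thesis using True by (auto intro!: ennreal_leI power_mono)
    next
      case False
      then show ?thesis using supp[OF False] by (simp add: h_def)
    qed
    then have "(\<integral>\<^sup>+ t. ennreal ((norm (h x t))\<^sup>2) \<partial>lborel) \<le> (\<integral>\<^sup>+ t. ennreal ((K * C)\<^sup>2) * indicator {a..a + R} t \<partial>lborel)"
      by (intro nn_integral_mono)
    also have "\<dots> < top" using R by (simp add: nn_integral_cmult_indicator ennreal_mult_less_top)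
    finally show "(\<integral>\<^sup>+ t. ennreal ((norm (h x t))\<^sup>2) \<partial>lborel) < top" .
  qed
  have "(\<integral>\<^sup>+ z. ennreal ((norm (STFT \<psi> g z))\<^sup>2) \<partial>lborel) =
    (\<integral>\<^sup>+ z. ennreal ((norm (STFT \<psi> g z))\<^sup>2) \<partial>(lborel \<Otimes>\<^sub>M lborel))"
    by (simp add: lborel_prod)
  also have "\<dots> = (\<integral>\<^sup>+ x. (\<integral>\<^sup>+ w. ennreal ((norm (STFT \<psi> g (x, w)))\<^sup>2) \<partial>lborel) \<partial>lborel)"
    by (rule lborel.nn_integral_fst[symmetric]) measurable
  also have "\<dots> = (\<integral>\<^sup>+ x. (\<integral>\<^sup>+ t. ennreal ((norm (h x t))\<^sup>2) \<partial>lborel) \<partial>lborel)"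
    by (simp add: STFT_eq_fourier h_def[symmetric] pl)
  also have "\<dots> = (\<integral>\<^sup>+ t. (\<integral>\<^sup>+ x. ennreal ((norm (h x t))\<^sup>2) \<partial>lborel) \<partial>lborel)"
    unfolding h_def by (rule lborel_pair.Fubini') measurable
  also have "\<dots> = (\<integral>\<^sup>+ t. ennreal ((norm (g t))\<^sup>2) * J \<partial>lborel)"
  proof (rule nn_integral_cong)
    fix t
    have "(\<integral>\<^sup>+ x. ennreal ((norm (h x t))\<^sup>2) \<partial>lborel) = ennreal ((norm (g t))\<^sup>2) * (\<integral>\<^sup>+ x. ennreal ((norm (\<psi> (t - x)))\<^sup>2) \<partial>lborel)"
      by (simp add: h_def norm_mult power_mult_distrib ennreal_mult nn_integral_cmult)
    also have "(\<integral>\<^sup>+ x. ennreal ((norm (\<psi> (t - x)))\<^sup>2) \<partial>lborel) = J"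
      unfolding J_def by (subst (2) nn_integral_real_affine[where c="- 1" and t=t]) auto
    finally show "(\<integral>\<^sup>+ x. ennreal ((norm (h x t))\<^sup>2) \<partial>lborel) = ennreal ((norm (g t))\<^sup>2) * J" .
  qed
  also have "\<dots> = (\<integral>\<^sup>+ t. ennreal ((norm (g t))\<^sup>2) \<partial>lborel) * J"
    by (rule nn_integral_multc) measurable
  finally show ?thesis by (simp add: J_def)
qed

section \<open>Schwartz functions and regular distributions\<close>

lemma nth_deriv_0 [simp]: "nth_deriv 0 \<phi> = \<phi>"
  by (simp add: nth_deriv_def)

lemma nth_deriv_Suc: "nth_deriv (Suc n) \<phi> = (\<lambda>x. vector_derivative (nth_deriv n \<phi>) (at x))"
  by (simp add: nth_deriv_def)

lemma schwartz_iff: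
  "\<phi> \<in> schwartz \<longleftrightarrow> (\<forall>n x. nth_deriv n \<phi> differentiable (at x)) \<and>
     (\<forall>m n. \<exists>B. \<forall>x. \<bar>x\<bar> ^ m * norm (nth_deriv n \<phi> x) \<le> B)"
  by (simp add: schwartz_def bounded_iff norm_mult norm_power)

lemma schwartz_has_derivative:
  "\<phi> \<in> schwartz \<Longrightarrow> (nth_deriv n \<phi> has_vector_derivative nth_deriv (Suc n) \<phi> x) (at x)"
  by (simp add: schwartz_iff vector_derivative_works nth_deriv_Suc)

lemma schwartz_decay: "\<phi> \<in> schwartz \<Longrightarrow> \<exists>B. \<forall>x. \<bar>x\<bar> ^ m * norm (nth_deriv n \<phi> x) \<le> B"
  by (simp add: schwartz_iff)

text \<open>The recursion defining \<open>nth_deriv\<close> is awkward to unfold; giving the whole sequence of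
  derivatives at once avoids it.\<close>

lemma schwartzI:
  assumes "\<And>n x. (D n has_vector_derivative D (Suc n) x) (at x)" and "D 0 = \<phi>"
    and "\<And>m n. \<exists>B. \<forall>x. \<bar>x\<bar> ^ m * norm (D n x) \<le> B"
  shows "\<phi> \<in> schwartz"
proof -
  have D: "nth_deriv n \<phi> = D n" for n
    by (induction n) (use assms(1,2) in \<open>auto simp: nth_deriv_Suc vector_derivative_at\<close>)
  show ?thesis
    unfolding schwartz_iff D using assms(1,3) differentiableI_vector by blast
qed

lemma schwartz_deriv:
  assumes "\<phi> \<in> schwartz"
  shows "nth_deriv 1 \<phi> \<in> schwartz"
proof (rule schwartzI[where D="\<lambda>n. nth_deriv (Suc n) \<phi>"])
  show "(nth_deriv (Suc n) \<phi> has_vector_derivative nth_deriv (Suc (Suc n)) \<phi> x) (at x)" for n x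
    by (rule schwartz_has_derivative[OF assms])
qed (use assms schwartz_decay in auto)

lemma schwartz_add:
  assumes \<phi>: "\<phi> \<in> schwartz" and \<eta>: "\<eta> \<in> schwartz"
  shows "(\<lambda>x. \<phi> x + \<eta> x) \<in> schwartz"
proof (rule schwartzI[where D="\<lambda>n x. nth_deriv n \<phi> x + nth_deriv n \<eta> x"])
  show "((\<lambda>x. nth_deriv n \<phi> x + nth_deriv n \<eta> x) has_vector_derivative
      nth_deriv (Suc n) \<phi> x + nth_deriv (Suc n) \<eta> x) (at x)" for n x
    by (intro has_vector_derivative_add schwartz_has_derivative \<phi> \<eta>)
  fix m n
  obtain A B where AB: "\<And>x. \<bar>x\<bar> ^ m * norm (nth_deriv n \<phi> x) \<le> A" "\<And>x. \<bar>x\<bar> ^ m * norm (nth_deriv n \<eta> x) \<le> B"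
    using schwartz_decay[OF \<phi>] schwartz_decay[OF \<eta>] by metis
  have "\<bar>x\<bar> ^ m * norm (nth_deriv n \<phi> x + nth_deriv n \<eta> x) \<le> A + B" for x
  proof -
    have "\<bar>x\<bar> ^ m * norm (nth_deriv n \<phi> x + nth_deriv n \<eta> x)
        \<le> \<bar>x\<bar> ^ m * (norm (nth_deriv n \<phi> x) + norm (nth_deriv n \<eta> x))"
      by (intro mult_left_mono norm_triangle_ineq) auto
    then show ?thesis using AB[of x] by (simp add: distrib_left)
  qed
  then show "\<exists>B. \<forall>x. \<bar>x\<bar> ^ m * norm (nth_deriv n \<phi> x + nth_deriv n \<eta> x) \<le> B" by blast
qed auto

lemma schwartz_bounded_linear:
  assumes L: "bounded_linear L" and \<phi>: "\<phi> \<in> schwartz"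
  shows "(\<lambda>x. L (\<phi> x)) \<in> schwartz"
proof (rule schwartzI[where D="\<lambda>n x. L (nth_deriv n \<phi> x)"])
  show "((\<lambda>x. L (nth_deriv n \<phi> x)) has_vector_derivative L (nth_deriv (Suc n) \<phi> x)) (at x)" for n x
    by (rule bounded_linear.has_vector_derivative[OF L schwartz_has_derivative[OF \<phi>]])
  fix m n
  obtain A where A: "\<And>x. \<bar>x\<bar> ^ m * norm (nth_deriv n \<phi> x) \<le> A"
    using schwartz_decay[OF \<phi>] by metis
  obtain K where K: "K \<ge> 0" "\<And>y. norm (L y) \<le> norm y * K"
    using bounded_linear.nonneg_bounded[OF L] by blast
  have "\<bar>x\<bar> ^ m * norm (L (nth_deriv n \<phi> x)) \<le> A * K" for x
  proof -
    have "\<bar>x\<bar> ^ m * norm (L (nth_deriv n \<phi> x)) \<le> \<bar>x\<bar> ^ m * (norm (nth_deriv n \<phi> x) * K)"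
      by (intro mult_left_mono K) auto
    also have "\<dots> \<le> A * K" using mult_right_mono[OF A K(1)] by (simp add: mult.assoc)
    finally show ?thesis .
  qed
  then show "\<exists>B. \<forall>x. \<bar>x\<bar> ^ m * norm (L (nth_deriv n \<phi> x)) \<le> B" by blast
qed auto

lemma schwartz_translation:
  assumes \<phi>: "\<phi> \<in> schwartz"
  shows "translation c \<phi> \<in> schwartz"
proof (rule schwartzI[where D="\<lambda>n x. nth_deriv n \<phi> (x - c)"])
  show "((\<lambda>x. nth_deriv n \<phi> (x - c)) has_vector_derivative nth_deriv (Suc n) \<phi> (x - c)) (at x)" for n x
    using vector_diff_chain_at[OF _ schwartz_has_derivative[OF \<phi>], of "\<lambda>x. x - c" 1 x n]
    by (simp add: o_def has_vector_derivative_diff_const has_vector_derivative_id)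
  fix m n
  obtain A B where A: "\<And>x. \<bar>x\<bar> ^ m * norm (nth_deriv n \<phi> x) \<le> A" and B: "\<And>x. \<bar>x\<bar> ^ 0 * norm (nth_deriv n \<phi> x) \<le> B"
    using schwartz_decay[OF \<phi>] by metis
  have "\<bar>x\<bar> ^ m * norm (nth_deriv n \<phi> (x - c)) \<le> 2 ^ m * (A + \<bar>c\<bar> ^ m * B)" for x
  proof -
    have "\<bar>x\<bar> \<le> 2 * max \<bar>x - c\<bar> \<bar>c\<bar>"
      using abs_triangle_ineq[of "x - c" c] by (auto simp: max_def)
    then have "\<bar>x\<bar> ^ m \<le> (2 * max \<bar>x - c\<bar> \<bar>c\<bar>) ^ m" by (intro power_mono) auto
    also have "\<dots> \<le> 2 ^ m * (\<bar>x - c\<bar> ^ m + \<bar>c\<bar> ^ m)"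
      by (auto simp: power_mult_distrib max_def)
    finally have "\<bar>x\<bar> ^ m * norm (nth_deriv n \<phi> (x - c)) \<le> 2 ^ m * (\<bar>x - c\<bar> ^ m + \<bar>c\<bar> ^ m) * norm (nth_deriv n \<phi> (x - c))"
      by (intro mult_right_mono) auto
    also have "\<dots> = 2 ^ m * (\<bar>x - c\<bar> ^ m * norm (nth_deriv n \<phi> (x - c)) + \<bar>c\<bar> ^ m * norm (nth_deriv n \<phi> (x - c)))"
      by (simp add: algebra_simps)
    also have "\<dots> \<le> 2 ^ m * (A + \<bar>c\<bar> ^ m * B)"
      using A[of "x - c"] B[of "x - c"] by (intro mult_left_mono add_mono) auto
    finally show ?thesis .
  qed
  then show "\<exists>B. \<forall>x. \<bar>x\<bar> ^ m * norm (nth_deriv n \<phi> (x - c)) \<le> B" by blast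
qed (simp add: translation_def)

lemma schwartz_modulation:
  assumes \<phi>: "\<phi> \<in> schwartz"
  shows "modulation \<xi> \<phi> \<in> schwartz"
proof -
  define c where "c = 2 * pi * \<xi>"
  define E where "E x = cis (c * x)" for x
  have E: "(E has_vector_derivative (\<i> * c * E x)) (at x)" for x
    unfolding E_def cis_conv_exp
    by (rule has_vector_derivative_real_field derivative_eq_intros refl | simp)+
  \<comment> \<open>Differentiating \<open>E * \<eta>\<close> gives \<open>E * next_coeff \<eta>\<close>, so all derivatives of the modulated
    function are \<open>E\<close> times a Schwartz function.\<close>
  define next_coeff where "next_coeff \<eta> = (\<lambda>x. \<i> * c * \<eta> x + nth_deriv 1 \<eta> x)" for \<eta>
  have next_coeff: "next_coeff \<eta> \<in> schwartz" if "\<eta> \<in> schwartz" for \<eta>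
    unfolding next_coeff_def
    by (intro schwartz_add schwartz_deriv that schwartz_bounded_linear[OF bounded_linear_mult_right])
  define C where "C n = (next_coeff ^^ n) \<phi>" for n
  have C: "C n \<in> schwartz" for n
    by (induction n) (simp_all add: C_def \<phi> next_coeff)
  show ?thesis
  proof (rule schwartzI[where D="\<lambda>n x. E x * C n x"])
    show "((\<lambda>x. E x * C n x) has_vector_derivative E x * C (Suc n) x) (at x)" for n x
    proof -
      have "((\<lambda>x. E x * C n x) has_vector_derivative (E x * nth_deriv 1 (C n) x + \<i> * c * E x * C n x)) (at x)"
        using has_vector_derivative_mult[OF E schwartz_has_derivative[OF C, of 0]] by simp
      then show ?thesis by (simp add: C_def next_coeff_def algebra_simps)
    qed
    show "(\<lambda>x. E x * C 0 x) = modulation \<xi> \<phi>"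
      by (simp add: fun_eq_iff C_def E_def c_def modulation_def cis_conv_exp mult_ac)
    show "\<exists>B. \<forall>x. \<bar>x\<bar> ^ m * norm (E x * C n x) \<le> B" for m n
      using schwartz_decay[OF C, where n=0 and m=m] by (simp add: E_def norm_mult)
  qed
qed

lemma schwartz_continuous:
  assumes "\<phi> \<in> schwartz"
  shows "continuous_on S \<phi>"
  using schwartz_has_derivative[OF assms, of 0]
  by (auto intro!: continuous_at_imp_continuous_on has_vector_derivative_continuous)

lemma schwartz_measurable: "\<phi> \<in> schwartz \<Longrightarrow> \<phi> \<in> borel_measurable borel"
  by (intro borel_measurable_continuous_onI schwartz_continuous)

lemma schwartz_bounded:
  assumes "\<phi> \<in> schwartz"
  obtains B where "B > 0" "\<And>x. norm (\<phi> x) \<le> B"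
proof -
  obtain B where B: "\<And>x. \<bar>x\<bar> ^ 0 * norm (nth_deriv 0 \<phi> x) \<le> B" using schwartz_decay[OF assms] by blast
  have "norm (\<phi> x) \<le> max B 1" for x using B[of x] by simp
  then show thesis using that[of "max B 1"] by simp
qed

lemma schwartz_quadratic_decay:
  assumes "\<phi> \<in> schwartz"
  obtains C where "C > 0" "\<And>x. (1 + x\<^sup>2) * norm (\<phi> x) \<le> C" "\<And>x. (1 + x\<^sup>2) * norm (nth_deriv 1 \<phi> x) \<le> C"
proof -
  have "\<exists>A. \<forall>x. (1 + x\<^sup>2) * norm (nth_deriv n \<phi> x) \<le> A" for n
  proof -
    obtain A B where A: "\<And>x. \<bar>x\<bar> ^ 0 * norm (nth_deriv n \<phi> x) \<le> A" and B: "\<And>x. \<bar>x\<bar> ^ 2 * norm (nth_deriv n \<phi> x) \<le> B"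
      using schwartz_decay[OF assms] by metis
    have "(1 + x\<^sup>2) * norm (nth_deriv n \<phi> x) \<le> A + B" for x
      using A[of x] B[of x] by (simp add: distrib_right)
    then show ?thesis by blast
  qed
  then obtain A B where A: "\<And>x. (1 + x\<^sup>2) * norm (nth_deriv 0 \<phi> x) \<le> A"
    and B: "\<And>x. (1 + x\<^sup>2) * norm (nth_deriv 1 \<phi> x) \<le> B"
    by metis
  show thesis
  proof (rule that[of "max 1 (max A B)"])
    show "(1 + x\<^sup>2) * norm (\<phi> x) \<le> max 1 (max A B)" for x
      using A[of x] by simp
    show "(1 + x\<^sup>2) * norm (nth_deriv 1 \<phi> x) \<le> max 1 (max A B)" for x
      using B[of x] by linarith
  qed simp
qed

lemma integrable_bounded_support:
  fixes g \<phi> :: "real \<Rightarrow> complex"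
  assumes "g \<in> borel_measurable borel" "\<And>t. norm (g t) \<le> K" "\<And>t. t \<notin> {a..b} \<Longrightarrow> g t = 0"
    and "\<phi> \<in> borel_measurable borel" "\<And>t. norm (\<phi> t) \<le> C"
  shows "integrable lborel (\<lambda>t. g t * \<phi> t)"
    and "norm (LINT t|lborel. g t * \<phi> t) \<le> K * C * measure lborel {a..b}"
proof -
  note [measurable] = assms(1,4)
  have K: "0 \<le> K" using assms(2)[of 0] norm_ge_zero order.trans by blast
  have b: "norm (g t * \<phi> t) \<le> K * C * indicator {a..b} t" for t
  proof (cases "t \<in> {a..b}")
    case True
    then show ?thesis using mult_mono[OF assms(2,5)] K by (simp add: norm_mult)
  qed (use assms(3) in auto)
  have i: "integrable lborel (\<lambda>t. K * C * indicator {a..b} t)"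
    by (intro integrable_mult_right integrable_real_indicator) (auto simp: emeasure_lborel_Icc_eq)
  show "integrable lborel (\<lambda>t. g t * \<phi> t)"
    by (rule Bochner_Integration.integrable_bound[OF i]) (use b in \<open>auto intro: order.trans[OF _ abs_ge_self]\<close>)
  have "norm (LINT t|lborel. g t * \<phi> t) \<le> (LINT t|lborel. K * C * indicator {a..b} t)"
    by (rule Bochner_Integration.integral_norm_bound_integral[OF \<open>integrable lborel (\<lambda>t. g t * \<phi> t)\<close> i b])
  also have "\<dots> = K * C * measure lborel {a..b}" by simp
  finally show "norm (LINT t|lborel. g t * \<phi> t) \<le> K * C * measure lborel {a..b}" .
qed

lemma seminorm_0_bound:
  assumes \<phi>: "\<phi> \<in> schwartz" and \<eta>: "\<eta> \<in> schwartz"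
  shows "norm (\<eta> x - \<phi> x) \<le> schwartz_seminorm 0 0 (\<lambda>x. \<eta> x - \<phi> x)"
proof -
  obtain A where A: "\<And>x. norm (\<phi> x) \<le> A" using schwartz_bounded[OF \<phi>] by blast
  obtain B where B: "\<And>x. norm (\<eta> x) \<le> B" using schwartz_bounded[OF \<eta>] by blast
  have "bdd_above (range (\<lambda>x. norm (\<eta> x - \<phi> x)))"
  proof (rule bdd_aboveI2)
    show "norm (\<eta> x - \<phi> x) \<le> B + A" for x
      using norm_triangle_ineq4[of "\<eta> x" "\<phi> x"] A[of x] B[of x] by linarith
  qed
  then show ?thesis unfolding schwartz_seminorm_def using cSUP_upper[of x UNIV "\<lambda>x. norm (\<eta> x - \<phi> x)"] by simp
qed

text \<open>For a bounded function of compact support the supremum norm, the seminorm with indices zero,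
  controls the pairing.\<close>

lemma distribution_of_tempered:
  assumes g: "g \<in> borel_measurable borel" "\<And>t. norm (g t) \<le> K" "\<And>t. t \<notin> {a..b} \<Longrightarrow> g t = 0"
  shows "distribution_of g \<in> tempered_distributions"
proof -
  have i: "integrable lborel (\<lambda>t. g t * \<phi> t)" if \<phi>: "\<phi> \<in> schwartz" for \<phi>
    using schwartz_bounded[OF \<phi>] integrable_bounded_support(1)[OF g schwartz_measurable[OF \<phi>]] by metis
  have K: "K \<ge> 0" using g(2)[of 0] norm_ge_zero order.trans by blast
  define D where "D = K * measure lborel {a..b} + 1"
  have D: "D > 0" using K by (simp add: D_def add_nonneg_pos)
  have val: "distribution_of g \<phi> = (LINT t|lborel. g t * \<phi> t)" if "\<phi> \<in> schwartz" for \<phi>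
    using that by (simp add: distribution_of_def)
  have lip: "dist (distribution_of g \<eta>) (distribution_of g \<phi>) < e"
    if \<phi>: "\<phi> \<in> schwartz" and \<eta>: "\<eta> \<in> schwartz" and lt: "schwartz_seminorm 0 0 (\<lambda>x. \<eta> x - \<phi> x) < e / D" for \<phi> \<eta> e
  proof -
    define s where "s = schwartz_seminorm 0 0 (\<lambda>x. \<eta> x - \<phi> x)"
    have sb: "norm (\<eta> x - \<phi> x) \<le> s" for x unfolding s_def by (rule seminorm_0_bound[OF \<phi> \<eta>])
    have s0: "s \<ge> 0" using sb[of 0] norm_ge_zero order.trans by blast
    have m: "(\<lambda>t. \<eta> t - \<phi> t) \<in> borel_measurable borel"
      using schwartz_measurable[OF \<phi>] schwartz_measurable[OF \<eta>] by measurable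
    have "distribution_of g \<eta> - distribution_of g \<phi> = (LINT t|lborel. g t * (\<eta> t - \<phi> t))"
      using i[OF \<phi>] i[OF \<eta>] by (simp add: val \<phi> \<eta> right_diff_distrib)
    then have "dist (distribution_of g \<eta>) (distribution_of g \<phi>) \<le> K * s * measure lborel {a..b}"
      using integrable_bounded_support(2)[OF g m sb] by (simp add: dist_norm)
    also have "\<dots> \<le> D * s" using s0 by (simp add: D_def algebra_simps)
    also have "\<dots> < e" using lt D unfolding s_def[symmetric] by (simp add: field_simps)
    finally show ?thesis .
  qed
  have cont: "continuous_map schwartz_topology euclidean (distribution_of g)"
    unfolding continuous_map
  proof (intro conjI allI impI)
    show "distribution_of g ` topspace schwartz_topology \<subseteq> topspace euclidean" by simp
    fix U :: "complex set" assume "openin euclidean U"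
    then have U: "open U" by simp
    show "openin schwartz_topology {\<phi> \<in> topspace schwartz_topology. distribution_of g \<phi> \<in> U}"
    proof (subst openin_subopen, intro ballI)
      fix \<phi> assume "\<phi> \<in> {\<phi> \<in> topspace schwartz_topology. distribution_of g \<phi> \<in> U}"
      then have "\<phi> \<in> topspace schwartz_topology" and \<phi>U: "distribution_of g \<phi> \<in> U" by auto
      then have \<phi>: "\<phi> \<in> schwartz"
        unfolding schwartz_topology_def topology_generated_by_topspace by auto
      obtain e where e: "e > 0" "\<And>y. dist y (distribution_of g \<phi>) < e \<Longrightarrow> y \<in> U"
        using U \<phi>U unfolding open_dist by blast
      define T where "T = {\<eta> \<in> schwartz. schwartz_seminorm 0 0 (\<lambda>x. \<eta> x - \<phi> x) < e / D}"
      have oT: "openin schwartz_topology T"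
        unfolding schwartz_topology_def T_def
        by (rule topology_generated_by_Basis) (use \<phi> e D in \<open>auto intro!: exI[of _ "0::nat"] exI[of _ \<phi>] exI[of _ "e / D"]\<close>)
      have "schwartz_seminorm 0 0 (\<lambda>x. \<phi> x - \<phi> x) = 0"
        by (simp add: schwartz_seminorm_def)
      then have "\<phi> \<in> T" using \<phi> e D by (simp add: T_def)
      moreover have "T \<subseteq> {\<phi> \<in> topspace schwartz_topology. distribution_of g \<phi> \<in> U}"
        using openin_subset[OF oT] e(2) lip[OF \<phi>] by (auto simp: T_def)
      ultimately show "\<exists>T. openin schwartz_topology T \<and> \<phi> \<in> T \<and> T \<subseteq> {\<phi> \<in> topspace schwartz_topology. distribution_of g \<phi> \<in> U}"
        using oT by blast
    qed
  qed
  have add: "distribution_of g (\<lambda>x. \<phi> x + \<eta> x) = distribution_of g \<phi> + distribution_of g \<eta>"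
    if "\<phi> \<in> schwartz" "\<eta> \<in> schwartz" for \<phi> \<eta>
    using that i by (simp add: val schwartz_add distrib_left)
  have mult: "distribution_of g (\<lambda>x. c * \<phi> x) = c * distribution_of g \<phi>" if "\<phi> \<in> schwartz" for c \<phi>
    using that schwartz_bounded_linear[OF bounded_linear_mult_right that]
    by (simp add: val mult.left_commute[of _ c])
  show ?thesis
    unfolding tempered_distributions_def using cont add mult by (auto simp: distribution_of_def)
qed

lemma stft_distribution_of:
  assumes \<psi>: "\<psi> \<in> schwartz"
  shows "stft \<psi> (distribution_of g) = STFT \<psi> g"
proof (rule ext, clarify)
  fix x w :: real
  have "(\<lambda>t. cnj (modulation w (translation x \<psi>) t)) \<in> schwartz"
    by (intro schwartz_bounded_linear[OF bounded_linear_cnj] schwartz_modulation schwartz_translation \<psi>)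
  moreover have "cnj (modulation w (translation x \<psi>) t) = cnj (\<psi> (t - x)) * cis (- (2 * pi * w * t))" for t
    by (simp add: modulation_def translation_def cis_conv_exp exp_cnj mult_ac)
  ultimately show "stft \<psi> (distribution_of g) (x, w) = STFT \<psi> g (x, w)"
    by (simp add: stft_def distribution_of_def STFT_def mult.assoc)
qed

lemma modulation_space_distribution_of_iff:
  assumes "\<psi> \<in> schwartz" and "g \<in> borel_measurable borel" "\<And>t. norm (g t) \<le> K" "\<And>t. t \<notin> {a..b} \<Longrightarrow> g t = 0"
  shows "distribution_of g \<in> modulation_space \<psi> p \<longleftrightarrow>
    (\<integral>\<^sup>+ z. ennreal (norm (STFT \<psi> g z) powr p) \<partial>lborel) < top"
  using distribution_of_tempered[OF assms(2-4)]
  by (simp add: modulation_space_def modulation_norm_def Lp_norm_less_top_iff stft_distribution_of[OF assms(1)])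

section \<open>Oscillatory integrals of chirps\<close>

lemma continuous_on_cis_square [continuous_intros]: "continuous_on S (\<lambda>v. cis (L * v\<^sup>2))"
  by (intro continuous_intros)

lemma exp_square_primitive:
  fixes K z :: complex
  assumes "K \<noteq> 0" "z \<noteq> 0"
  shows "((\<lambda>z. exp (K * z\<^sup>2) / (2 * K * z)) has_field_derivative
    (exp (K * z\<^sup>2) - exp (K * z\<^sup>2) / (2 * K * z\<^sup>2))) (at z)"
proof -
  have "((\<lambda>z. exp (K * z\<^sup>2) / (2 * K * z)) has_field_derivative
     (exp (K * z\<^sup>2) * (K * (2 * z)) * (2 * K * z) - exp (K * z\<^sup>2) * (2 * K)) / (2 * K * z * (2 * K * z))) (at z)"
    by (rule derivative_eq_intros refl | use assms in simp)+
  moreover have "(exp (K * z\<^sup>2) * (K * (2 * z)) * (2 * K * z) - exp (K * z\<^sup>2) * (2 * K)) / (2 * K * z * (2 * K * z)) =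
     exp (K * z\<^sup>2) - exp (K * z\<^sup>2) / (2 * K * z\<^sup>2)"
    using assms by (simp add: diff_divide_distrib power2_eq_square)
  ultimately show ?thesis by simp
qed

text \<open>Integrating by parts against \<open>2iLv\<close>: away from the stationary point \<open>0\<close> the integral is
  controlled by the smallest phase derivative.\<close>

lemma chirp_integral_nonstationary:
  fixes L m a b :: real
  assumes L: "L > 0" and m: "0 < m" "m \<le> a" and ab: "a \<le> b"
  shows "norm (integral {a..b} (\<lambda>v. cis (L * v\<^sup>2))) \<le> 1 / (L * m)"
proof -
  define G where "G v = cis (L * v\<^sup>2) / (2 * \<i> * L * v)" for v :: real
  define R where "R v = cis (L * v\<^sup>2) / (2 * \<i> * L * (complex_of_real v)\<^sup>2)" for v :: real
  have pos: "v > 0" if "v \<in> {a..b}" for v using that m by auto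
  have "(G has_vector_derivative (cis (L * v\<^sup>2) - R v)) (at v within {a..b})" if "v \<in> {a..b}" for v
  proof -
    have "v \<noteq> 0" using pos[OF that] by simp
    define K where "K = \<i> * complex_of_real L"
    have K: "K \<noteq> 0" using L by (simp add: K_def)
    have "((\<lambda>z. exp (K * z\<^sup>2) / (2 * K * z)) has_field_derivative
        (exp (K * (complex_of_real v)\<^sup>2) - exp (K * (complex_of_real v)\<^sup>2) / (2 * K * (complex_of_real v)\<^sup>2))) (at (complex_of_real v))"
      by (rule exp_square_primitive) (use K \<open>v \<noteq> 0\<close> in auto)
    from has_vector_derivative_real_field[OF this, of "{a..b}"]
    show ?thesis
      by (simp add: G_def[abs_def] R_def cis_conv_exp K_def mult.assoc)
  qed
  then have FTC: "((\<lambda>v. cis (L * v\<^sup>2) - R v) has_integral (G b - G a)) {a..b}"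
    by (intro fundamental_theorem_of_calculus ab)
  have cR: "continuous_on {a..b} R"
    unfolding R_def using m L by (intro continuous_on_divide continuous_intros) auto
  have Ri: "R integrable_on {a..b}" by (rule integrable_continuous_real[OF cR])
  have sum: "integral {a..b} (\<lambda>v. cis (L * v\<^sup>2)) = (G b - G a) + integral {a..b} R"
    using has_integral_add[OF FTC integrable_integral[OF Ri]] by (simp add: integral_unique)
  have nG: "norm (G v) = 1 / (2 * L * v)" if "v \<in> {a..b}" for v
    using L pos[OF that] by (simp add: G_def norm_divide norm_mult)
  have I: "((\<lambda>v. 1 / (2 * L * v\<^sup>2)) has_integral (1 / (2 * L * a) - 1 / (2 * L * b))) {a..b}"
  proof -
    have "((\<lambda>v. - (1 / (2 * L * v))) has_vector_derivative 1 / (2 * L * v\<^sup>2)) (at v within {a..b})" if "v \<in> {a..b}" for v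
      unfolding has_real_derivative_iff_has_vector_derivative[symmetric]
      using L pos[OF that] by (auto intro!: derivative_eq_intros simp: field_simps power2_eq_square)
    from fundamental_theorem_of_calculus[OF ab this] show ?thesis by simp
  qed
  have "norm (integral {a..b} R) \<le> 1 / (2 * L * a) - 1 / (2 * L * b)"
    unfolding integral_unique[OF I, symmetric]
  proof (rule integral_norm_bound_integral[OF Ri])
    show "(\<lambda>v. 1 / (2 * L * v\<^sup>2)) integrable_on {a..b}" using I by blast
    show "norm (R v) \<le> 1 / (2 * L * v\<^sup>2)" if "v \<in> {a..b}" for v
      using L pos[OF that] by (simp add: R_def norm_divide norm_mult norm_power)
  qed
  moreover have "norm (G b - G a) \<le> 1 / (2 * L * b) + 1 / (2 * L * a)"
    using norm_triangle_ineq4[of "G b" "G a"] nG ab by auto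
  ultimately have "norm (integral {a..b} (\<lambda>v. cis (L * v\<^sup>2))) \<le> 2 * (1 / (2 * L * a))"
    unfolding sum using norm_triangle_ineq[of "G b - G a" "integral {a..b} R"] by linarith
  also have "\<dots> \<le> 1 / (L * m)" using L m by (simp add: frac_le)
  finally show ?thesis .
qed

lemma chirp_integral_reflect:
  "integral {- b..- a} (\<lambda>v. cis (L * v\<^sup>2)) = integral {a..b} (\<lambda>v. cis (L * v\<^sup>2))"
  using Henstock_Kurzweil_Integration.integral_reflect_real[of b a "\<lambda>v. cis (L * v\<^sup>2)"] by simp

lemma chirp_integral_combine:
  "a \<le> c \<Longrightarrow> c \<le> b \<Longrightarrow> integral {a..b} (\<lambda>v. cis (L * v\<^sup>2)) =
     integral {a..c} (\<lambda>v. cis (L * v\<^sup>2)) + integral {c..b} (\<lambda>v. cis (L * v\<^sup>2))"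
  by (rule Henstock_Kurzweil_Integration.integral_combine[symmetric])
     (auto intro!: integrable_continuous_real continuous_intros)

lemma chirp_integral_nonneg:
  fixes L a b :: real
  assumes L: "L > 0" and ab: "0 \<le> a" "a \<le> b"
  shows "norm (integral {a..b} (\<lambda>v. cis (L * v\<^sup>2))) \<le> 2 / sqrt L"
proof -
  \<comment> \<open>The trivial bound up to \<open>1 / sqrt L\<close>, the derivative test beyond it.\<close>
  define d where "d = 1 / sqrt L"
  have d: "d > 0" using L by (simp add: d_def)
  have Ld: "1 / (L * d) = d" using L by (simp add: d_def field_simps)
  have triv: "norm (integral {a..b} (\<lambda>v. cis (L * v\<^sup>2))) \<le> b - a" if "a \<le> b" for a b
    using integral_bound[OF that, of "\<lambda>v. cis (L * v\<^sup>2)" 1] by (simp add: continuous_on_cis_square)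
  have far: "norm (integral {a..b} (\<lambda>v. cis (L * v\<^sup>2))) \<le> d" if "d \<le> a" "a \<le> b" for a b
    using chirp_integral_nonstationary[OF L d that] Ld by simp
  have "norm (integral {a..b} (\<lambda>v. cis (L * v\<^sup>2))) \<le> d + d"
  proof (cases "b \<le> d")
    case True
    then show ?thesis using triv[OF ab(2)] ab d by linarith
  next
    case b: False
    show ?thesis
    proof (cases "d \<le> a")
      case True
      then show ?thesis using far[OF True ab(2)] d by linarith
    next
      case False
      then have "integral {a..b} (\<lambda>v. cis (L * v\<^sup>2)) =
        integral {a..d} (\<lambda>v. cis (L * v\<^sup>2)) + integral {d..b} (\<lambda>v. cis (L * v\<^sup>2))"
        using b by (intro chirp_integral_combine) auto
      then show ?thesis
        using triv[of a d] far[of d b] False b ab norm_triangle_ineq[of "integral {a..d} (\<lambda>v. cis (L * v\<^sup>2))" "integral {d..b} (\<lambda>v. cis (L * v\<^sup>2))"]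
        by auto
    qed
  qed
  then show ?thesis by (simp add: d_def)
qed

lemma chirp_integral_uniform:
  fixes L a b :: real
  assumes L: "L > 0" and ab: "a \<le> b"
  shows "norm (integral {a..b} (\<lambda>v. cis (L * v\<^sup>2))) \<le> 4 / sqrt L"
proof -
  let ?F = "\<lambda>a b. integral {a..b} (\<lambda>v. cis (L * v\<^sup>2))"
  have s: "4 / sqrt L = 2 / sqrt L + 2 / sqrt L" "0 < 2 / sqrt L" using L by simp_all
  consider "0 \<le> a" | "b \<le> 0" | "a \<le> 0" "0 \<le> b" by linarith
  then show ?thesis
  proof cases
    case 1
    then show ?thesis using chirp_integral_nonneg[OF L 1 ab] s by linarith
  next
    case 2
    then have "norm (?F (- b) (- a)) \<le> 2 / sqrt L"
      using ab by (intro chirp_integral_nonneg[OF L]) auto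
    then show ?thesis
      unfolding chirp_integral_reflect using s by linarith
  next
    case 3
    then have "?F a b = ?F a 0 + ?F 0 b" by (rule chirp_integral_combine)
    moreover have "norm (?F a 0) \<le> 2 / sqrt L"
      using chirp_integral_nonneg[OF L, of 0 "- a"] 3 chirp_integral_reflect[of 0 a L] by simp
    moreover have "norm (?F 0 b) \<le> 2 / sqrt L"
      using chirp_integral_nonneg[OF L, of 0 b] 3 by simp
    ultimately show ?thesis using norm_triangle_ineq[of "?F a 0" "?F 0 b"] by simp
  qed
qed

definition plateau :: "real \<Rightarrow> real \<Rightarrow> real \<Rightarrow> real" where
  "plateau A W w = (if \<bar>w\<bar> < W then A else 1 / \<bar>w\<bar>)"

text \<open>The instantaneous frequency of the chirp sweeps an interval of length about \<open>L * l\<close>.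
  Within it the Fourier transform has size \<open>1 / sqrt L\<close> (stationary phase), outside it decays like
  \<open>1 / \<bar>w\<bar>\<close>, which is all that the sharp cut-off permits.\<close>

lemma chirp_fourier_bound:
  fixes L l t w :: real
  assumes L: "L > 0" and l: "l > 0" and t: "0 \<le> t" "t \<le> l"
  shows "norm (integral {0..t} (\<lambda>\<tau>. cis (L * \<tau>\<^sup>2 - 2 * pi * w * \<tau>))) \<le> plateau (4 / sqrt L) (L * l) w"
proof -
  define c where "c = pi * w / L"
  have sq: "cis (L * \<tau>\<^sup>2 - 2 * pi * w * \<tau>) = cis (- (L * c\<^sup>2)) * cis (L * (\<tau> + - c)\<^sup>2)" for \<tau>
  proof -
    have Lc: "L * c = pi * w" using L by (simp add: c_def)
    have "L * (\<tau> + - c)\<^sup>2 = L * \<tau>\<^sup>2 - 2 * (L * c) * \<tau> + L * c\<^sup>2"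
      by (simp add: power2_eq_square algebra_simps)
    then have "L * \<tau>\<^sup>2 - 2 * pi * w * \<tau> = - (L * c\<^sup>2) + L * (\<tau> + - c)\<^sup>2"
      unfolding Lc by simp
    then show ?thesis unfolding cis_mult by (rule arg_cong)
  qed
  have "integral {0..t} (\<lambda>\<tau>. cis (L * \<tau>\<^sup>2 - 2 * pi * w * \<tau>)) =
     cis (- (L * c\<^sup>2)) * integral {0..t} (\<lambda>\<tau>. cis (L * (\<tau> + - c)\<^sup>2))"
    unfolding sq by simp
  also have "integral {0..t} (\<lambda>\<tau>. cis (L * (\<tau> + - c)\<^sup>2)) = integral {- c..t - c} (\<lambda>v. cis (L * v\<^sup>2))"
    using integral_shift_real_ivl[of "- c" "- c" "t - c" "\<lambda>v. cis (L * v\<^sup>2)"] by simp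
  finally have n: "norm (integral {0..t} (\<lambda>\<tau>. cis (L * \<tau>\<^sup>2 - 2 * pi * w * \<tau>))) =
      norm (integral {- c..t - c} (\<lambda>v. cis (L * v\<^sup>2)))"
    by (simp add: norm_mult)
  consider "\<bar>w\<bar> < L * l" | "w \<ge> L * l" | "w \<le> - (L * l)" by linarith
  then show ?thesis
  proof cases
    case 1
    then show ?thesis unfolding n plateau_def using chirp_integral_uniform[OF L, of "- c" "t - c"] t by simp
  next
    case 2
    define m where "m = w / L"
    have w: "w > 0" using 2 L l by (meson less_le_trans mult_pos_pos)
    have m: "m > 0" "l \<le> m" using w L 2 by (auto simp: m_def field_simps)
    have "c = pi * m" by (simp add: c_def m_def)
    moreover have "2 * m \<le> pi * m" using m(1) pi_ge_two by (intro mult_right_mono) auto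
    ultimately have "m \<le> c - t" using m t by linarith
    then have "norm (integral {c - t..c} (\<lambda>v. cis (L * v\<^sup>2))) \<le> 1 / (L * m)"
      using t by (intro chirp_integral_nonstationary[OF L m(1)]) auto
    also have "L * m = w" using L by (simp add: m_def)
    finally show ?thesis
      unfolding n plateau_def using 2 w chirp_integral_reflect[of c "c - t" L] by simp
  next
    case 3
    define m where "m = - w / L"
    have w: "w < 0" using 3 L l by (smt (verit) mult_pos_pos)
    have m: "m > 0" using w L by (auto simp: m_def field_simps)
    have "- c = pi * m" by (simp add: c_def m_def)
    moreover have "1 * m \<le> pi * m" using m(1) pi_ge_two by (intro mult_right_mono) auto
    ultimately have "m \<le> - c" by linarith
    then have "norm (integral {- c..t - c} (\<lambda>v. cis (L * v\<^sup>2))) \<le> 1 / (L * m)"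
      using t by (intro chirp_integral_nonstationary[OF L m(1)]) auto
    also have "L * m = - w" using L by (simp add: m_def)
    finally show ?thesis
      unfolding n plateau_def using 3 w by simp
  qed
qed

text \<open>A smooth amplitude enters only through its size and that of its derivative.\<close>

lemma integral_by_parts_amplitude:
  fixes e \<phi> \<phi>' :: "real \<Rightarrow> complex"
  assumes l: "0 \<le> l" and e: "continuous_on {0..l} e"
    and prim: "\<And>t. 0 \<le> t \<Longrightarrow> t \<le> l \<Longrightarrow> norm (integral {0..t} e) \<le> S"
    and \<phi>: "\<And>t. t \<in> {0..l} \<Longrightarrow> (\<phi> has_vector_derivative \<phi>' t) (at t)" and c': "continuous_on {0..l} \<phi>'"
    and b: "\<And>t. t \<in> {0..l} \<Longrightarrow> norm (\<phi> t) \<le> M" "\<And>t. t \<in> {0..l} \<Longrightarrow> norm (\<phi>' t) \<le> M"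
  shows "norm (integral {0..l} (\<lambda>t. e t * \<phi> t)) \<le> S * M * (1 + l)"
proof -
  define E where "E t = integral {0..t} e" for t
  have S: "S \<ge> 0" using prim[of 0] l by simp
  have dE: "(E has_vector_derivative e t) (at t within {0..l})" if "t \<in> {0..l}" for t
    unfolding E_def by (rule integral_has_vector_derivative[OF e that])
  have cE: "continuous_on {0..l} E"
    by (rule continuous_on_vector_derivative[OF dE])
  have c\<phi>: "continuous_on {0..l} \<phi>"
    by (rule continuous_on_vector_derivative[OF has_vector_derivative_at_within[OF \<phi>]])
  have "((\<lambda>t. E t * \<phi>' t + e t * \<phi> t) has_integral (E l * \<phi> l - E 0 * \<phi> 0)) {0..l}"
    using l
    by (intro fundamental_theorem_of_calculus has_vector_derivative_mult dE has_vector_derivative_at_within[OF \<phi>]) auto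
  note prod = this
  have i: "(\<lambda>t. E t * \<phi>' t) integrable_on {0..l}"
    by (intro integrable_continuous_real continuous_intros cE c')
  have "((\<lambda>t. e t * \<phi> t) has_integral (E l * \<phi> l - E 0 * \<phi> 0 - integral {0..l} (\<lambda>t. E t * \<phi>' t))) {0..l}"
    using has_integral_diff[OF prod integrable_integral[OF i]] by simp
  then have eq: "integral {0..l} (\<lambda>t. e t * \<phi> t) = E l * \<phi> l - integral {0..l} (\<lambda>t. E t * \<phi>' t)"
    by (simp add: integral_unique E_def)
  have "norm (integral {0..l} (\<lambda>t. E t * \<phi>' t)) \<le> S * M * (l - 0)"
  proof (rule integral_bound[OF l])
    show "continuous_on {0..l} (\<lambda>t. E t * \<phi>' t)" by (intro continuous_intros cE c')
    show "norm (E t * \<phi>' t) \<le> S * M" if "t \<in> {0..l}" for t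
      unfolding norm_mult using that S prim[of t] b(2)[of t] by (intro mult_mono) (auto simp: E_def)
  qed
  moreover have "norm (E l * \<phi> l) \<le> S * M"
    unfolding norm_mult using l S prim[of l] b(1)[of l] by (intro mult_mono) (auto simp: E_def)
  ultimately show ?thesis
    unfolding eq using norm_triangle_ineq4[of "E l * \<phi> l" "integral {0..l} (\<lambda>t. E t * \<phi>' t)"]
    by (simp add: algebra_simps)
qed

definition chirp_piece :: "real \<Rightarrow> real \<Rightarrow> real \<Rightarrow> real \<Rightarrow> complex" where
  "chirp_piece L s l t = (if t \<in> {s..<s + l} then cis (L * (t - s)\<^sup>2) else 0)"

lemma chirp_piece_measurable [measurable]: "chirp_piece L s l \<in> borel_measurable borel"
  unfolding chirp_piece_def cis_conv_exp by measurable

lemma STFT_chirp_piece: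
  fixes \<psi> :: "real \<Rightarrow> complex"
  assumes \<psi>: "continuous_on UNIV \<psi>"
  shows "norm (STFT \<psi> (chirp_piece L s l) (x, w)) =
     norm (integral {0..l} (\<lambda>\<tau>. cis (L * \<tau>\<^sup>2 - 2 * pi * w * \<tau>) * cnj (\<psi> (s + \<tau> - x))))"
proof -
  define f where "f \<tau> = cis (L * \<tau>\<^sup>2 - 2 * pi * w * \<tau>) * cnj (\<psi> (s + \<tau> - x))" for \<tau>
  have cf: "continuous_on {0..l} f"
    unfolding f_def by (intro continuous_intros continuous_on_compose2[OF \<psi>]) auto
  have "STFT \<psi> (chirp_piece L s l) (x, w) =
     (LINT \<tau>|lborel. chirp_piece L s l (s + \<tau>) * cnj (\<psi> (s + \<tau> - x)) * cis (- (2 * pi * w * (s + \<tau>))))"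
    unfolding STFT_def using lborel_integral_real_affine[of 1 "\<lambda>t. chirp_piece L s l t * cnj (\<psi> (t - x)) * cis (- (2 * pi * w * t))" s]
    by simp
  also have "\<dots> = (LINT \<tau>|lborel. cis (- (2 * pi * w * s)) * (indicator {0..<l} \<tau> *\<^sub>R f \<tau>))"
  proof (rule Bochner_Integration.integral_cong[OF refl])
    fix \<tau>
    have 1: "cis (L * \<tau>\<^sup>2) * cis (- (2 * pi * w * (s + \<tau>))) = cis (- (2 * pi * w * s)) * cis (L * \<tau>\<^sup>2 - 2 * pi * w * \<tau>)"
      by (simp add: cis_mult algebra_simps)
    show "chirp_piece L s l (s + \<tau>) * cnj (\<psi> (s + \<tau> - x)) * cis (- (2 * pi * w * (s + \<tau>))) =
       cis (- (2 * pi * w * s)) * (indicator {0..<l} \<tau> *\<^sub>R f \<tau>)"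
    proof (cases "\<tau> \<in> {0..<l}")
      case True
      have "cis (L * \<tau>\<^sup>2) * cnj (\<psi> (s + \<tau> - x)) * cis (- (2 * pi * w * (s + \<tau>))) =
        (cis (L * \<tau>\<^sup>2) * cis (- (2 * pi * w * (s + \<tau>)))) * cnj (\<psi> (s + \<tau> - x))" by simp
      also have "\<dots> = cis (- (2 * pi * w * s)) * f \<tau>" unfolding 1 f_def by simp
      finally show ?thesis using True by (simp add: chirp_piece_def)
    qed (auto simp: chirp_piece_def)
  qed
  also have "\<dots> = cis (- (2 * pi * w * s)) * (LINT \<tau>|lborel. indicator {0..<l} \<tau> *\<^sub>R f \<tau>)"
    by (rule integral_mult_right_zero)
  also have "(LINT \<tau>|lborel. indicator {0..<l} \<tau> *\<^sub>R f \<tau>) = (LINT \<tau>:{0..l}|lborel. f \<tau>)"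
    unfolding set_lebesgue_integral_def
  proof (rule integral_cong_AE)
    have fi: "set_integrable lborel {0..l} f" by (rule borel_integrable_atLeastAtMost'[OF cf])
    then show m: "(\<lambda>\<tau>. indicator {0..l} \<tau> *\<^sub>R f \<tau>) \<in> borel_measurable lborel"
      unfolding set_integrable_def by auto
    have "(\<lambda>\<tau>. indicator {0..<l} \<tau> *\<^sub>R f \<tau>) = (\<lambda>\<tau>. indicator {0..<l} \<tau> *\<^sub>R (indicator {0..l} \<tau> *\<^sub>R f \<tau>))"
      by (auto simp: indicator_def)
    also have "\<dots> \<in> borel_measurable lborel" using m by measurable
    finally show "(\<lambda>\<tau>. indicator {0..<l} \<tau> *\<^sub>R f \<tau>) \<in> borel_measurable lborel" .
    show "AE \<tau> in lborel. indicator {0..<l} \<tau> *\<^sub>R f \<tau> = indicator {0..l} \<tau> *\<^sub>R f \<tau>"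
      using AE_lborel_singleton[of l] by eventually_elim (auto simp: indicator_def)
  qed
  also have "(LINT \<tau>:{0..l}|lborel. f \<tau>) = integral {0..l} f"
    by (intro set_borel_integral_eq_integral borel_integrable_atLeastAtMost' cf)
  finally show ?thesis by (simp add: norm_mult f_def[abs_def])
qed

text \<open>The constant does not depend on the chirp: position is controlled by the decay of \<open>\<psi>\<close>, since all
  pieces lie in \<open>[0, \<alpha>]\<close>, and frequency by the oscillation of the chirp alone.\<close>

theorem STFT_chirp_piece_bound:
  assumes \<psi>: "\<psi> \<in> schwartz" and \<alpha>: "\<alpha> > 0"
  obtains D where "D > 0"
    "\<And>L s l x w. L > 0 \<Longrightarrow> l > 0 \<Longrightarrow> 0 \<le> s \<Longrightarrow> s + l \<le> \<alpha> \<Longrightarrow>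
       norm (STFT \<psi> (chirp_piece L s l) (x, w)) \<le> D / (1 + x\<^sup>2) * plateau (4 / sqrt L) (L * l) w"
proof -
  obtain C where C: "C > 0" "\<And>x. (1 + x\<^sup>2) * norm (\<psi> x) \<le> C" "\<And>x. (1 + x\<^sup>2) * norm (nth_deriv 1 \<psi> x) \<le> C"
    using schwartz_quadratic_decay[OF \<psi>] by blast
  define M where "M x = C * (2 * (1 + \<alpha>\<^sup>2)) / (1 + x\<^sup>2)" for x
  have decay: "z \<le> M x" if z: "(1 + (T - x)\<^sup>2) * z \<le> C" "z \<ge> 0" and T: "0 \<le> T" "T \<le> \<alpha>" for x T z
  proof -
    have "T\<^sup>2 \<le> \<alpha>\<^sup>2" using T by (intro power_mono) auto
    moreover have "x\<^sup>2 \<le> 2 * T\<^sup>2 + 2 * (T - x)\<^sup>2"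
      using zero_le_power2[of "2 * T - x"] by (simp add: power2_eq_square algebra_simps)
    moreover have "0 \<le> \<alpha>\<^sup>2 * (T - x)\<^sup>2" by simp
    moreover have "2 * (1 + \<alpha>\<^sup>2) * (1 + (T - x)\<^sup>2) = 2 + 2 * \<alpha>\<^sup>2 + 2 * (T - x)\<^sup>2 + 2 * (\<alpha>\<^sup>2 * (T - x)\<^sup>2)"
      by (simp add: algebra_simps)
    ultimately have "1 + x\<^sup>2 \<le> 2 * (1 + \<alpha>\<^sup>2) * (1 + (T - x)\<^sup>2)" by linarith
    then have "(1 + x\<^sup>2) * z \<le> 2 * (1 + \<alpha>\<^sup>2) * (1 + (T - x)\<^sup>2) * z" using z(2) by (rule mult_right_mono)
    also have "\<dots> \<le> 2 * (1 + \<alpha>\<^sup>2) * C" using mult_left_mono[OF z(1), of "2 * (1 + \<alpha>\<^sup>2)"] by (simp add: mult.assoc)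
    finally have "(1 + x\<^sup>2) * z \<le> C * (2 * (1 + \<alpha>\<^sup>2))" by (simp add: mult.commute)
    moreover have "1 + x\<^sup>2 > 0" by (simp add: add_pos_nonneg)
    ultimately show ?thesis by (simp add: M_def field_simps)
  qed
  define D where "D = C * (2 * (1 + \<alpha>\<^sup>2)) * (1 + \<alpha>)"
  show thesis
  proof (rule that[of D])
    show "D > 0" using C \<alpha> by (simp add: D_def add_pos_nonneg)
    fix L s l x w :: real assume L: "L > 0" and l: "l > 0" and s: "0 \<le> s" "s + l \<le> \<alpha>"
    define S where "S = plateau (4 / sqrt L) (L * l) w"
    have S: "S \<ge> 0" using L by (simp add: S_def plateau_def)
    have Mx: "M x \<ge> 0" using C by (simp add: M_def add_nonneg_nonneg)
    have "norm (integral {0..l} (\<lambda>\<tau>. cis (L * \<tau>\<^sup>2 - 2 * pi * w * \<tau>) * cnj (\<psi> (s + \<tau> - x)))) \<le> S * M x * (1 + l)"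
    proof (rule integral_by_parts_amplitude)
      show "norm (integral {0..t} (\<lambda>\<tau>. cis (L * \<tau>\<^sup>2 - 2 * pi * w * \<tau>))) \<le> S" if "0 \<le> t" "t \<le> l" for t
        unfolding S_def by (rule chirp_fourier_bound[OF L l that])
      show "((\<lambda>\<tau>. cnj (\<psi> (s + \<tau> - x))) has_vector_derivative cnj (nth_deriv 1 \<psi> (s + t - x))) (at t)" for t
      proof -
        have "((\<lambda>\<tau>. s + \<tau> - x) has_vector_derivative 1) (at t)"
          by (auto intro!: derivative_eq_intros simp flip: has_real_derivative_iff_has_vector_derivative)
        from vector_diff_chain_at[OF this] schwartz_has_derivative[OF \<psi>, of 0 "s + t - x"]
        have "((\<lambda>\<tau>. \<psi> (s + \<tau> - x)) has_vector_derivative nth_deriv 1 \<psi> (s + t - x)) (at t)"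
          by (simp add: o_def)
        then show ?thesis by (rule bounded_linear.has_vector_derivative[OF bounded_linear_cnj])
      qed
      show "continuous_on {0..l} (\<lambda>t. cnj (nth_deriv 1 \<psi> (s + t - x)))"
        by (intro continuous_intros continuous_on_compose2[OF schwartz_continuous[OF schwartz_deriv[OF \<psi>], of UNIV]]) auto
      show "norm (cnj (\<psi> (s + t - x))) \<le> M x" if "t \<in> {0..l}" for t
        using that s C(2)[of "s + t - x"] by (intro decay[of "s + t"]) auto
      show "norm (cnj (nth_deriv 1 \<psi> (s + t - x))) \<le> M x" if "t \<in> {0..l}" for t
        using that s C(3)[of "s + t - x"] by (intro decay[of "s + t"]) auto
    qed (use l in \<open>auto intro!: continuous_intros\<close>)
    also have "\<dots> \<le> S * M x * (1 + \<alpha>)" using S Mx s by (intro mult_left_mono) auto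
    also have "\<dots> = D / (1 + x\<^sup>2) * S" by (simp add: M_def D_def)
    finally show "norm (STFT \<psi> (chirp_piece L s l) (x, w)) \<le> D / (1 + x\<^sup>2) * plateau (4 / sqrt L) (L * l) w"
      unfolding S_def STFT_chirp_piece[OF schwartz_continuous[OF \<psi>]] .
  qed
qed

lemma plateau_measurable [measurable]: "plateau A W \<in> borel_measurable borel"
  unfolding plateau_def by measurable

lemma plateau_nonneg: "A \<ge> 0 \<Longrightarrow> plateau A W w \<ge> 0"
  by (simp add: plateau_def)

lemma nn_integral_plateau:
  assumes A: "A > 0" and W: "W > 0" and r: "r > 1"
  shows "(\<integral>\<^sup>+ w. ennreal (plateau A W w powr r) \<partial>lborel) \<le> ennreal (2 * W * A powr r + 2 * W powr (1 - r) / (r - 1))"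
proof -
  define T where "T w = ennreal (w powr (- r)) * indicator {W..} w" for w :: real
  have Tm [measurable]: "T \<in> borel_measurable borel" unfolding T_def by measurable
  have "((\<lambda>x. x powr (- r)) has_integral - (W powr (- r + 1)) / (- r + 1)) {W..}"
    using r W by (intro has_integral_powr_to_inf) auto
  then have "(\<integral>\<^sup>+ w. T w \<partial>lborel) = ennreal (- (W powr (- r + 1)) / (- r + 1))"
    unfolding T_def by (intro nn_integral_has_integral_lebesgue') auto
  also have "- (W powr (- r + 1)) / (- r + 1) = W powr (1 - r) / (r - 1)"
    using r by (simp add: field_simps)
  finally have IT: "(\<integral>\<^sup>+ w. T w \<partial>lborel) = ennreal (W powr (1 - r) / (r - 1))" .
  have IT': "(\<integral>\<^sup>+ w. T (- w) \<partial>lborel) = (\<integral>\<^sup>+ w. T w \<partial>lborel)"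
    by (subst (2) nn_integral_real_affine[where c="- 1" and t=0]) auto
  have pw: "ennreal (plateau A W w powr r) \<le> ennreal (A powr r) * indicator {- W..W} w + (T w + T (- w))" for w
  proof (cases "\<bar>w\<bar> < W")
    case True
    then have "ennreal (plateau A W w powr r) = ennreal (A powr r) * indicator {- W..W} w"
      by (auto simp: plateau_def indicator_def)
    then show ?thesis
      using add_left_mono[of 0 "T w + T (- w)" "ennreal (plateau A W w powr r)"] by simp
  next
    case False
    then consider "w \<ge> W" | "- w \<ge> W" by linarith
    then show ?thesis
    proof cases
      case 1
      then have "ennreal (plateau A W w powr r) = T w"
        using W by (simp add: plateau_def T_def powr_minus powr_divide inverse_eq_divide)
      then show ?thesis by (simp add: add_increasing add_increasing2)
    next
      case 2
      then have "plateau A W w = inverse (- w)"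
        using W by (simp add: plateau_def inverse_eq_divide)
      then have "plateau A W w powr r = (- w) powr (- r)"
        using 2 W by (simp only: inverse_powr powr_minus)
      then have "ennreal (plateau A W w powr r) = T (- w)" using 2 by (simp add: T_def)
      then show ?thesis by (simp add: add_increasing)
    qed
  qed
  have "(\<integral>\<^sup>+ w. ennreal (plateau A W w powr r) \<partial>lborel)
     \<le> (\<integral>\<^sup>+ w. ennreal (A powr r) * indicator {- W..W} w + (T w + T (- w)) \<partial>lborel)"
    by (rule nn_integral_mono[OF pw])
  also have "\<dots> = ennreal (A powr r) * ennreal (2 * W) + (ennreal (W powr (1 - r) / (r - 1)) + ennreal (W powr (1 - r) / (r - 1)))"
    using W by (simp add: nn_integral_add nn_integral_cmult_indicator IT IT')
  also have "\<dots> = ennreal (2 * W * A powr r + 2 * W powr (1 - r) / (r - 1))"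
    using W r by (simp add: ennreal_mult[symmetric] ennreal_plus[symmetric] mult_ac del: ennreal_plus)
  finally show ?thesis .
qed

section \<open>A train of chirps of unit modulus\<close>

text \<open>A substitute for Minkowski's inequality: a sum with weights \<open>2\<^sup>-\<^sup>n\<^sup>-\<^sup>1\<close> is at most the largest of the
  numbers \<open>2\<^sup>n\<^sup>+\<^sup>1 b\<^sub>n\<close>.  The geometric loss is affordable for rapidly decreasing terms.\<close>

lemma powr_suminf_le_suminf_powr:
  fixes b :: "nat \<Rightarrow> real"
  assumes b: "\<And>n. b n \<ge> 0" and sb: "summable b" and q: "q > 0"
  shows "ennreal ((\<Sum>n. b n) powr q) \<le> (\<Sum>n. ennreal ((2 ^ Suc n * b n) powr q))"
proof (cases "summable (\<lambda>n. (2 ^ Suc n * b n) powr q)")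
  case False
  then have "(\<Sum>n. ennreal ((2 ^ Suc n * b n) powr q)) = top"
    using summable_suminf_not_top[of "\<lambda>n. (2 ^ Suc n * b n) powr q"] by (metis powr_ge_zero)
  then show ?thesis by simp
next
  case True
  define T where "T = (\<Sum>n. (2 ^ Suc n * b n) powr q)"
  have T0: "T \<ge> 0" unfolding T_def by (rule suminf_nonneg[OF True]) simp
  have le: "b n \<le> (1 / 2) ^ Suc n * T powr (1 / q)" for n
  proof -
    have "(2 ^ Suc n * b n) powr q \<le> T"
      unfolding T_def using sum_le_suminf[OF True, of "{n}"] by simp
    then have "((2 ^ Suc n * b n) powr q) powr (1 / q) \<le> T powr (1 / q)"
      using q by (intro powr_mono2) auto
    then have "2 ^ Suc n * b n \<le> T powr (1 / q)"
      using q b[of n] by (simp add: powr_powr del: power_Suc)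
    then have "(1 / 2) ^ Suc n * (2 ^ Suc n * b n) \<le> (1 / 2) ^ Suc n * T powr (1 / q)"
      by (rule mult_left_mono) simp
    moreover have "(1 / 2) ^ Suc n * (2 ^ Suc n * b n) = b n"
      by (simp add: power_one_over del: power_Suc)
    ultimately show ?thesis by (simp only:)
  qed
  have g: "(\<lambda>n. (1 / 2) ^ Suc n * T powr (1 / q)) sums (1 * T powr (1 / q))"
    by (intro sums_mult2 power_half_series)
  have "(\<Sum>n. b n) \<le> T powr (1 / q)"
    using suminf_le[OF le sb sums_summable[OF g]] sums_unique[OF g] by simp
  then have "(\<Sum>n. b n) powr q \<le> (T powr (1 / q)) powr q"
    using q suminf_nonneg[OF sb b] by (intro powr_mono2) auto
  also have "\<dots> = T" using q T0 by (simp add: powr_powr)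
  finally have "ennreal ((\<Sum>n. b n) powr q) \<le> ennreal T" by (rule ennreal_leI)
  also have "\<dots> = (\<Sum>n. ennreal ((2 ^ Suc n * b n) powr q))"
    unfolding T_def by (rule suminf_ennreal2[OF _ True, symmetric]) simp
  finally show ?thesis .
qed

lemma nn_integral_cauchy_weight_powr:
  assumes D: "D > 0" and r: "r \<ge> 1"
  shows "(\<integral>\<^sup>+ x. ennreal ((D / (1 + x\<^sup>2)) powr r) \<partial>lborel) < top"
proof -
  \<comment> \<open>The weight is dominated by a plateau, whose integrals are already known.\<close>
  have pw: "(D / (1 + x\<^sup>2)) powr r \<le> D powr r * plateau 1 1 x powr 2" for x :: real
  proof -
    have p: "1 + x\<^sup>2 > 0" by (simp add: add_pos_nonneg)
    have "(1 / (1 + x\<^sup>2)) powr r \<le> (1 / (1 + x\<^sup>2)) powr 1"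
      using p r by (intro powr_mono') (auto simp: divide_le_eq)
    also have "\<dots> = 1 / (1 + x\<^sup>2)" using p by (simp add: less_imp_le)
    also have "\<dots> \<le> plateau 1 1 x powr 2"
    proof (cases "\<bar>x\<bar> < 1")
      case True
      then show ?thesis using p by (simp add: plateau_def divide_le_eq)
    next
      case False
      then have "plateau 1 1 x powr 2 = 1 / x\<^sup>2" by (simp add: plateau_def powr_2_nonneg power_divide)
      moreover have "x\<^sup>2 > 0" using False by auto
      ultimately show ?thesis by (simp add: frac_le)
    qed
    finally have "(1 / (1 + x\<^sup>2)) powr r \<le> plateau 1 1 x powr 2" .
    then have "D powr r * (1 / (1 + x\<^sup>2)) powr r \<le> D powr r * plateau 1 1 x powr 2"
      by (intro mult_left_mono) auto
    moreover have "D powr r * (1 / (1 + x\<^sup>2)) powr r = (D / (1 + x\<^sup>2)) powr r"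
      using D p by (subst powr_mult[symmetric]) auto
    ultimately show ?thesis by simp
  qed
  have "(\<integral>\<^sup>+ x. ennreal ((D / (1 + x\<^sup>2)) powr r) \<partial>lborel) \<le>
     (\<integral>\<^sup>+ x. ennreal (D powr r) * ennreal (plateau 1 1 x powr 2) \<partial>lborel)"
    by (intro nn_integral_mono) (use pw in \<open>auto simp: ennreal_mult[symmetric] intro!: ennreal_leI\<close>)
  also have "\<dots> = ennreal (D powr r) * (\<integral>\<^sup>+ x. ennreal (plateau 1 1 x powr 2) \<partial>lborel)"
    by (rule nn_integral_cmult) measurable
  also have "\<dots> < top"
    using nn_integral_plateau[of 1 1 2]
    by (auto simp: ennreal_mult_less_top intro: le_less_trans)
  finally show ?thesis .
qed

lemma summable_gaussian:
  fixes a b c :: real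
  assumes a: "a > 0"
  shows "summable (\<lambda>n. exp (- a * (real n)\<^sup>2 + b * real n + c))"
proof (rule summable_comparison_test')
  show "summable (\<lambda>n. exp ((b + 1)\<^sup>2 / (4 * a) + c) * exp (- 1) ^ n)"
    by (intro summable_mult summable_geometric) simp
  show "norm (exp (- a * (real n)\<^sup>2 + b * real n + c)) \<le> exp ((b + 1)\<^sup>2 / (4 * a) + c) * exp (- 1) ^ n" for n
  proof -
    have "0 \<le> (2 * a * real n - (b + 1))\<^sup>2 / (4 * a)" using a by simp
    also have "\<dots> = a * (real n)\<^sup>2 - (b + 1) * real n + (b + 1)\<^sup>2 / (4 * a)"
      using a by (simp add: field_simps power2_eq_square)
    finally have "- a * (real n)\<^sup>2 + b * real n + c \<le> (b + 1)\<^sup>2 / (4 * a) + c + real n * (- 1)"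
      by (simp add: algebra_simps)
    then show ?thesis
      by (simp add: exp_add[symmetric] exp_of_nat_mult[symmetric])
  qed
qed

locale chirp_train =
  fixes \<alpha> q :: real
  assumes \<alpha>: "\<alpha> > 0" and q: "1 < q" "q \<le> 2"
begin

text \<open>Up to normalisation \<open>weight N\<close> is the length of the \<open>N\<close>-th interval.  The exponent is chosen so that
  \<open>rate N powr (1 - q / 2) * weight N = exp (- 3 * real N)\<close>: this product governs the \<open>q\<close>-th
  power of the \<open>L\<^sup>q\<close> norm of the transform of the piece.  With \<open>p < q\<close> in place of \<open>q\<close> in the exponent
  of the rate, the product grows like \<open>exp ((q - p) / 2 * (real N)\<^sup>2 - 3 * real N)\<close>.\<close>

definition weight :: "nat \<Rightarrow> real" where
  "weight N = exp (- (1 - q / 2) * (real N)\<^sup>2 - 3 * real N)"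

text \<open>Makes the lengths add up to \<open>\<alpha>\<close>; the logarithm keeps all quantities below exponentials of
  quadratic polynomials in \<open>N\<close>.\<close>

definition scale :: real where
  "scale = ln (\<alpha> / (\<Sum>N. weight N))"

definition log_len :: "nat \<Rightarrow> real" where
  "log_len N = scale - (1 - q / 2) * (real N)\<^sup>2 - 3 * real N"

definition len :: "nat \<Rightarrow> real" where
  "len N = exp (log_len N)"

definition start :: "nat \<Rightarrow> real" where
  "start N = (\<Sum>n<N. len n)"

definition rate :: "nat \<Rightarrow> real" where
  "rate N = exp ((real N)\<^sup>2)"

definition piece :: "nat \<Rightarrow> real \<Rightarrow> complex" where
  "piece N = chirp_piece (rate N) (start N) (len N)"

definition train :: "real \<Rightarrow> complex" where
  "train t = (\<Sum>N. piece N t)"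

lemma summable_weight: "summable weight"
proof (rule summable_comparison_test')
  show "summable (\<lambda>n. exp (- 3 :: real) ^ n)" by (intro summable_geometric) simp
  show "norm (weight n) \<le> exp (- 3) ^ n" for n
  proof -
    have "(q / 2 - 1) * (real n)\<^sup>2 \<le> 0" using q by (intro mult_nonpos_nonneg) auto
    then show ?thesis unfolding weight_def by (simp add: exp_of_nat_mult[symmetric])
  qed
qed

lemma weight_pos: "weight N > 0"
  by (simp add: weight_def)

lemma len_eq: "len N = \<alpha> / (\<Sum>N. weight N) * weight N"
proof -
  have "(\<Sum>N. weight N) > 0" by (intro suminf_pos summable_weight weight_pos)
  then have "exp scale = \<alpha> / (\<Sum>N. weight N)" using \<alpha> by (simp add: scale_def)
  moreover have "len N = exp scale * weight N"
    by (simp add: len_def log_len_def weight_def exp_add[symmetric] algebra_simps)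
  ultimately show ?thesis by simp
qed

lemma len_pos: "len N > 0"
  by (simp add: len_def)

lemma len_sums: "len sums \<alpha>"
proof -
  have "(\<Sum>N. weight N) > 0" by (intro suminf_pos summable_weight weight_pos)
  then show ?thesis
    using sums_mult[OF summable_sums[OF summable_weight], of "\<alpha> / (\<Sum>N. weight N)"]
    by (simp add: len_eq[abs_def])
qed

lemma start_Suc: "start (Suc N) = start N + len N"
  by (simp add: start_def)

lemma start_nonneg: "start N \<ge> 0"
  unfolding start_def by (intro sum_nonneg less_imp_le[OF len_pos])

lemma start_mono: "M \<le> N \<Longrightarrow> start M \<le> start N"
  unfolding start_def by (intro sum_mono2) (auto intro: less_imp_le[OF len_pos])

lemma start_le: "start N \<le> \<alpha>"
  unfolding start_def using sum_le_suminf[OF sums_summable[OF len_sums], of "{..<N}"] len_pos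
  by (auto simp: sums_unique[OF len_sums, symmetric] less_imp_le)

lemma start_interval_unique:
  assumes "t \<in> {start M..<start (Suc M)}" "t \<in> {start N..<start (Suc N)}"
  shows "M = N"
proof (rule ccontr)
  assume "M \<noteq> N"
  then consider "Suc M \<le> N" | "Suc N \<le> M" by linarith
  then show False by cases (use start_mono assms in fastforce)+
qed

lemma norm_piece: "norm (piece N t) = indicator {start N..<start (Suc N)} t"
  by (auto simp: piece_def chirp_piece_def start_Suc indicator_def)

lemma exists_piece:
  assumes t: "t \<in> {0..<\<alpha>}"
  shows "\<exists>N. t \<in> {start N..<start (Suc N)}"
proof -
  have "start \<longlonglongrightarrow> \<alpha>" using len_sums unfolding sums_def start_def .
  then have "\<forall>\<^sub>F N in sequentially. t < start N" using t by (intro order_tendstoD) auto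
  then obtain K where K: "t < start K" by (auto simp: eventually_sequentially)
  define M where "M = (LEAST K. t < start K)"
  have M: "t < start M" unfolding M_def by (rule LeastI[of _ K]) (rule K)
  have "start 0 = 0" by (simp add: start_def)
  with M t have "M \<noteq> 0" by (intro notI) simp
  then obtain N where N: "M = Suc N" using not0_implies_Suc by blast
  have "\<not> t < start N" using not_less_Least[of N "\<lambda>K. t < start K"] N M_def by auto
  then show ?thesis using M N by (intro exI[of _ N]) auto
qed

lemma train_on_piece:
  assumes t: "t \<in> {start N..<start (Suc N)}"
  shows "train t = piece N t" "(\<lambda>M. piece M t) sums train t" "summable (\<lambda>M. norm (piece M t))"
proof -
  have z: "piece M t = 0" if "M \<notin> {N}" for M
  proof -
    have "t \<notin> {start M..<start (Suc M)}" using start_interval_unique[OF t, of M] that by blast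
    then have "norm (piece M t) = 0" by (subst norm_piece) (rule indicator_simps(2))
    then show ?thesis by simp
  qed
  have s: "(\<lambda>M. piece M t) sums piece N t"
    using sums_finite[of "{N}" "\<lambda>M. piece M t"] z by simp
  then show "train t = piece N t" unfolding train_def by (rule sums_unique[symmetric])
  with s show "(\<lambda>M. piece M t) sums train t" by simp
  show "summable (\<lambda>M. norm (piece M t))"
    by (rule summable_finite[of "{N}"]) (use z in auto)
qed

lemma train_outside:
  assumes t: "t \<notin> {0..<\<alpha>}"
  shows "train t = 0" "piece N t = 0"
proof -
  show z: "piece N t = 0" for N
    using norm_piece[of N t] t start_nonneg[of N] start_le[of "Suc N"] by (auto simp: indicator_def split: if_splits)
  show "train t = 0" by (simp add: train_def z)
qed

lemma piece_sums_train: "(\<lambda>N. piece N t) sums train t" "summable (\<lambda>N. norm (piece N t))"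
  using exists_piece[of t] train_on_piece[of t] train_outside[of t]
  by (cases "t \<in> {0..<\<alpha>}"; force)+

lemma norm_train: "norm (train t) = indicator {0..<\<alpha>} t"
  using exists_piece[of t] train_on_piece(1)[of t] train_outside(1)[of t] norm_piece[of _ t]
  by (cases "t \<in> {0..<\<alpha>}") (auto simp: indicator_def)

lemma piece_measurable [measurable]: "piece N \<in> borel_measurable borel"
  unfolding piece_def by measurable

lemma train_measurable [measurable]: "train \<in> borel_measurable borel"
  unfolding train_def by measurable

lemma STFT_train_le:
  assumes \<psi>: "\<psi> \<in> schwartz"
  shows "summable (\<lambda>N. norm (STFT \<psi> (piece N) z))"
    and "norm (STFT \<psi> train z) \<le> (\<Sum>N. norm (STFT \<psi> (piece N) z))"
proof -
  obtain B where B: "B > 0" "\<And>x. norm (\<psi> x) \<le> B" using schwartz_bounded[OF \<psi>] by blast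
  obtain x w where z: "z = (x, w)" by (cases z)
  note [measurable] = schwartz_measurable[OF \<psi>]
  define k where "k t = cnj (\<psi> (t - x)) * cis (- (2 * pi * w * t))" for t
  have km [measurable]: "k \<in> borel_measurable borel" unfolding k_def cis_conv_exp by measurable
  have kb: "norm (k t) \<le> B" for t using B by (simp add: k_def norm_mult)
  define f where "f N t = piece N t * k t" for N t
  have fm: "f N \<in> borel_measurable lborel" for N unfolding f_def by measurable
  have fb: "norm (f N t) \<le> B * indicator {start N..<start (Suc N)} t" for N t
    using kb[of t] by (simp add: f_def norm_mult norm_piece indicator_def)
  have ii: "integrable lborel (\<lambda>t. B * indicator {start N..<start (Suc N)} t)" for N
    by (intro integrable_mult_right integrable_real_indicator) (auto simp: emeasure_lborel_Ico start_mono)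
  have fi: "integrable lborel (f N)" for N
    by (rule Bochner_Integration.integrable_bound[OF ii[of N]])
       (use fb fm in \<open>auto intro: order.trans[OF _ abs_ge_self]\<close>)
  have nf: "(LINT t|lborel. norm (f N t)) \<le> B * len N" for N
  proof -
    have "(LINT t|lborel. norm (f N t)) \<le> (LINT t|lborel. B * indicator {start N..<start (Suc N)} t)"
      using fi ii fb by (intro integral_mono) auto
    also have "\<dots> = B * len N" using len_pos[of N] by (simp add: start_Suc less_imp_le)
    finally show ?thesis .
  qed
  have sn: "summable (\<lambda>N. LINT t|lborel. norm (f N t))"
    by (rule summable_comparison_test'[OF summable_mult[OF sums_summable[OF len_sums], of B]])
       (use nf in auto)
  have sf: "summable (\<lambda>N. norm (f N t))" for t
    unfolding f_def norm_mult by (intro summable_mult2 piece_sums_train)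
  have eq: "(\<Sum>N. f N t) = train t * k t" for t
    unfolding f_def using sums_mult2[OF piece_sums_train(1)] by (intro sums_unique[symmetric])
  have P: "STFT \<psi> (piece N) z = (LINT t|lborel. f N t)" for N
    by (simp add: z STFT_def f_def k_def mult.assoc)
  have T: "STFT \<psi> train z = (LINT t|lborel. (\<Sum>N. f N t))"
    by (simp add: eq) (simp add: z STFT_def k_def mult.assoc)
  have bN: "norm (STFT \<psi> (piece N) z) \<le> (LINT t|lborel. norm (f N t))" for N
    unfolding P by (rule integral_norm_bound)
  show s: "summable (\<lambda>N. norm (STFT \<psi> (piece N) z))"
    by (rule summable_comparison_test'[OF sn]) (use bN in auto)
  have "(\<lambda>N. STFT \<psi> (piece N) z) sums STFT \<psi> train z"
    unfolding P T using fi sf sn by (intro sums_integral) auto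
  then show "norm (STFT \<psi> train z) \<le> (\<Sum>N. norm (STFT \<psi> (piece N) z))"
    using summable_norm[OF s] by (simp add: sums_unique[symmetric])
qed

text \<open>The bound of \<open>nn_integral_plateau\<close> for the \<open>N\<close>-th piece, in exponential form: first the band of
  frequencies that the chirp sweeps, then the tails.\<close>

definition plateau_integral :: "real \<Rightarrow> nat \<Rightarrow> real" where
  "plateau_integral r N = 2 * 4 powr r * exp (scale + (q - r) / 2 * (real N)\<^sup>2 - 3 * real N)
     + 2 / (r - 1) * exp ((1 - r) * (scale + q / 2 * (real N)\<^sup>2 - 3 * real N))"

lemma plateau_integral_nonneg: "r > 1 \<Longrightarrow> plateau_integral r N \<ge> 0"
  by (simp add: plateau_integral_def add_nonneg_nonneg)

lemma nn_integral_plateau_piece: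
  assumes r: "r > 1"
  shows "(\<integral>\<^sup>+ w. ennreal (plateau (4 / sqrt (rate N)) (rate N * len N) w powr r) \<partial>lborel)
     \<le> ennreal (plateau_integral r N)"
proof -
  have sq: "sqrt (rate N) = exp ((real N)\<^sup>2 / 2)"
    by (intro real_sqrt_unique) (simp_all add: rate_def exp_double[symmetric])
  have A: "(4 / sqrt (rate N)) powr r = 4 powr r * exp (- ((real N)\<^sup>2 / 2 * r))"
    unfolding sq by (subst powr_divide) (simp_all only: exp_powr_real exp_minus divide_inverse exp_ge_zero zero_le_numeral)
  have W: "rate N * len N = exp (scale + q / 2 * (real N)\<^sup>2 - 3 * real N)"
    unfolding rate_def len_def log_len_def exp_add[symmetric]
    by (rule arg_cong[where f=exp]) (simp add: algebra_simps)
  have 1: "2 * (rate N * len N) * (4 / sqrt (rate N)) powr r = 2 * 4 powr r * exp (scale + (q - r) / 2 * (real N)\<^sup>2 - 3 * real N)"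
  proof -
    have "exp (scale + q / 2 * (real N)\<^sup>2 - 3 * real N) * exp (- ((real N)\<^sup>2 / 2 * r)) = exp (scale + (q - r) / 2 * (real N)\<^sup>2 - 3 * real N)"
      unfolding exp_add[symmetric] by (rule arg_cong[where f=exp]) (simp add: field_simps)
    then show ?thesis unfolding A W by (simp only: mult.assoc mult.left_commute mult.commute)
  qed
  have 2: "2 * (rate N * len N) powr (1 - r) / (r - 1) = 2 / (r - 1) * exp ((1 - r) * (scale + q / 2 * (real N)\<^sup>2 - 3 * real N))"
    unfolding W exp_powr_real by (simp add: mult.commute)
  show ?thesis
  proof -
    have "0 < 4 / sqrt (rate N)" "0 < rate N * len N" using len_pos[of N] by (simp_all add: rate_def)
    from nn_integral_plateau[OF this r] show ?thesis unfolding 1 2 plateau_integral_def .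
  qed
qed

lemma STFT_piece_Lr:
  assumes \<psi>: "\<psi> \<in> schwartz" and r: "r > 1"
  obtains C where "C \<ge> 0"
    "\<And>N. (\<integral>\<^sup>+ z. ennreal (norm (STFT \<psi> (piece N) z) powr r) \<partial>lborel) \<le> ennreal (C * plateau_integral r N)"
proof -
  obtain D where D: "D > 0" "\<And>L s l x w. L > 0 \<Longrightarrow> l > 0 \<Longrightarrow> 0 \<le> s \<Longrightarrow> s + l \<le> \<alpha> \<Longrightarrow>
       norm (STFT \<psi> (chirp_piece L s l) (x, w)) \<le> D / (1 + x\<^sup>2) * plateau (4 / sqrt L) (L * l) w"
    using STFT_chirp_piece_bound[OF \<psi> \<alpha>] by blast
  define K where "K x = (D / (1 + x\<^sup>2)) powr r" for x :: real
  have Km [measurable]: "K \<in> borel_measurable borel" unfolding K_def by measurable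
  define C where "C = enn2real (\<integral>\<^sup>+ x. ennreal (K x) \<partial>lborel)"
  have C: "(\<integral>\<^sup>+ x. ennreal (K x) \<partial>lborel) = ennreal C"
    unfolding C_def K_def using nn_integral_cauchy_weight_powr[OF D(1), of r] r by simp
  show thesis
  proof (rule that[of C])
    show "C \<ge> 0" by (simp add: C_def)
    fix N
    define P where "P w = plateau (4 / sqrt (rate N)) (rate N * len N) w powr r" for w
    have Pm [measurable]: "P \<in> borel_measurable borel" unfolding P_def by measurable
    have Pp: "plateau (4 / sqrt (rate N)) (rate N * len N) w \<ge> 0" for w
      by (rule plateau_nonneg) (simp add: rate_def)
    have pw: "ennreal (norm (STFT \<psi> (piece N) z) powr r) \<le> (case z of (x, w) \<Rightarrow> ennreal (K x) * ennreal (P w))" for z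
    proof (cases z)
      case (Pair x w)
      have "norm (STFT \<psi> (piece N) (x, w)) \<le> D / (1 + x\<^sup>2) * plateau (4 / sqrt (rate N)) (rate N * len N) w"
        unfolding piece_def
        using len_pos start_nonneg start_le[of "Suc N"] by (intro D) (auto simp: rate_def start_Suc)
      then have "norm (STFT \<psi> (piece N) (x, w)) powr r \<le> (D / (1 + x\<^sup>2) * plateau (4 / sqrt (rate N)) (rate N * len N) w) powr r"
        using r by (intro powr_mono2) auto
      also have "\<dots> = K x * P w"
        unfolding K_def P_def by (rule powr_mult)
      finally show ?thesis unfolding Pair by (simp add: ennreal_mult[symmetric] K_def P_def ennreal_leI)
    qed
    have "(\<integral>\<^sup>+ z. ennreal (norm (STFT \<psi> (piece N) z) powr r) \<partial>lborel) \<le>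
      (\<integral>\<^sup>+ z. (case z of (x, w) \<Rightarrow> ennreal (K x) * ennreal (P w)) \<partial>(lborel \<Otimes>\<^sub>M lborel))"
      unfolding lborel_prod by (rule nn_integral_mono[OF pw])
    also have "\<dots> = (\<integral>\<^sup>+ x. (\<integral>\<^sup>+ w. ennreal (K x) * ennreal (P w) \<partial>lborel) \<partial>lborel)"
      by (subst lborel.nn_integral_fst[symmetric]) auto
    also have "\<dots> = (\<integral>\<^sup>+ x. ennreal (K x) \<partial>lborel) * (\<integral>\<^sup>+ w. ennreal (P w) \<partial>lborel)"
      by (simp add: nn_integral_cmult nn_integral_multc)
    also have "\<dots> \<le> ennreal C * ennreal (plateau_integral r N)"
      unfolding C P_def by (intro mult_left_mono nn_integral_plateau_piece[OF r]) auto
    also have "\<dots> = ennreal (C * plateau_integral r N)"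
      using plateau_integral_nonneg[OF r] by (simp add: ennreal_mult C_def)
    finally show "(\<integral>\<^sup>+ z. ennreal (norm (STFT \<psi> (piece N) z) powr r) \<partial>lborel) \<le> ennreal (C * plateau_integral r N)" .
  qed
qed

lemma STFT_measurable:
  assumes "\<psi> \<in> schwartz" and [measurable]: "g \<in> borel_measurable borel"
  shows "STFT \<psi> g \<in> borel_measurable borel"
proof -
  note [measurable] = schwartz_measurable[OF assms(1)]
  show ?thesis using borel_measurable_STFT[of g \<psi>] by (simp add: borel_prod)
qed

lemma summable_plateau_integral:
  "summable (\<lambda>N. (2 ^ Suc N) powr q * plateau_integral q N)"
proof -
  have two: "(2 ^ Suc N) powr q \<le> exp (2 * real N + 2)" for N
  proof -
    have "(2 ^ Suc N) powr q \<le> (2 ^ Suc N :: real) powr 2"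
      using q by (intro powr_mono) (auto simp del: power_Suc)
    also have "\<dots> = (2 ^ Suc N)\<^sup>2" by (rule powr_2_nonneg) simp
    also have "\<dots> \<le> (exp 1 ^ Suc N)\<^sup>2"
      using exp_ge_add_one_self[of "1::real"] by (intro power_mono) auto
    also have "exp 1 ^ Suc N = exp (real (Suc N))"
      using exp_of_nat_mult[of "Suc N" "1::real"] by simp
    also have "(exp (real (Suc N)))\<^sup>2 = exp (2 * real N + 2)"
      unfolding exp_double[symmetric] by simp
    finally show ?thesis .
  qed
  define a where "a = (q - 1) * q / 2"
  have a: "a > 0" using q by (simp add: a_def)
  have s1: "summable (\<lambda>N. exp (- 1 * real N + (2 + scale)))"
  proof -
    have "(\<lambda>N. exp (- 1 * real N + (2 + scale))) = (\<lambda>N. exp (- 1) ^ N * exp (2 + scale))"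
    proof
      fix N
      have "exp (- 1 :: real) ^ N = exp (real N * - 1)" by (rule exp_of_nat_mult[symmetric])
      then show "exp (- 1 * real N + (2 + scale)) = exp (- 1) ^ N * exp (2 + scale)"
        unfolding exp_add[of "- 1 * real N"] by (simp only: mult.commute)
    qed
    then show ?thesis by (simp add: summable_mult2 summable_geometric)
  qed
  have s2: "summable (\<lambda>N. exp (- a * (real N)\<^sup>2 + (3 * (q - 1) + 2) * real N + (2 + (1 - q) * scale)))"
    by (rule summable_gaussian[OF a])
  have s: "summable (\<lambda>N. 2 * 4 powr q * exp (- 1 * real N + (2 + scale)) +
      2 / (q - 1) * exp (- a * (real N)\<^sup>2 + (3 * (q - 1) + 2) * real N + (2 + (1 - q) * scale)))"
    by (intro summable_add summable_mult s1 s2)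
  show ?thesis
  proof (rule summable_comparison_test'[OF s])
    fix N
    have "norm ((2 ^ Suc N) powr q * plateau_integral q N) = (2 ^ Suc N) powr q * plateau_integral q N"
      using plateau_integral_nonneg[OF q(1)] by simp
    also have "\<dots> \<le> exp (2 * real N + 2) * plateau_integral q N"
      by (intro mult_right_mono two plateau_integral_nonneg q)
    also have "\<dots> = 2 * 4 powr q * exp (- 1 * real N + (2 + scale)) +
      2 / (q - 1) * exp (- a * (real N)\<^sup>2 + (3 * (q - 1) + 2) * real N + (2 + (1 - q) * scale))"
    proof -
      have e1: "exp (2 * real N + 2) * exp (scale + (q - q) / 2 * (real N)\<^sup>2 - 3 * real N) = exp (- 1 * real N + (2 + scale))"
        unfolding exp_add[symmetric] by simp
      have e2: "exp (2 * real N + 2) * exp ((1 - q) * (scale + q / 2 * (real N)\<^sup>2 - 3 * real N)) =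
        exp (- a * (real N)\<^sup>2 + (3 * (q - 1) + 2) * real N + (2 + (1 - q) * scale))"
        unfolding exp_add[symmetric] a_def by (rule arg_cong[where f=exp]) (simp add: field_simps)
      show ?thesis unfolding plateau_integral_def distrib_left e1[symmetric] e2[symmetric] by simp
    qed
    finally show "norm ((2 ^ Suc N) powr q * plateau_integral q N) \<le> 2 * 4 powr q * exp (- 1 * real N + (2 + scale)) +
      2 / (q - 1) * exp (- a * (real N)\<^sup>2 + (3 * (q - 1) + 2) * real N + (2 + (1 - q) * scale))" .
  qed
qed

text \<open>Both terms of \<open>plateau_integral q N\<close> beat the geometric factor \<open>2\<^sup>N\<^sup>q\<close>: the first by
  \<open>exp (- 3 * real N)\<close>, the second because \<open>q > 1\<close> makes its exponent negative and quadratic.\<close>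

theorem STFT_train_Lq:
  assumes \<psi>: "\<psi> \<in> schwartz"
  shows "(\<integral>\<^sup>+ z. ennreal (norm (STFT \<psi> train z) powr q) \<partial>lborel) < top"
proof -
  obtain C where C: "C \<ge> 0"
    "\<And>N. (\<integral>\<^sup>+ z. ennreal (norm (STFT \<psi> (piece N) z) powr q) \<partial>lborel) \<le> ennreal (C * plateau_integral q N)"
    using STFT_piece_Lr[OF \<psi> q(1)] by blast
  note [measurable] = STFT_measurable[OF \<psi>]
  let ?b = "\<lambda>N z. norm (STFT \<psi> (piece N) z)"
  have "(\<integral>\<^sup>+ z. ennreal (norm (STFT \<psi> train z) powr q) \<partial>lborel) \<le>
     (\<integral>\<^sup>+ z. (\<Sum>N. ennreal ((2 ^ Suc N * ?b N z) powr q)) \<partial>lborel)"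
  proof (rule nn_integral_mono)
    fix z
    have "norm (STFT \<psi> train z) powr q \<le> (\<Sum>N. ?b N z) powr q"
      using q by (intro powr_mono2 STFT_train_le[OF \<psi>]) auto
    then have "ennreal (norm (STFT \<psi> train z) powr q) \<le> ennreal ((\<Sum>N. ?b N z) powr q)" by (rule ennreal_leI)
    also have "\<dots> \<le> (\<Sum>N. ennreal ((2 ^ Suc N * ?b N z) powr q))"
      using q by (intro powr_suminf_le_suminf_powr STFT_train_le[OF \<psi>]) auto
    finally show "ennreal (norm (STFT \<psi> train z) powr q) \<le> (\<Sum>N. ennreal ((2 ^ Suc N * ?b N z) powr q))" .
  qed
  also have "\<dots> = (\<Sum>N. \<integral>\<^sup>+ z. ennreal ((2 ^ Suc N * ?b N z) powr q) \<partial>lborel)"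
    by (rule nn_integral_suminf) measurable
  also have "\<dots> \<le> (\<Sum>N. ennreal (C * ((2 ^ Suc N) powr q * plateau_integral q N)))"
  proof (rule suminf_le)
    fix N
    have "(\<integral>\<^sup>+ z. ennreal ((2 ^ Suc N * ?b N z) powr q) \<partial>lborel) =
      (\<integral>\<^sup>+ z. ennreal ((2 ^ Suc N) powr q) * ennreal (?b N z powr q) \<partial>lborel)"
      by (intro nn_integral_cong) (simp add: powr_mult ennreal_mult del: power_Suc)
    also have "\<dots> = ennreal ((2 ^ Suc N) powr q) * (\<integral>\<^sup>+ z. ennreal (?b N z powr q) \<partial>lborel)"
      by (rule nn_integral_cmult) measurable
    also have "\<dots> \<le> ennreal ((2 ^ Suc N) powr q) * ennreal (C * plateau_integral q N)"
      by (intro mult_left_mono C) auto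
    also have "\<dots> = ennreal (C * ((2 ^ Suc N) powr q * plateau_integral q N))"
      using C(1) plateau_integral_nonneg[OF q(1)] by (simp add: ennreal_mult[symmetric] mult_ac)
    finally show "(\<integral>\<^sup>+ z. ennreal ((2 ^ Suc N * ?b N z) powr q) \<partial>lborel) \<le> ennreal (C * ((2 ^ Suc N) powr q * plateau_integral q N))" .
  qed auto
  also have "\<dots> = ennreal (\<Sum>N. C * ((2 ^ Suc N) powr q * plateau_integral q N))"
    using C(1) plateau_integral_nonneg[OF q(1)]
    by (intro suminf_ennreal2 summable_mult summable_plateau_integral mult_nonneg_nonneg) auto
  also have "\<dots> < top" by simp
  finally show ?thesis .
qed

end

section \<open>Failure of smaller exponents\<close>

lemma young_powr:
  fixes a b p :: real
  assumes a: "a \<ge> 0" and b: "b \<ge> 0" and p: "p > 1"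
  shows "a * b \<le> a powr p + b powr (p / (p - 1))"
proof (cases "b \<le> a powr (p - 1)")
  case True
  have "a * b \<le> a powr 1 * a powr (p - 1)" using a True by (simp add: mult_left_mono)
  also have "\<dots> = a powr p" unfolding powr_add[symmetric] by simp
  finally show ?thesis by (simp add: add_increasing2)
next
  case False
  have "(a powr (p - 1)) powr (1 / (p - 1)) \<le> b powr (1 / (p - 1))"
    using False p by (intro powr_mono2) auto
  then have "a \<le> b powr (1 / (p - 1))" using p a by (simp add: powr_powr)
  then have "a * b \<le> b powr (1 / (p - 1)) * b powr 1" using b by (simp add: mult_right_mono)
  also have "\<dots> = b powr (1 / (p - 1) + 1)" unfolding powr_add by simp
  also have "1 / (p - 1) + 1 = p / (p - 1)" using p by (simp add: field_simps)
  finally show ?thesis by (simp add: add_increasing)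
qed

lemma schwartz_L2_norm:
  assumes \<psi>: "\<psi> \<in> schwartz"
  shows "(\<integral>\<^sup>+ t. ennreal ((norm (\<psi> t))\<^sup>2) \<partial>lborel) < top"
    and "\<psi> \<noteq> (\<lambda>_. 0) \<Longrightarrow> (\<integral>\<^sup>+ t. ennreal ((norm (\<psi> t))\<^sup>2) \<partial>lborel) > 0"
proof -
  note [measurable] = schwartz_measurable[OF \<psi>]
  obtain C where C: "C > 0" "\<And>x. (1 + x\<^sup>2) * norm (\<psi> x) \<le> C"
    "\<And>x. (1 + x\<^sup>2) * norm (nth_deriv 1 \<psi> x) \<le> C"
    using schwartz_quadratic_decay[OF \<psi>] by blast
  have "(norm (\<psi> x))\<^sup>2 \<le> (C / (1 + x\<^sup>2)) powr 2" for x
  proof -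
    have p: "1 + x\<^sup>2 > 0" by (simp add: add_pos_nonneg)
    have "norm (\<psi> x) \<le> C / (1 + x\<^sup>2)" using C(2)[of x] p by (simp add: field_simps)
    then have "(norm (\<psi> x))\<^sup>2 \<le> (C / (1 + x\<^sup>2))\<^sup>2" by (intro power_mono) auto
    also have "\<dots> = (C / (1 + x\<^sup>2)) powr 2"
      using C(1) p by (intro powr_2_nonneg[symmetric] divide_nonneg_nonneg) auto
    finally show ?thesis .
  qed
  then have "(\<integral>\<^sup>+ t. ennreal ((norm (\<psi> t))\<^sup>2) \<partial>lborel) \<le> (\<integral>\<^sup>+ x. ennreal ((C / (1 + x\<^sup>2)) powr 2) \<partial>lborel)"
    by (intro nn_integral_mono ennreal_leI)
  also have "\<dots> < top" using nn_integral_cauchy_weight_powr[OF C(1), of 2] by simp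
  finally show "(\<integral>\<^sup>+ t. ennreal ((norm (\<psi> t))\<^sup>2) \<partial>lborel) < top" .
  assume nz: "\<psi> \<noteq> (\<lambda>_. 0)"
  show "(\<integral>\<^sup>+ t. ennreal ((norm (\<psi> t))\<^sup>2) \<partial>lborel) > 0"
  proof (rule ccontr)
    assume "\<not> ?thesis"
    then have "(\<integral>\<^sup>+ t. ennreal ((norm (\<psi> t))\<^sup>2) \<partial>lborel) = 0" by simp
    then have "AE t in lborel. ennreal ((norm (\<psi> t))\<^sup>2) = 0"
      using nn_integral_0_iff_AE[of "\<lambda>t. ennreal ((norm (\<psi> t))\<^sup>2)" lborel] by simp
    then have AE: "AE t in lborel. \<psi> t = 0" by eventually_elim simp
    define U where "U = {t. \<psi> t \<noteq> 0}"
    have U: "open U"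
      unfolding U_def by (rule open_Collect_neq) (auto intro: schwartz_continuous[OF \<psi>])
    have "U \<noteq> {}" using nz by (auto simp: U_def)
    have "U \<in> sets lborel" using U by simp
    moreover have "AE t in lborel. t \<notin> U" using AE by eventually_elim (simp add: U_def)
    ultimately have "U \<in> null_sets lborel" by (simp only: AE_iff_null_sets)
    then have "negligible U" unfolding negligible_iff_null_sets by (rule null_sets_completionI)
    then show False using open_not_negligible[OF U \<open>U \<noteq> {}\<close>] by contradiction
  qed
qed

lemma STFT_add_scaled:
  assumes \<psi>: "\<psi> \<in> schwartz"
    and g: "g \<in> borel_measurable borel" "\<And>t. norm (g t) \<le> K" "\<And>t. t \<notin> {a..b} \<Longrightarrow> g t = 0"
    and h: "h \<in> borel_measurable borel" "\<And>t. norm (h t) \<le> K'" "\<And>t. t \<notin> {a..b} \<Longrightarrow> h t = 0"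
  shows "STFT \<psi> (\<lambda>t. g t + c * h t) z = STFT \<psi> g z + c * STFT \<psi> h z"
proof -
  obtain B where B: "B > 0" "\<And>x. norm (\<psi> x) \<le> B" using schwartz_bounded[OF \<psi>] by blast
  obtain x w where z: "z = (x, w)" by (cases z)
  note [measurable] = schwartz_measurable[OF \<psi>]
  define k where "k t = cnj (\<psi> (t - x)) * cis (- (2 * pi * w * t))" for t
  have km: "k \<in> borel_measurable borel" unfolding k_def cis_conv_exp by measurable
  have kb: "norm (k t) \<le> B" for t using B by (simp add: k_def norm_mult)
  have S: "STFT \<psi> f z = (LINT t|lborel. f t * k t)" for f
    by (simp add: z STFT_def k_def mult.assoc)
  have i: "integrable lborel (\<lambda>t. g t * k t)" "integrable lborel (\<lambda>t. h t * k t)"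
    using integrable_bounded_support(1)[OF g km kb] integrable_bounded_support(1)[OF h km kb] by auto
  have "(\<lambda>t. (g t + c * h t) * k t) = (\<lambda>t. g t * k t + c * (h t * k t))"
    by (simp add: algebra_simps)
  then show ?thesis unfolding S using i by simp
qed

context chirp_train
begin

lemma train_bounded_support:
  "train \<in> borel_measurable borel" "norm (train t) \<le> 1" "t \<notin> {0..\<alpha>} \<Longrightarrow> train t = 0"
  using norm_train[of t] train_outside(1)[of t] by (auto simp: indicator_def)

lemma piece_bounded_support:
  "piece N \<in> borel_measurable borel" "norm (piece N t) \<le> 1" "t \<notin> {0..\<alpha>} \<Longrightarrow> piece N t = 0"
  using norm_piece[of N t] train_outside(2)[of t] by (auto simp: indicator_def)

text \<open>Since \<open>train\<close> agrees with \<open>piece N\<close> where the latter lives, their inner product is the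
  length of that interval.  Moyal's identity carries it to the time-frequency plane, by polarisation,
  where Young's inequality separates the two transforms.\<close>

lemma train_duality:
  assumes \<psi>: "\<psi> \<in> schwartz" and s: "s > 0" and p: "p > 1"
  shows "ennreal (4 * s * len N) * (\<integral>\<^sup>+ t. ennreal ((norm (\<psi> t))\<^sup>2) \<partial>lborel) \<le>
    4 * ((\<integral>\<^sup>+ z. ennreal (norm (STFT \<psi> train z) powr p) \<partial>lborel) +
         ennreal (s powr (p / (p - 1))) * (\<integral>\<^sup>+ z. ennreal (norm (STFT \<psi> (piece N) z) powr (p / (p - 1))) \<partial>lborel))"
proof -
  note [measurable] = STFT_measurable[OF \<psi>]
  obtain B where B: "\<And>x. norm (\<psi> x) \<le> B" using schwartz_bounded[OF \<psi>] by blast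
  define M where "M = (\<integral>\<^sup>+ t. ennreal ((norm (\<psi> t))\<^sup>2) \<partial>lborel)"
  define r where "r = p / (p - 1)"
  define H where "H c t = train t + complex_of_real c * piece N t" for c t
  define V where "V = STFT \<psi> train"
  define P where "P = STFT \<psi> (piece N)"
  have Hm [measurable]: "H c \<in> borel_measurable borel" for c unfolding H_def by measurable
  have Hb: "norm (H c t) \<le> 1 + \<bar>c\<bar>" for c t
  proof -
    have "norm (H c t) \<le> norm (train t) + \<bar>c\<bar> * norm (piece N t)"
      unfolding H_def by (rule order.trans[OF norm_triangle_ineq]) (simp add: norm_mult)
    also have "\<dots> \<le> 1 + \<bar>c\<bar> * 1"
      by (intro add_mono mult_left_mono train_bounded_support piece_bounded_support) auto
    finally show ?thesis by simp
  qed
  have Hs: "H c t = 0" if "t \<notin> {0..0 + \<alpha>}" for c t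
    using train_bounded_support(3)[of t] piece_bounded_support(3)[of t N] that by (simp add: H_def)
  have SH: "STFT \<psi> (H c) z = V z + c * P z" for c z
    unfolding H_def[abs_def] V_def P_def
    by (rule STFT_add_scaled[OF \<psi> train_bounded_support piece_bounded_support])
  have moyal: "(\<integral>\<^sup>+ z. ennreal ((norm (STFT \<psi> (H c) z))\<^sup>2) \<partial>lborel) = (\<integral>\<^sup>+ t. ennreal ((norm (H c t))\<^sup>2) \<partial>lborel) * M" for c
    unfolding M_def by (rule moyal_compact_support[OF Hm schwartz_measurable[OF \<psi>] \<alpha> Hs Hb B])
  define n where "n = (\<integral>\<^sup>+ t. ennreal ((norm (H (- s) t))\<^sup>2) \<partial>lborel)"
  have n: "n < top"
  proof -
    have "n \<le> (\<integral>\<^sup>+ t. ennreal ((1 + s)\<^sup>2) * indicator {0..\<alpha>} t \<partial>lborel)"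
      unfolding n_def
    proof (rule nn_integral_mono)
      fix t
      show "ennreal ((norm (H (- s) t))\<^sup>2) \<le> ennreal ((1 + s)\<^sup>2) * indicator {0..\<alpha>} t"
        using Hs[of t "- s"] power_mono[OF Hb[of "- s" t], of 2] s by (cases "t \<in> {0..\<alpha>}") (auto intro: ennreal_leI)
    qed
    also have "\<dots> < top" using \<alpha> by (simp add: nn_integral_cmult_indicator ennreal_mult_less_top)
    finally show ?thesis .
  qed
  have Mtop: "M < top" unfolding M_def by (rule schwartz_L2_norm(1)[OF \<psi>])
  have pl: "(\<integral>\<^sup>+ t. ennreal ((norm (H s t))\<^sup>2) \<partial>lborel) = n + ennreal (4 * s * len N)"
  proof -
    have "ennreal ((norm (H s t))\<^sup>2) = ennreal ((norm (H (- s) t))\<^sup>2) + ennreal (4 * s) * indicator {start N..<start (Suc N)} t" for t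
    proof (cases "t \<in> {start N..<start (Suc N)}")
      case True
      have e: "H c t = complex_of_real (1 + c) * piece N t" for c
        using train_on_piece(1)[OF True] by (simp add: H_def algebra_simps)
      have "norm (piece N t) = 1" using norm_piece[of N t] True by simp
      then have "(norm (H c t))\<^sup>2 = (1 + c)\<^sup>2" for c unfolding e norm_mult norm_of_real by simp
      moreover have "(1 + s)\<^sup>2 = (1 + - s)\<^sup>2 + 4 * s" by (simp add: power2_eq_square algebra_simps)
      ultimately show ?thesis using True s by (simp add: ennreal_plus[symmetric] del: ennreal_plus)
    next
      case False
      then have "norm (piece N t) = 0" using norm_piece[of N t] by simp
      then have "piece N t = 0" by simp
      then show ?thesis using False by (simp add: H_def)
    qed
    then have "(\<integral>\<^sup>+ t. ennreal ((norm (H s t))\<^sup>2) \<partial>lborel) = n + ennreal (4 * s) * emeasure lborel {start N..<start (Suc N)}"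
      unfolding n_def by (simp add: nn_integral_add nn_integral_cmult_indicator)
    also have "ennreal (4 * s) * emeasure lborel {start N..<start (Suc N)} = ennreal (4 * s * len N)"
      using s len_pos[of N] by (simp add: start_Suc ennreal_mult[symmetric])
    finally show ?thesis .
  qed
  have pw: "ennreal ((norm (STFT \<psi> (H s) z))\<^sup>2) \<le> ennreal ((norm (STFT \<psi> (H (- s)) z))\<^sup>2) +
     4 * (ennreal (norm (V z) powr p) + ennreal (s powr r) * ennreal (norm (P z) powr r))" for z
  proof -
    have pol: "(norm (a + b))\<^sup>2 \<le> (norm (a - b))\<^sup>2 + 4 * (norm a * norm b)" for a b :: complex
    proof -
      have "(norm (a + b))\<^sup>2 = (norm (a - b))\<^sup>2 + 4 * Re (a * cnj b)"
        by (simp only: cmod_power2) (simp add: power2_eq_square algebra_simps)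
      also have "Re (a * cnj b) \<le> norm (a * cnj b)" by (rule complex_Re_le_cmod)
      finally show ?thesis by (simp add: norm_mult)
    qed
    have "(norm (STFT \<psi> (H s) z))\<^sup>2 \<le> (norm (STFT \<psi> (H (- s)) z))\<^sup>2 + 4 * (norm (V z) * (s * norm (P z)))"
      using pol[of "V z" "s * P z"] s by (simp add: SH norm_mult)
    also have "norm (V z) * (s * norm (P z)) \<le> norm (V z) powr p + (s * norm (P z)) powr r"
      unfolding r_def using s p by (intro young_powr) auto
    also have "(s * norm (P z)) powr r = s powr r * norm (P z) powr r" by (rule powr_mult)
    finally have real: "(norm (STFT \<psi> (H s) z))\<^sup>2 \<le> (norm (STFT \<psi> (H (- s)) z))\<^sup>2 + 4 * (norm (V z) powr p + s powr r * norm (P z) powr r)"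
      by simp
    have "ennreal ((norm (STFT \<psi> (H s) z))\<^sup>2) \<le> ennreal ((norm (STFT \<psi> (H (- s)) z))\<^sup>2 + 4 * (norm (V z) powr p + s powr r * norm (P z) powr r))"
      by (rule ennreal_leI[OF real])
    then show ?thesis by (simp add: ennreal_mult)
  qed
  have "n * M + ennreal (4 * s * len N) * M = (\<integral>\<^sup>+ z. ennreal ((norm (STFT \<psi> (H s) z))\<^sup>2) \<partial>lborel)"
    unfolding moyal pl by (simp add: distrib_right)
  also have "\<dots> \<le> (\<integral>\<^sup>+ z. (ennreal ((norm (STFT \<psi> (H (- s)) z))\<^sup>2) +
     4 * (ennreal (norm (V z) powr p) + ennreal (s powr r) * ennreal (norm (P z) powr r))) \<partial>lborel)"
    by (rule nn_integral_mono[OF pw])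
  also have "\<dots> = n * M + 4 * ((\<integral>\<^sup>+ z. ennreal (norm (V z) powr p) \<partial>lborel) +
         ennreal (s powr r) * (\<integral>\<^sup>+ z. ennreal (norm (P z) powr r) \<partial>lborel))"
    unfolding n_def moyal[symmetric] V_def P_def by (simp add: nn_integral_add nn_integral_cmult)
  finally show ?thesis
    using n Mtop unfolding ennreal_add_left_cancel_le
    by (auto simp: M_def V_def P_def r_def ennreal_mult_eq_top_iff)
qed

text \<open>The coefficients of \<open>N\<^sup>2\<close> in the two exponents are negative for the conjugate exponent \<open>r\<close> of \<open>p\<close>
  because \<open>r * q - r - q = (q - p) / (p - 1)\<close>; a linear term such as the one from the factor
  \<open>exp (real N)\<close> cannot compensate this.\<close>

lemma rescaled_plateau_integral_bounded:
  assumes p: "1 < p" "p < q"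
  shows "\<exists>K. \<forall>N. exp (real N - log_len N) powr (p / (p - 1)) * plateau_integral (p / (p - 1)) N \<le> K"
proof -
  define r where "r = p / (p - 1)"
  have r: "r > 1" using p by (simp add: r_def field_simps)
  have "r * (p - 1) = p" using p by (simp add: r_def)
  moreover have "(r * q - r - q) * (p - 1) = (r * (p - 1)) * (q - 1) - q * (p - 1)" by (simp add: algebra_simps)
  ultimately have "(r * q - r - q) * (p - 1) = q - p" by (simp add: algebra_simps)
  then have pos: "r * q - r - q > 0" using p by (metis diff_gt_0_iff_gt zero_less_mult_pos2)
  define a where "a = (r * q - r - q) / 2"
  define a' where "a' = r * q - r - q / 2"
  have a: "a > 0" "a' > 0" using pos q by (auto simp: a_def a'_def)
  define E where "E N = exp (- a * (real N)\<^sup>2 + (4 * r - 3) * real N + (1 - r) * scale)" for N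
  define E' where "E' N = exp (- a' * (real N)\<^sup>2 + (7 * r - 3) * real N + (1 - 2 * r) * scale)" for N
  have le: "E N \<le> suminf E" "E' N \<le> suminf E'" for N
    using sum_le_suminf[OF summable_gaussian[OF a(1)], of "{N}"] sum_le_suminf[OF summable_gaussian[OF a(2)], of "{N}"]
    by (simp_all add: E_def[abs_def] E'_def[abs_def])
  have "exp (real N - log_len N) powr r * plateau_integral r N = 2 * 4 powr r * E N + 2 / (r - 1) * E' N" for N
  proof -
    have e1: "exp ((real N - log_len N) * r) * exp (scale + (q - r) / 2 * (real N)\<^sup>2 - 3 * real N) = E N"
      unfolding E_def exp_add[symmetric] log_len_def a_def
      by (rule arg_cong[where f=exp]) (simp add: field_simps)
    have e2: "exp ((real N - log_len N) * r) * exp ((1 - r) * (scale + q / 2 * (real N)\<^sup>2 - 3 * real N)) = E' N"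
      unfolding E'_def exp_add[symmetric] log_len_def a'_def
      by (rule arg_cong[where f=exp]) (simp add: field_simps)
    show ?thesis
      unfolding plateau_integral_def e1[symmetric] e2[symmetric] exp_powr_real by (simp only: distrib_left mult.left_commute)
  qed
  moreover have "2 * 4 powr r * E N + 2 / (r - 1) * E' N \<le> 2 * 4 powr r * suminf E + 2 / (r - 1) * suminf E'" for N
    using r by (intro add_mono mult_left_mono le) auto
  ultimately show ?thesis unfolding r_def[symmetric] by (metis (no_types))
qed

lemma STFT_train_not_Lp_gt_1:
  assumes \<psi>: "\<psi> \<in> schwartz" "\<psi> \<noteq> (\<lambda>_. 0)" and p: "1 < p" "p < q"
  shows "(\<integral>\<^sup>+ z. ennreal (norm (STFT \<psi> train z) powr p) \<partial>lborel) = top"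
proof (rule ccontr)
  assume nt: "(\<integral>\<^sup>+ z. ennreal (norm (STFT \<psi> train z) powr p) \<partial>lborel) \<noteq> top"
  define I where "I = enn2real (\<integral>\<^sup>+ z. ennreal (norm (STFT \<psi> train z) powr p) \<partial>lborel)"
  have I: "(\<integral>\<^sup>+ z. ennreal (norm (STFT \<psi> train z) powr p) \<partial>lborel) = ennreal I" "I \<ge> 0"
    using nt by (auto simp: I_def less_top)
  define m where "m = enn2real (\<integral>\<^sup>+ t. ennreal ((norm (\<psi> t))\<^sup>2) \<partial>lborel)"
  have m: "(\<integral>\<^sup>+ t. ennreal ((norm (\<psi> t))\<^sup>2) \<partial>lborel) = ennreal m" "m > 0"
    using schwartz_L2_norm[OF \<psi>(1)] \<psi>(2) by (auto simp: m_def enn2real_positive_iff)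
  define r where "r = p / (p - 1)"
  have r: "r > 1" using p by (simp add: r_def field_simps)
  obtain C where C: "C \<ge> 0"
    "\<And>N. (\<integral>\<^sup>+ z. ennreal (norm (STFT \<psi> (piece N) z) powr r) \<partial>lborel) \<le> ennreal (C * plateau_integral r N)"
    using STFT_piece_Lr[OF \<psi>(1) r] by blast
  obtain K where K: "\<And>N. exp (real N - log_len N) powr r * plateau_integral r N \<le> K"
    using rescaled_plateau_integral_bounded[OF p] unfolding r_def by blast
  have K0: "K \<ge> 0" using K[of 0] plateau_integral_nonneg[OF r, of 0] by (meson mult_nonneg_nonneg order.trans powr_ge_zero)
  have bound: "exp (real N) * m \<le> I + C * K" for N
  proof -
    \<comment> \<open>With this multiple of the piece the left side of the duality inequality grows like
      \<open>exp (real N)\<close>, while the right side stays bounded.\<close>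
    define s where "s = exp (real N - log_len N)"
    have s: "s > 0" "4 * s * len N = 4 * exp (real N)"
      by (auto simp: s_def len_def exp_diff)
    have "ennreal (4 * exp (real N)) * ennreal m \<le>
      4 * (ennreal I + ennreal (s powr r) * (\<integral>\<^sup>+ z. ennreal (norm (STFT \<psi> (piece N) z) powr r) \<partial>lborel))"
      using train_duality[OF \<psi>(1) s(1) p(1), of N] unfolding I m s(2) r_def .
    also have "\<dots> \<le> 4 * (ennreal I + ennreal (s powr r) * ennreal (C * plateau_integral r N))"
      by (intro mult_left_mono add_left_mono C) auto
    also have "\<dots> = ennreal (4 * (I + s powr r * (C * plateau_integral r N)))"
      using I(2) C(1) plateau_integral_nonneg[OF r] by (simp add: ennreal_mult ennreal_plus)
    finally have "ennreal (4 * exp (real N) * m) \<le> ennreal (4 * (I + s powr r * (C * plateau_integral r N)))"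
      using m(2) by (simp only: ennreal_mult[symmetric] exp_ge_zero mult_nonneg_nonneg zero_le_numeral less_imp_le)
    then have "4 * exp (real N) * m \<le> 4 * (I + s powr r * (C * plateau_integral r N))"
      by (rule ennreal_le_iff[THEN iffD1, rotated])
         (use I(2) C(1) plateau_integral_nonneg[OF r, of N] in \<open>intro mult_nonneg_nonneg add_nonneg_nonneg, auto\<close>)
    also have "s powr r * (C * plateau_integral r N) = C * (s powr r * plateau_integral r N)" by simp
    also have "\<dots> \<le> C * K" using K[of N] C(1) unfolding s_def by (rule mult_left_mono)
    finally show ?thesis by simp
  qed
  obtain N :: nat where "(I + C * K) / m < real N" using reals_Archimedean2 by blast
  also have "real N < exp (real N)" using exp_ge_add_one_self[of "real N"] by linarith
  finally have "I + C * K < exp (real N) * m" using m(2) by (simp add: field_simps)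
  then show False using bound[of N] by simp
qed

theorem STFT_train_not_Lp:
  assumes \<psi>: "\<psi> \<in> schwartz" "\<psi> \<noteq> (\<lambda>_. 0)" and p: "1 \<le> p" "p < q"
  shows "(\<integral>\<^sup>+ z. ennreal (norm (STFT \<psi> train z) powr p) \<partial>lborel) = top"
proof -
  \<comment> \<open>The duality argument needs an exponent above 1.  The transform is bounded, so membership in
    \<open>L\<^sup>p\<close> would pass to any larger exponent, here one strictly between 1 and \<open>q\<close>.\<close>
  define p' where "p' = (p + q) / 2"
  have p': "1 < p'" "p' < q" "p \<le> p'" using p by (auto simp: p'_def)
  obtain B where B: "B > 0" "\<And>x. norm (\<psi> x) \<le> B" using schwartz_bounded[OF \<psi>(1)] by blast
  note [measurable] = STFT_measurable[OF \<psi>(1)]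
  have Vb: "norm (STFT \<psi> train z) \<le> B * \<alpha>" for z
  proof -
    obtain x w where z: "z = (x, w)" by (cases z)
    note [measurable] = schwartz_measurable[OF \<psi>(1)]
    have "norm (LINT t|lborel. train t * (cnj (\<psi> (t - x)) * cis (- (2 * pi * w * t)))) \<le> 1 * B * measure lborel {0..\<alpha>}"
      using B(2) by (intro integrable_bounded_support(2) train_bounded_support) (auto simp: norm_mult cis_conv_exp)
    then show ?thesis using \<alpha> by (simp add: z STFT_def mult.assoc)
  qed
  define c where "c = (B * \<alpha>) powr (p' - p)"
  have pw: "norm (STFT \<psi> train z) powr p' \<le> c * norm (STFT \<psi> train z) powr p" for z
  proof -
    have "norm (STFT \<psi> train z) powr p' = norm (STFT \<psi> train z) powr (p' - p) * norm (STFT \<psi> train z) powr p"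
      unfolding powr_add[symmetric] by simp
    also have "\<dots> \<le> c * norm (STFT \<psi> train z) powr p"
      unfolding c_def using p' by (intro mult_right_mono powr_mono2 Vb) auto
    finally show ?thesis .
  qed
  have "top = (\<integral>\<^sup>+ z. ennreal (norm (STFT \<psi> train z) powr p') \<partial>lborel)"
    by (rule STFT_train_not_Lp_gt_1[OF \<psi> p'(1,2), symmetric])
  also have "\<dots> \<le> (\<integral>\<^sup>+ z. ennreal c * ennreal (norm (STFT \<psi> train z) powr p) \<partial>lborel)"
    using pw by (intro nn_integral_mono) (auto simp: ennreal_mult[symmetric] c_def intro: ennreal_leI)
  also have "\<dots> = ennreal c * (\<integral>\<^sup>+ z. ennreal (norm (STFT \<psi> train z) powr p) \<partial>lborel)"
    by (rule nn_integral_cmult) measurable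
  finally show ?thesis
    by (metis ennreal_mult_less_top ennreal_less_top less_top top.extremum_unique)
qed

end

lemma gabor_parseval_window_exists:
  fixes \<alpha> \<beta> q :: real and \<psi> :: "real \<Rightarrow> complex"
  assumes \<psi>: "\<psi> \<in> schwartz" "\<psi> \<noteq> (\<lambda>_. 0)"
    and \<alpha>: "\<alpha> > 0" and \<beta>: "\<beta> > 0" and \<alpha>\<beta>: "\<alpha> * \<beta> \<le> 1" and q: "1 < q" "q \<le> 2"
  shows "\<exists>g \<in> L2. distribution_of g \<in> modulation_space \<psi> q \<and>
    is_parseval_frame (gabor_system g \<alpha> \<beta>) \<and>
    (\<forall>p. 1 \<le> p \<and> p < q \<longrightarrow> distribution_of g \<notin> modulation_space \<psi> p)"
proof -
  interpret chirp_train \<alpha> q using \<alpha> q by unfold_locales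
  note [measurable] = STFT_measurable[OF \<psi>(1)]
  define g where "g t = sqrt \<beta> * train t" for t
  have gm [measurable]: "g \<in> borel_measurable borel" unfolding g_def by measurable
  have ng: "norm (g t) = (if t \<in> {0..<\<alpha>} then sqrt \<beta> else 0)" for t
    using \<beta> by (simp add: g_def norm_mult norm_train indicator_def)
  have gb: "norm (g t) \<le> sqrt \<beta>" for t using ng[of t] \<beta> by simp
  have gs: "g t = 0" if "t \<notin> {0..\<alpha>}" for t using train_bounded_support(3)[OF that] by (simp add: g_def)
  have "(\<integral>\<^sup>+ t. ennreal ((norm (g t))\<^sup>2) \<partial>lborel) = (\<integral>\<^sup>+ t. ennreal \<beta> * indicator {0..<\<alpha>} t \<partial>lborel)"
    using \<beta> by (intro nn_integral_cong) (auto simp: ng)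
  also have "\<dots> < top" using \<alpha> by (simp add: nn_integral_cmult_indicator ennreal_mult_less_top)
  finally have L2: "g \<in> L2" by (simp add: L2_iff)
  have Sg: "STFT \<psi> g z = sqrt \<beta> * STFT \<psi> train z" for z
    using STFT_add_scaled[where g="\<lambda>_. 0" and K=0 and c="sqrt \<beta>" and z=z, OF \<psi>(1) _ _ _ train_bounded_support]
    by (simp add: g_def[abs_def] STFT_def split: prod.splits)
  have scaled: "(\<integral>\<^sup>+ z. ennreal (norm (STFT \<psi> g z) powr p) \<partial>lborel) =
     ennreal (sqrt \<beta> powr p) * (\<integral>\<^sup>+ z. ennreal (norm (STFT \<psi> train z) powr p) \<partial>lborel)" for p
  proof -
    have "(\<integral>\<^sup>+ z. ennreal (norm (STFT \<psi> g z) powr p) \<partial>lborel) =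
      (\<integral>\<^sup>+ z. ennreal (sqrt \<beta> powr p) * ennreal (norm (STFT \<psi> train z) powr p) \<partial>lborel)"
      using \<beta> by (intro nn_integral_cong) (simp add: Sg norm_mult powr_mult ennreal_mult)
    also have "\<dots> = ennreal (sqrt \<beta> powr p) * (\<integral>\<^sup>+ z. ennreal (norm (STFT \<psi> train z) powr p) \<partial>lborel)"
      by (rule nn_integral_cmult) measurable
    finally show ?thesis .
  qed
  have mem: "distribution_of g \<in> modulation_space \<psi> p \<longleftrightarrow>
    ennreal (sqrt \<beta> powr p) * (\<integral>\<^sup>+ z. ennreal (norm (STFT \<psi> train z) powr p) \<partial>lborel) < top" for p
    unfolding scaled[symmetric] by (rule modulation_space_distribution_of_iff[OF \<psi>(1) gm gb gs])
  have "distribution_of g \<in> modulation_space \<psi> q"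
    using STFT_train_Lq[OF \<psi>(1)] by (simp add: mem ennreal_mult_less_top)
  moreover have "distribution_of g \<notin> modulation_space \<psi> p" if "1 \<le> p" "p < q" for p
    using STFT_train_not_Lp[OF \<psi> that] \<beta> by (simp add: mem ennreal_mult_top)
  moreover have "is_parseval_frame (gabor_system g \<alpha> \<beta>)"
    using parseval_frame_constant_modulus[OF \<alpha> \<beta> \<alpha>\<beta> _ ng] by simp
  ultimately show ?thesis using L2 by blast
qed

theorem theorem4p5:
  fixes \<psi> :: "real \<Rightarrow> complex"
  assumes "\<psi> \<in> schwartz" and "\<psi> \<noteq> (\<lambda>_. 0)"
  shows
    "(\<forall>\<alpha> \<beta> q :: real. \<alpha> > 0 \<longrightarrow> \<beta> > 0 \<longrightarrow> \<alpha> * \<beta> \<le> 1 \<longrightarrow> 1 < q \<longrightarrow> q \<le> 2 \<longrightarrow>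
        (\<exists>g \<in> L2. distribution_of g \<in> modulation_space \<psi> q \<and>
           is_frame (gabor_system g \<alpha> \<beta>) \<and>
           (\<forall>p. 1 \<le> p \<and> p < q \<longrightarrow> distribution_of g \<notin> modulation_space \<psi> p)))
     \<and>
     (\<forall>\<alpha> \<beta> :: real. \<alpha> > 0 \<longrightarrow> \<beta> > 0 \<longrightarrow> \<alpha> * \<beta> \<le> 1 / 2 \<longrightarrow>
        (\<exists>g \<in> L2. distribution_of g \<in> modulation_space \<psi> 2 \<and>
           is_parseval_frame (gabor_system g \<alpha> \<beta>) \<and>
           (\<forall>p. 1 \<le> p \<and> p < 2 \<longrightarrow> distribution_of g \<notin> modulation_space \<psi> p)))"
proof (intro conjI allI impI)
  fix \<alpha> \<beta> q :: real
  assume "\<alpha> > 0" "\<beta> > 0" "\<alpha> * \<beta> \<le> 1" "1 < q" "q \<le> 2"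
  then show "\<exists>g \<in> L2. distribution_of g \<in> modulation_space \<psi> q \<and>
           is_frame (gabor_system g \<alpha> \<beta>) \<and>
           (\<forall>p. 1 \<le> p \<and> p < q \<longrightarrow> distribution_of g \<notin> modulation_space \<psi> p)"
    using gabor_parseval_window_exists[OF assms] parseval_frame_imp_frame by meson
next
  fix \<alpha> \<beta> :: real
  assume "\<alpha> > 0" "\<beta> > 0" "\<alpha> * \<beta> \<le> 1 / 2"
  then show "\<exists>g \<in> L2. distribution_of g \<in> modulation_space \<psi> 2 \<and>
           is_parseval_frame (gabor_system g \<alpha> \<beta>) \<and>
           (\<forall>p. 1 \<le> p \<and> p < 2 \<longrightarrow> distribution_of g \<notin> modulation_space \<psi> p)"
    by (intro gabor_parseval_window_exists[OF assms]) auto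
qed

end
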